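(* Let $0<q<1$. For nonzero complex $\alpha,\beta,x,z$, $$\frac{\bigl(q\beta xz,-\frac{qxz}{\beta},\frac{q^{\frac{3}{2}}xz}{\alpha},-q^{\frac{1}{2}}\alpha xz;q\bigr)_{\infty}}{\bigl(q^{\frac{1}{2}}x,-q^{\frac{3}{2}}xz^2,\frac{q^2\beta xz^2}{\alpha};q\bigr)_{\infty}}\;{}_8W_7\Bigl(-q^{\frac{1}{2}}xz^2;\frac{qz}{\alpha},-\frac{q^{\frac{1}{2}}z}{\beta},-\alpha z,q^{\frac{1}{2}}\beta z,-q^{\frac{1}{2}}x;q,-q^{\frac{1}{2}}x\Bigr)$$ $$=\frac{\bigl(-\frac{q^2xz^2}{\alpha\beta},-q\alpha\beta xz^2,-\frac{q\alpha x}{\beta};q^2\bigr)_{\infty}}{\bigl(-\frac{q^3\beta xz^4}{\alpha};q^2\bigr)_{\infty}}\;{}_8W_7\Bigl(-\frac{q\beta xz^4}{\alpha};\frac{q^2z^2}{\alpha^2},-qz^2,-z^2,q\beta^2z^2,-\frac{q\beta x}{\alpha};q^2,-\frac{q\alpha x}{\beta}\Bigr)$$ if both $|q^{\frac{1}{2}}x|<1$ and $|\frac{q\alpha x}{\beta}|<1$, as an identity of meromorphic functions in $(\alpha,\beta,x,z)$.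
   Context: $q$-shifted factorials: $(a_1,\ldots,a_m;p)_j=\prod_{r=1}^m\prod_{i=0}^{j-1}(1-a_rp^i)$ for $j\in\mathbb{Z}_{\geq 0}\cup\{\infty\}$. $q^{1/2}$ denotes the positive square root. Very-well-poised series in base $p$ ($0<p<1$): $${}_8W_7(\alpha_0;\alpha_1,\ldots,\alpha_5;p,u)=\sum_{r=0}^\infty\frac{1-\alpha_0p^{2r}}{1-\alpha_0}u^r\prod_{j=0}^5\frac{(\alpha_j;p)_r}{(p\alpha_0/\alpha_j;p)_r},\qquad |u|<1.$$ In the identity the left-hand series has base $q$ and the right-hand series has base $q^2$. *)

theory Defs
  imports "HOL-Analysis.Analysis"
begin

definition qpoch :: "complex \<Rightarrow> complex \<Rightarrow> nat \<Rightarrow> complex" where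
  "qpoch a p n = (\<Prod>i<n. 1 - a * p ^ i)"

definition qpoch_inf :: "complex list \<Rightarrow> complex \<Rightarrow> complex" where
  "qpoch_inf as p = (\<Prod>a\<leftarrow>as. \<Prod>i. 1 - a * p ^ i)"

definition W87 :: "complex \<Rightarrow> complex list \<Rightarrow> complex \<Rightarrow> complex \<Rightarrow> complex" where
  "W87 a0 as p u =
     (\<Sum>r. (1 - a0 * p ^ (2 * r)) / (1 - a0) * u ^ r *
        (\<Prod>a\<leftarrow>a0 # as. qpoch a p r / qpoch (p * a0 / a) p r))"

text \<open>No denominator occurring in a term of the series vanishes.\<close>

definition W87_defined :: "complex \<Rightarrow> complex list \<Rightarrow> complex \<Rightarrow> bool" where
  "W87_defined a0 as p \<longleftrightarrow>
     a0 \<noteq> 1 \<and> (\<forall>a\<in>set (a0 # as). a \<noteq> 0 \<and> (\<forall>r. qpoch (p * a0 / a) p r \<noteq> 0))"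

text \<open>
  Holomorphy in several variables: continuous, and complex differentiable in each variable
  separately (equivalent to the other usual definitions by Osgood's lemma).
\<close>

definition holomorphic_several :: "(complex ^ 'n \<Rightarrow> complex) \<Rightarrow> (complex ^ 'n) set \<Rightarrow> bool" where
  "holomorphic_several f S \<longleftrightarrow>
     open S \<and> continuous_on S f \<and>
     (\<forall>w\<in>S. \<forall>i. (\<lambda>t. f (\<chi> j. if j = i then t else w $ j)) field_differentiable at (w $ i))"

text \<open>
  A total function represents a meromorphic function on \<open>S\<close> if locally it is a quotient of
  holomorphic functions, the denominator not vanishing identically on any nonempty open set.
  The values at zeros of the denominator are irrelevant.
\<close>

definition meromorphic_several :: "(complex ^ 'n \<Rightarrow> complex) \<Rightarrow> (complex ^ 'n) set \<Rightarrow> bool" where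
  "meromorphic_several f S \<longleftrightarrow>
     open S \<and>
     (\<forall>w\<in>S. \<exists>U g h. w \<in> U \<and> U \<subseteq> S \<and>
        holomorphic_several g U \<and> holomorphic_several h U \<and>
        interior {v \<in> U. h v = 0} = {} \<and>
        (\<forall>v\<in>U. h v \<noteq> 0 \<longrightarrow> f v = g v / h v))"

text \<open>
  Below \<open>Q\<close>, \<open>h\<close>, \<open>t\<close> are $q$, $q^{1/2}$, $q^{3/2}$. The parameters of each series and the
  denominator parameters of its prefactor are named, so that the points where a denominator
  vanishes can be described.
\<close>

definition left_a0 :: "real \<Rightarrow> complex \<Rightarrow> complex \<Rightarrow> complex" where
  "left_a0 q x z = - of_real (q powr (1/2)) * x * z ^ 2"

definition left_params :: "real \<Rightarrow> complex \<Rightarrow> complex \<Rightarrow> complex \<Rightarrow> complex \<Rightarrow> complex list" where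
  "left_params q \<alpha> \<beta> x z =
     (let Q = of_real q; h = of_real (q powr (1/2)) in
        [Q * z / \<alpha>, - (h * z / \<beta>), - \<alpha> * z, h * \<beta> * z, - h * x])"

definition left_denom :: "real \<Rightarrow> complex \<Rightarrow> complex \<Rightarrow> complex \<Rightarrow> complex \<Rightarrow> complex" where
  "left_denom q \<alpha> \<beta> x z =
     (let Q = of_real q; h = of_real (q powr (1/2)); t = of_real (q powr (3/2)) in
        qpoch_inf [h * x, - t * x * z ^ 2, Q ^ 2 * \<beta> * x * z ^ 2 / \<alpha>] Q)"

definition left_side :: "real \<Rightarrow> complex \<Rightarrow> complex \<Rightarrow> complex \<Rightarrow> complex \<Rightarrow> complex" where
  "left_side q \<alpha> \<beta> x z =
     (let Q = of_real q; h = of_real (q powr (1/2)); t = of_real (q powr (3/2)) in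
        qpoch_inf [Q * \<beta> * x * z, - (Q * x * z / \<beta>), t * x * z / \<alpha>, - h * \<alpha> * x * z] Q
        / left_denom q \<alpha> \<beta> x z
        * W87 (left_a0 q x z) (left_params q \<alpha> \<beta> x z) Q (- h * x))"

definition right_a0 :: "real \<Rightarrow> complex \<Rightarrow> complex \<Rightarrow> complex \<Rightarrow> complex \<Rightarrow> complex" where
  "right_a0 q \<alpha> \<beta> x z = - (of_real q * \<beta> * x * z ^ 4 / \<alpha>)"

definition right_params :: "real \<Rightarrow> complex \<Rightarrow> complex \<Rightarrow> complex \<Rightarrow> complex \<Rightarrow> complex list" where
  "right_params q \<alpha> \<beta> x z =
     (let Q = of_real q in
        [Q ^ 2 * z ^ 2 / \<alpha> ^ 2, - Q * z ^ 2, - (z ^ 2), Q * \<beta> ^ 2 * z ^ 2, - (Q * \<beta> * x / \<alpha>)])"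

definition right_denom :: "real \<Rightarrow> complex \<Rightarrow> complex \<Rightarrow> complex \<Rightarrow> complex \<Rightarrow> complex" where
  "right_denom q \<alpha> \<beta> x z =
     (let Q = of_real q in qpoch_inf [- (Q ^ 3 * \<beta> * x * z ^ 4 / \<alpha>)] (Q ^ 2))"

definition right_side :: "real \<Rightarrow> complex \<Rightarrow> complex \<Rightarrow> complex \<Rightarrow> complex \<Rightarrow> complex" where
  "right_side q \<alpha> \<beta> x z =
     (let Q = of_real q in
        qpoch_inf [- (Q ^ 2 * x * z ^ 2 / (\<alpha> * \<beta>)), - Q * \<alpha> * \<beta> * x * z ^ 2, - (Q * \<alpha> * x / \<beta>)] (Q ^ 2)
        / right_denom q \<alpha> \<beta> x z
        * W87 (right_a0 q \<alpha> \<beta> x z) (right_params q \<alpha> \<beta> x z) (Q ^ 2) (- (Q * \<alpha> * x / \<beta>)))"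

definition param_domain :: "real \<Rightarrow> complex \<Rightarrow> complex \<Rightarrow> complex \<Rightarrow> complex \<Rightarrow> bool" where
  "param_domain q \<alpha> \<beta> x z \<longleftrightarrow>
     \<alpha> \<noteq> 0 \<and> \<beta> \<noteq> 0 \<and> x \<noteq> 0 \<and> z \<noteq> 0 \<and>
     norm (of_real (q powr (1/2)) * x) < 1 \<and> norm (of_real q * \<alpha> * x / \<beta>) < 1"

end

theory Submission
  imports Defs "HOL-Complex_Analysis.Conformal_Mappings"
begin

text \<open>
  Write \<open>Q\<close> for \<open>q\<close> and \<open>h\<close> for its square root. The idea is to hold \<open>\<alpha>\<close>, \<open>z\<close> and \<open>s = \<beta> x\<close> fixed and to
  let \<open>v = 1 / \<beta>\<close> vary. In these coordinates each series has exactly one parameter \<open>D\<close> that is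
  singular at \<open>v = 0\<close>, namely \<open>h z / v\<close> on the left and \<open>Q z\<^sup>2 / v\<^sup>2\<close> on the right, and it enters the
  \<open>r\<close>-th term only through \<open>u\<^sup>r (D; p)\<^sub>r\<close>, the product of the factors \<open>u - u D p\<^sup>i\<close> with \<open>i < r\<close>. Since
  \<open>u D\<close> does not depend on \<open>v\<close>, this is holomorphic at \<open>v = 0\<close>. After multiplication by suitable
  infinite products, both sides therefore become sums of series that are holomorphic in \<open>v\<close> on the
  star-shaped set \<open>\<bar>h s v\<bar> < 1\<close>, \<open>\<bar>Q \<alpha> s v\<^sup>2\<bar> < 1\<close> around \<open>0\<close> (\<open>left_side_regularized\<close>,
  \<open>right_side_regularized\<close>). At the points \<open>v = h z Q\<^sup>n\<close> both series terminate, and these points tend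
  to \<open>0\<close>. By the identity theorem it is enough to prove the terminating identity
  (\<open>sides_equal_terminating\<close>); the general one follows in \<open>regularized_identity\<close>.

  The terminating identity is a chain of finite transformations, all obtained from the Bailey lemma,
  that is, from an interchange of two sums and the q-Saalschuetz summation. With \<open>a = \<alpha> s z\<^sup>2\<close>, a
  terminating \<open>8W7\<close> transformation (\<open>Bailey_transformation\<close>) in base \<open>Q\<close> takes the left series to the
  \<open>8W7\<close> series with leading parameter \<open>a\<close> and further parameters \<open>\<alpha> s, \<alpha> z, -\<alpha> z, Q\<^sup>-\<^sup>n, -Q\<^sup>-\<^sup>n\<close>. The
  parameters that come in pairs of opposite sign combine to factorials in base \<open>Q\<^sup>2\<close>, so that this
  series is also an output of the Bailey lemma in base \<open>Q\<^sup>2\<close>, relative to \<open>a\<^sup>2\<close>. The matching inner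
  sum is a \<open>6\<phi>5\<close> in base \<open>Q\<close> (\<open>quadratic_Bailey_pair\<close>). What remains is a balanced \<open>4\<phi>3\<close> in base
  \<open>Q\<^sup>2\<close>, which \<open>Watson_transformation\<close> and one more \<open>8W7\<close> transformation turn into the right series.
  Some of the intermediate denominators can vanish where the two sides are defined, but only for
  finitely many values of \<open>s\<close>; the identity is proved away from these and extended by continuity
  (\<open>terminating_quadratic\<close>).

  The same regularised series show that each side is, on the whole domain, a quotient of two
  holomorphic functions whose denominator is a product of functions \<open>(c m; p)\<^sub>\<infinity>\<close> with monomials \<open>m\<close>. Along
  a curve \<open>(\<alpha>, \<beta>, t x, t z)\<close> with \<open>t > 0\<close> such a denominator has only countably many zeros, so its zero
  set has empty interior (\<open>interior_zeros_empty\<close>).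
\<close>

section \<open>Finite q-shifted factorials and the Bailey lemma\<close>

lemma qpoch_0 [simp]: "qpoch a p 0 = 1"
  by (simp add: qpoch_def)

lemma qpoch_Suc: "qpoch a p (Suc n) = qpoch a p n * (1 - a * p ^ n)"
  by (simp add: qpoch_def)

lemma qpoch_add: "qpoch a p (m + n) = qpoch a p m * qpoch (a * p ^ m) p n"
  by (induction n) (simp_all add: qpoch_Suc power_add mult.assoc)

lemma qpoch_nonzero_le: "qpoch a p n \<noteq> 0 \<Longrightarrow> m \<le> n \<Longrightarrow> qpoch a p m \<noteq> 0"
  by (metis le_add_diff_inverse mult_zero_left qpoch_add)

lemma qpoch_square: "qpoch (a\<^sup>2) (p\<^sup>2) n = qpoch a p n * qpoch (- a) p n"
  by (induction n) (simp_all add: qpoch_Suc power_mult [symmetric] algebra_simps power2_eq_square power_mult_distrib)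

lemma qpoch_double: "qpoch a p (2 * n) = qpoch a (p\<^sup>2) n * qpoch (a * p) (p\<^sup>2) n"
proof (induction n)
  case (Suc n)
  have "(p\<^sup>2) ^ n = p ^ (2 * n)" by (simp add: power_mult)
  with Suc show ?case by (simp add: qpoch_Suc mult_ac)
qed simp

text \<open>This is \<open>p\<close> to the power \<open>r (r - 1) / 2\<close>, written so that no exponent has to be divided.\<close>

definition tri_power :: "complex \<Rightarrow> nat \<Rightarrow> complex" where
  "tri_power p r = (\<Prod>i<r. p ^ i)"

lemma tri_power_0 [simp]: "tri_power p 0 = 1"
  by (simp add: tri_power_def)

lemma tri_power_Suc: "tri_power p (Suc r) = tri_power p r * p ^ r"
  by (simp add: tri_power_def)

text \<open>Reversal of the factors of a q-shifted factorial, with all divisions cleared except the one in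
  the parameter. It is used for \<open>c = p\<close> and \<open>c = - p\<close>, where the parameter becomes \<open>p\<^sup>-\<^sup>n\<close> and \<open>- p\<^sup>-\<^sup>n\<close>.\<close>

lemma qpoch_reverse:
  assumes "r \<le> n" "c \<noteq> 0" "p \<noteq> 0"
  shows "qpoch (p / (c * p ^ n)) p r * (c * p ^ n) ^ r * qpoch c p (n - r)
           = (- 1) ^ r * (tri_power p r * p ^ r) * qpoch c p n"
  using assms(1)
proof (induction r)
  case (Suc r)
  define m where "m = n - Suc r"
  have n: "n = m + Suc r" and nr: "n - r = Suc m"
    using Suc.prems by (auto simp: m_def)
  have IH: "qpoch (p / (c * p ^ n)) p r * (c * p ^ n) ^ r * (qpoch c p m * (1 - c * p ^ m))
           = (- 1) ^ r * (tri_power p r * p ^ r) * qpoch c p n"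
    using Suc nr by (simp add: qpoch_Suc)
  have last: "(1 - p / (c * p ^ n) * p ^ r) * (c * p ^ n) = - (p ^ Suc r) * (1 - c * p ^ m)"
    using assms by (simp add: n power_add field_simps)
  have "qpoch (p / (c * p ^ n)) p (Suc r) * (c * p ^ n) ^ Suc r * qpoch c p (n - Suc r)
      = (qpoch (p / (c * p ^ n)) p r * (c * p ^ n) ^ r * qpoch c p m)
        * ((1 - p / (c * p ^ n) * p ^ r) * (c * p ^ n))"
    by (simp add: qpoch_Suc m_def)
  also have "\<dots> = (qpoch (p / (c * p ^ n)) p r * (c * p ^ n) ^ r * (qpoch c p m * (1 - c * p ^ m))) * - (p ^ Suc r)"
    unfolding last by simp
  also have "\<dots> = (- 1) ^ Suc r * (tri_power p (Suc r) * p ^ Suc r) * qpoch c p n"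
    unfolding IH by (simp add: tri_power_Suc)
  finally show ?case .
qed simp

text \<open>The summand of a terminating balanced \<open>3\<phi>2\<close> series with \<open>j + m\<close> as the terminating index. The
  third numerator parameter and the second denominator parameter have been reversed, which turns
  the summation formula into a polynomial identity in \<open>a\<close>, \<open>b\<close> and \<open>g\<close>.\<close>

definition saal_term where
  "saal_term a b g p j m = qpoch a p j * qpoch b p j * qpoch g p m * g ^ j
     * qpoch (a * b * g * p ^ j) p m / (qpoch p p j * qpoch p p m)"

text \<open>The sum satisfies a first-order recurrence in \<open>n\<close> with factor \<open>K\<close>, because the difference of
  consecutive summands telescopes with the certificate \<open>G\<close>, as in the Wilf-Zeilberger method. The value of
  \<open>G\<close> at the upper end accounts for the extra summand of the longer sum.\<close>

lemma q_Saalschuetz: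
  assumes p: "\<And>n. qpoch p p n \<noteq> 0"
  shows "(\<Sum>j\<le>n. saal_term a b g p j (n - j)) = qpoch (a * g) p n * qpoch (b * g) p n / qpoch p p n"
proof (induction n)
  case (Suc n)
  define K where "K = (1 - a * g * p ^ n) * (1 - b * g * p ^ n)"
  define G where "G j = (case j of 0 \<Rightarrow> 0 | Suc i \<Rightarrow>
      - g * p ^ (n - i) * (1 - a * p ^ i) * (1 - b * p ^ i) * saal_term a b g p i (n - i))" for j
  have nz: "1 - p * p ^ i \<noteq> 0" for i
    using p[of "Suc i"] by (auto simp: qpoch_Suc)
  have step: "(1 - p * p ^ n) * saal_term a b g p j (Suc n - j) - K * saal_term a b g p j (n - j)
              = G (Suc j) - G j" if "j \<le> n" for j
  proof (cases j)
    case 0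
    have "qpoch (a * b * g) p (Suc n) = qpoch (a * b * g) p n * (1 - a * b * g * p ^ n)"
      by (simp add: qpoch_Suc)
    then show ?thesis
      using nz[of n] p[of n] by (simp add: 0 G_def K_def saal_term_def qpoch_Suc field_simps)
  next
    case (Suc i)
    define m where "m = n - j"
    have n: "n = Suc (m + i)" using that Suc by (simp add: m_def)
    define X where "X = a * b * g * p ^ i"
    have X: "qpoch X p (Suc m) = (1 - X) * qpoch (X * p) p m"
      using qpoch_add[of X p 1 m] by (simp add: qpoch_def)
    have X2: "qpoch (X * p) p (Suc m) = qpoch (X * p) p m * (1 - X * p * p ^ m)"
      by (simp add: qpoch_Suc)
    have e: "a * b * g * p ^ Suc i = X * p" "a * b * g * p ^ i = X" by (auto simp: X_def)
    have d: "Suc n - j = Suc m" "n - j = m" "n - i = Suc m" "j = Suc i" using n Suc by auto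
    define y where "y = p ^ i" define N where "N = p ^ m"
    have pn: "p ^ n = p * y * N" by (simp add: n y_def N_def power_add)
    have nzN: "1 - p * N \<noteq> 0" and nzy: "1 - p * y \<noteq> 0" using nz by (auto simp: N_def y_def)
    define C where "C = qpoch a p i * qpoch b p i * qpoch g p m * g ^ i * qpoch (X * p) p m
        / (qpoch p p i * qpoch p p m)"
    have s1: "saal_term a b g p (Suc i) (Suc m) = C * ((1 - a * y) * (1 - b * y) * (1 - g * N) * g
        * (1 - X * p * N) / ((1 - p * y) * (1 - p * N)))"
      unfolding saal_term_def e X2 by (simp add: C_def qpoch_Suc y_def N_def mult_ac)
    have s2: "saal_term a b g p (Suc i) m = C * ((1 - a * y) * (1 - b * y) * g / (1 - p * y))"
      unfolding saal_term_def e by (simp add: C_def qpoch_Suc y_def N_def mult_ac)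
    have s3: "saal_term a b g p i (Suc m) = C * ((1 - g * N) * (1 - X) / (1 - p * N))"
      unfolding saal_term_def e X by (simp add: C_def qpoch_Suc y_def N_def mult_ac)
    have Xy: "X = a * b * g * y" by (simp add: X_def y_def)
    define F where "F = C * ((1 - a * y) * (1 - b * y) * g / ((1 - p * y) * (1 - p * N)))"
    have f1: "saal_term a b g p (Suc i) (Suc m) = F * ((1 - g * N) * (1 - X * p * N))"
      unfolding s1 F_def by simp
    have f2: "saal_term a b g p (Suc i) m = F * (1 - p * N)"
      unfolding s2 F_def using nzN by simp
    have f3: "g * (1 - a * y) * (1 - b * y) * saal_term a b g p i (Suc m)
        = F * ((1 - g * N) * (1 - X) * (1 - p * y))"
      unfolding s3 F_def using nzy by simp
    have G1: "G (Suc (Suc i)) = - N * g * (1 - a * (p * y)) * (1 - b * (p * y)) * saal_term a b g p (Suc i) m"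
      by (simp add: G_def d(2)[unfolded d(4)] y_def N_def)
    have "G (Suc i) = - g * p ^ Suc m * (1 - a * y) * (1 - b * y) * saal_term a b g p i (Suc m)"
      by (simp add: G_def d(3) y_def)
    also have "\<dots> = - (p * N) * (g * (1 - a * y) * (1 - b * y) * saal_term a b g p i (Suc m))"
      by (simp add: N_def)
    finally have G2: "G (Suc i) = - (p * N) * (F * ((1 - g * N) * (1 - X) * (1 - p * y)))"
      unfolding f3 .
    \<comment> \<open>All four terms are multiples of the common factor \<open>F\<close>; the cofactors cancel identically.\<close>
    have "(1 - p * p ^ n) * saal_term a b g p (Suc i) (Suc m) - K * saal_term a b g p (Suc i) m
       - (G (Suc (Suc i)) - G (Suc i))
      = F *
        ((1 - p * (p * y * N)) * (1 - g * N) * (1 - X * p * N)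
         - (1 - a * g * (p * y * N)) * (1 - b * g * (p * y * N)) * (1 - p * N)
         + N * (1 - a * (p * y)) * (1 - b * (p * y)) * g * (1 - p * N)
         - N * p * (1 - g * N) * (1 - X) * (1 - p * y))"
      unfolding f1 f2 G1 G2 K_def pn by (simp add: algebra_simps)
    also have "\<dots> = 0"
      unfolding Xy by (simp add: algebra_simps)
    finally show ?thesis by (simp add: d d(2)[unfolded d(4)])
  qed
  have Glast: "G (Suc n) = - (1 - p * p ^ n) * saal_term a b g p (Suc n) 0"
    using nz[of n] p[of n] by (simp add: G_def saal_term_def qpoch_Suc field_simps)
  have "(1 - p * p ^ n) * (\<Sum>j\<le>n. saal_term a b g p j (Suc n - j))
        - K * (\<Sum>j\<le>n. saal_term a b g p j (n - j)) = (\<Sum>j\<le>n. G (Suc j) - G j)"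
    unfolding sum_distrib_left sum_subtractf [symmetric]
    by (intro sum.cong) (auto simp: step)
  also have "\<dots> = G (Suc n)"
    by (simp only: lessThan_Suc_atMost [symmetric] sum_lessThan_telescope) (simp add: G_def)
  finally have "(1 - p * p ^ n) * (\<Sum>j\<le>Suc n. saal_term a b g p j (Suc n - j))
      = K * (\<Sum>j\<le>n. saal_term a b g p j (n - j))"
    unfolding sum.atMost_Suc diff_self_eq_0 Glast
    by (simp add: distrib_left) (simp add: algebra_simps)
  then show ?case
    unfolding Suc using nz[of n] p[of n] by (simp add: qpoch_Suc K_def field_simps)
qed (simp add: saal_term_def)

text \<open>Sequences \<open>A\<close> and \<open>bailey_sum a p A\<close> form a Bailey pair relative to \<open>a\<close> in base \<open>p\<close>.\<close>

definition bailey_sum :: "complex \<Rightarrow> complex \<Rightarrow> (nat \<Rightarrow> complex) \<Rightarrow> nat \<Rightarrow> complex" where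
  "bailey_sum a p A n = (\<Sum>r\<le>n. A r / (qpoch p p (n - r) * qpoch (a * p) p (n + r)))"

text \<open>The contribution of one parameter \<open>b\<close> to a well-poised series with leading parameter \<open>a\<close>.\<close>

definition wp :: "complex \<Rightarrow> complex \<Rightarrow> complex \<Rightarrow> nat \<Rightarrow> complex" where
  "wp a p b r = qpoch b p r / qpoch (a * p / b) p r"

lemma sum_from:
  fixes f :: "nat \<Rightarrow> complex"
  assumes "r \<le> n"
  shows "(\<Sum>j\<le>n. if r \<le> j then f j else 0) = (\<Sum>m\<le>n - r. f (r + m))"
proof -
  have "(\<Sum>j\<le>n. if r \<le> j then f j else 0) = sum f {j. j \<le> n \<and> r \<le> j}"
    by (simp add: sum.If_cases Int_def)
  also have "{j. j \<le> n \<and> r \<le> j} = (\<lambda>m. r + m) ` {..n - r}"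
  proof (intro equalityI subsetI)
    fix j assume "j \<in> {j. j \<le> n \<and> r \<le> j}"
    then have "j = r + (j - r)" "j - r \<in> {..n - r}" by auto
    then show "j \<in> (\<lambda>m. r + m) ` {..n - r}" by (rule image_eqI)
  qed (use assms in auto)
  also have "sum f \<dots> = (\<Sum>m\<le>n - r. f (r + m))"
    by (subst sum.reindex) auto
  finally show ?thesis .
qed

text \<open>After the two summations are interchanged, the inner sum runs over \<open>j\<close> from \<open>r\<close> to \<open>n\<close>; shifting it
  by \<open>r\<close> gives the left-hand side of the q-Saalschuetz summation with parameters \<open>d p\<^sup>r\<close> and \<open>e p\<^sup>r\<close>.\<close>

lemma Bailey_lemma:
  assumes p: "\<And>n. qpoch p p n \<noteq> 0"
    and nz: "d \<noteq> 0" "e \<noteq> 0"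
    and dn: "qpoch (a * p / d) p n \<noteq> 0" and en: "qpoch (a * p / e) p n \<noteq> 0"
    and an: "qpoch (a * p) p (2 * n) \<noteq> 0"
  shows "qpoch (a * p / d) p n * qpoch (a * p / e) p n *
       bailey_sum a p (\<lambda>r. wp a p d r * wp a p e r * (a * p / (d * e)) ^ r * A r) n
     = (\<Sum>j\<le>n. qpoch d p j * qpoch e p j * qpoch (a * p / (d * e)) p (n - j) * (a * p / (d * e)) ^ j
          / qpoch p p (n - j) * bailey_sum a p A j)"
proof -
  define g where "g = a * p / (d * e)"
  have inner: "(\<Sum>m\<le>n - r. qpoch d p (r + m) * qpoch e p (r + m) * qpoch g p (n - (r + m)) * g ^ (r + m)
          / qpoch p p (n - (r + m)) * (1 / (qpoch p p (r + m - r) * qpoch (a * p) p (r + m + r))))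
      = qpoch (a * p / d) p n * qpoch (a * p / e) p n * wp a p d r * wp a p e r * g ^ r
         / (qpoch p p (n - r) * qpoch (a * p) p (n + r))" if r: "r \<le> n" for r
  proof -
    define N where "N = n - r"
    have n: "n = r + N" using r by (simp add: N_def)
    then have idx: "n + r = 2 * r + N" "n - r = N" by simp_all
    have dbl: "d * p ^ r * (e * p ^ r) * g = a * p * p ^ (2 * r)"
      using nz by (simp add: g_def mult_2 power_add)
    have top: "qpoch (a * p) p (2 * r + N) \<noteq> 0"
      using qpoch_nonzero_le[OF an, of "2 * r + N"] by (simp add: n)
    have term_eq: "qpoch d p (r + m) * qpoch e p (r + m) * qpoch g p (n - (r + m)) * g ^ (r + m)
          / qpoch p p (n - (r + m)) * (1 / (qpoch p p (r + m - r) * qpoch (a * p) p (r + m + r)))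
        = qpoch d p r * qpoch e p r * g ^ r / qpoch (a * p) p (2 * r + N)
            * saal_term (d * p ^ r) (e * p ^ r) g p m (N - m)" if m: "m \<le> N" for m
    proof -
      have "qpoch (a * p) p (2 * r + N) = qpoch (a * p) p ((2 * r + m) + (N - m))"
        using m by simp
      also have "\<dots> = qpoch (a * p) p (2 * r + m) * qpoch (a * p * p ^ (2 * r) * p ^ m) p (N - m)"
        by (simp add: qpoch_add power_add mult.assoc)
      finally have q: "qpoch (a * p) p (2 * r + N) = \<dots>" .
      then have "qpoch (a * p) p (2 * r + m) \<noteq> 0" "qpoch (a * p * p ^ (2 * r) * p ^ m) p (N - m) \<noteq> 0"
        using top by auto
      moreover have idx: "n - (r + m) = N - m" "r + m + r = 2 * r + m" "r + m - r = m" using m n by auto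
      ultimately show ?thesis
        unfolding saal_term_def dbl q idx qpoch_add[of d p r m] qpoch_add[of e p r m] power_add[of g r m]
        by (simp add: field_simps)
    qed
    have split: "qpoch (a * p / x) p n = qpoch (a * p / x) p r * qpoch (a * p / x * p ^ r) p N" for x
      by (simp add: n qpoch_add)
    have r0: "qpoch (a * p / d) p r \<noteq> 0" "qpoch (a * p / e) p r \<noteq> 0"
      using qpoch_nonzero_le dn en r by blast+
    have ex: "d * p ^ r * g = a * p / e * p ^ r" "e * p ^ r * g = a * p / d * p ^ r"
      using nz by (simp_all add: g_def)
    have "(\<Sum>m\<le>n - r. qpoch d p (r + m) * qpoch e p (r + m) * qpoch g p (n - (r + m)) * g ^ (r + m)
          / qpoch p p (n - (r + m)) * (1 / (qpoch p p (r + m - r) * qpoch (a * p) p (r + m + r))))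
      = qpoch d p r * qpoch e p r * g ^ r / qpoch (a * p) p (2 * r + N)
            * (\<Sum>m\<le>N. saal_term (d * p ^ r) (e * p ^ r) g p m (N - m))"
      unfolding sum_distrib_left N_def[symmetric] by (intro sum.cong refl term_eq) auto
    also have "\<dots> = qpoch d p r * qpoch e p r * g ^ r / qpoch (a * p) p (2 * r + N)
        * (qpoch (a * p / e * p ^ r) p N * qpoch (a * p / d * p ^ r) p N / qpoch p p N)"
      unfolding q_Saalschuetz[OF p] ex by simp
    also have "\<dots> = qpoch (a * p / d) p n * qpoch (a * p / e) p n * wp a p d r * wp a p e r * g ^ r
         / (qpoch p p (n - r) * qpoch (a * p) p (n + r))"
      unfolding split wp_def idx using r0 by (simp add: mult_ac)
    finally show ?thesis .
  qed
  define c where "c j = qpoch d p j * qpoch e p j * qpoch g p (n - j) * g ^ j / qpoch p p (n - j)" for j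
  have "(\<Sum>j\<le>n. c j * bailey_sum a p A j)
      = (\<Sum>j\<le>n. \<Sum>r\<le>n. if r \<le> j then c j * (1 / (qpoch p p (j - r) * qpoch (a * p) p (j + r))) * A r else 0)"
    unfolding bailey_sum_def sum_distrib_left
    by (intro sum.cong refl sum.mono_neutral_cong_left) auto
  also have "\<dots> = (\<Sum>r\<le>n. \<Sum>j\<le>n. if r \<le> j then c j * (1 / (qpoch p p (j - r) * qpoch (a * p) p (j + r))) * A r else 0)"
    by (rule sum.swap)
  also have "\<dots> = (\<Sum>r\<le>n. (\<Sum>m\<le>n - r. c (r + m) * (1 / (qpoch p p (r + m - r) * qpoch (a * p) p (r + m + r)))) * A r)"
    unfolding sum_distrib_right by (rule sum.cong [OF refl]) (simp only: sum_from atMost_iff)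
  also have "\<dots> = (\<Sum>r\<le>n. qpoch (a * p / d) p n * qpoch (a * p / e) p n * wp a p d r * wp a p e r * g ^ r
         / (qpoch p p (n - r) * qpoch (a * p) p (n + r)) * A r)"
    unfolding c_def by (intro sum.cong refl arg_cong2[where f = "(*)"] inner) auto
  also have "\<dots> = qpoch (a * p / d) p n * qpoch (a * p / e) p n *
       bailey_sum a p (\<lambda>r. wp a p d r * wp a p e r * g ^ r * A r) n"
    unfolding bailey_sum_def sum_distrib_left by (intro sum.cong refl) simp
  finally show ?thesis unfolding c_def g_def by simp
qed

text \<open>The unit Bailey pair: the very-well-poised factor, with the sign and power of \<open>p\<close> that turn
  \<open>1 / (p; p)\<^sub>n\<^sub>-\<^sub>r\<close> in \<open>bailey_sum\<close> into \<open>(p\<^sup>-\<^sup>n; p)\<^sub>r p\<^sup>n\<^sup>r\<close>, up to a factor \<open>(p; p)\<^sub>n\<close>.\<close>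

definition vwp :: "complex \<Rightarrow> complex \<Rightarrow> nat \<Rightarrow> complex" where
  "vwp a p r = (1 - a * p ^ (2 * r)) / (1 - a) * qpoch a p r / qpoch p p r * (- 1) ^ r * tri_power p r"

lemma qpoch_head: "a \<noteq> 1 \<Longrightarrow> qpoch a p (Suc r) / (1 - a) = qpoch (a * p) p r"
  using qpoch_add[of a p 1 r] by (simp add: qpoch_def)

text \<open>The partial sums up to any \<open>m < n\<close> are products (\<open>partial\<close> below), and adding the last term to
  the one for \<open>m = n - 1\<close> gives zero.\<close>

lemma bailey_sum_vwp:
  assumes p: "\<And>n. qpoch p p n \<noteq> 0" and a: "a \<noteq> 1" and an: "qpoch (a * p) p (2 * n) \<noteq> 0"
  shows "bailey_sum a p (vwp a p) n = (if n = 0 then 1 else 0)"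
proof (cases n)
  case 0
  then show ?thesis using a by (simp add: bailey_sum_def vwp_def)
next
  case (Suc k)
  have nz: "1 - p ^ Suc i \<noteq> 0" for i
    using p[of "Suc i"] by (auto simp: qpoch_Suc)
  define t where "t r = vwp a p r / (qpoch p p (n - r) * qpoch (a * p) p (n + r))" for r
  have vS: "vwp a p (Suc r) = (1 - a * p ^ (2 * Suc r)) * qpoch (a * p) p r / qpoch p p (Suc r)
      * (- 1) ^ Suc r * tri_power p (Suc r)" for r
    unfolding vwp_def qpoch_head[OF a, symmetric] by simp
  have partial: "(\<Sum>r\<le>m. t r) = qpoch (a * p) p m * (- 1) ^ m * tri_power p (Suc m)
      / (qpoch p p m * qpoch p p (n - Suc m) * (1 - p ^ n) * qpoch (a * p) p (n + m))"
    if "m < n" for m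
    using that
  proof (induction m)
    case 0
    have "qpoch p p n = qpoch p p k * (1 - p ^ n)" by (simp add: Suc qpoch_Suc)
    then show ?case using a by (simp add: t_def vwp_def Suc tri_power_Suc)
  next
    case (Suc m)
    define i where "i = n - Suc (Suc m)"
    have n: "n = Suc (Suc (m + i))" using Suc.prems by (simp add: i_def)
    define M where "M = p ^ Suc m"
    define I where "I = p ^ Suc i"
    have pn: "p ^ n = M * I" by (simp add: n M_def I_def power_add)
    have pnz: "1 - M * I \<noteq> 0" "1 - M \<noteq> 0" "1 - I \<noteq> 0"
      using nz[of "Suc (m + i)"] nz[of m] nz[of i] unfolding n[symmetric] pn by (simp_all add: M_def I_def)
    have e1: "qpoch p p (n - Suc m) = qpoch p p i * (1 - I)" "n - Suc (Suc m) = i"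
      by (simp_all add: n qpoch_Suc I_def)
    have e2: "qpoch (a * p) p (n + Suc m) = qpoch (a * p) p (n + m) * (1 - a * M * (M * I))"
      by (simp add: qpoch_Suc power_add pn M_def mult_ac)
    have "qpoch (a * p) p (n + Suc m) \<noteq> 0"
      using qpoch_nonzero_le[OF an] Suc.prems by simp
    then have e3: "1 - a * M * (M * I) \<noteq> 0" "qpoch (a * p) p (n + m) \<noteq> 0" unfolding e2 by auto
    have e4: "qpoch (a * p) p (Suc m) = qpoch (a * p) p m * (1 - a * M)"
      by (simp add: qpoch_Suc M_def mult_ac)
    have e5: "qpoch p p (Suc m) = qpoch p p m * (1 - M)"
      by (simp add: qpoch_Suc M_def)
    have e6: "tri_power p (Suc (Suc m)) = tri_power p (Suc m) * M"
      by (simp add: tri_power_Suc M_def)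
    have e7: "p ^ (2 * Suc m) = M * M" by (simp add: M_def mult_2 power_add)
    define D where "D = qpoch (a * p) p m * (- 1) ^ m * tri_power p (Suc m)
       / (qpoch p p (Suc m) * qpoch p p (n - Suc m) * qpoch (a * p) p (n + Suc m))"
    have d1: "(\<Sum>r\<le>m. t r) = D * ((1 - M) * (1 - a * M * (M * I)) / (1 - M * I))"
      using Suc e3 pnz unfolding D_def e2 e5 pn by (simp add: mult_ac)
    have d2: "t (Suc m) = - D * (1 - a * (M * M))"
      unfolding t_def vS e7 D_def by (simp add: mult_ac)
    have d3: "qpoch (a * p) p (Suc m) * (- 1) ^ Suc m * tri_power p (Suc (Suc m))
      / (qpoch p p (Suc m) * qpoch p p i * (1 - M * I) * qpoch (a * p) p (n + Suc m))
       = - D * ((1 - a * M) * M * (1 - I) / (1 - M * I))"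
      using pnz unfolding D_def e1 e4 e6 by (simp add: mult_ac)
    have "(1 - M) * (1 - a * M * (M * I)) / (1 - M * I) - (1 - a * (M * M))
        = - ((1 - a * M) * M * (1 - I) / (1 - M * I))"
      using pnz by (simp add: divide_simps) (simp add: algebra_simps)
    moreover have "D * X + - D * Y = - D * Z" if "X - Y = - Z" for X Y Z
      using that by (metis add.commute diff_conv_add_uminus minus_mult_commute mult_minus_right distrib_left)
    ultimately show ?case
      unfolding sum.atMost_Suc d1 d2 pn e1(2) d3 by blast
  qed
  have "qpoch (a * p) p (n + n) \<noteq> 0" using an by (simp add: mult_2)
  moreover have "qpoch (a * p) p (n + n) = qpoch (a * p) p (n + k) * (1 - a * p ^ (2 * n))"
    by (simp add: Suc qpoch_Suc mult_2)
  ultimately have last: "1 - a * p ^ (2 * n) \<noteq> 0" "qpoch (a * p) p (n + k) \<noteq> 0"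
    "qpoch (a * p) p (n + n) = qpoch (a * p) p (n + k) * (1 - a * p ^ (2 * n))" by auto
  have "bailey_sum a p (vwp a p) n = (\<Sum>r\<le>k. t r) + t n"
    by (simp add: bailey_sum_def t_def Suc)
  also have "(\<Sum>r\<le>k. t r) = qpoch (a * p) p k * (- 1) ^ k * tri_power p n
      / (qpoch p p k * (1 - p ^ n) * qpoch (a * p) p (n + k))"
    using partial[of k] by (simp add: Suc)
  also have "t n = - \<dots>"
    unfolding t_def last(3) using last p[of k] nz[of k] vS[of k] by (simp add: Suc[symmetric]) (simp add: Suc qpoch_Suc)
  finally show ?thesis by (simp add: Suc)
qed

text \<open>The Bailey lemma applied to the unit pair leaves only the term with \<open>j = 0\<close>.\<close>

lemma sum_6phi5:
  assumes p: "\<And>n. qpoch p p n \<noteq> 0" and a: "a \<noteq> 1" and an: "qpoch (a * p) p (2 * n) \<noteq> 0"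
    and nz: "d \<noteq> 0" "e \<noteq> 0"
    and dn: "qpoch (a * p / d) p n \<noteq> 0" and en: "qpoch (a * p / e) p n \<noteq> 0"
  shows "bailey_sum a p (\<lambda>r. wp a p d r * wp a p e r * (a * p / (d * e)) ^ r * vwp a p r) n
     = qpoch (a * p / (d * e)) p n / (qpoch p p n * qpoch (a * p / d) p n * qpoch (a * p / e) p n)"
proof -
  have unit: "bailey_sum a p (vwp a p) j = (if j = 0 then 1 else 0)" if "j \<le> n" for j
    by (rule bailey_sum_vwp[OF p a]) (use qpoch_nonzero_le[OF an] that in auto)
  have "qpoch (a * p / d) p n * qpoch (a * p / e) p n *
       bailey_sum a p (\<lambda>r. wp a p d r * wp a p e r * (a * p / (d * e)) ^ r * vwp a p r) n
     = (\<Sum>j\<le>n. if j = 0 then qpoch (a * p / (d * e)) p n / qpoch p p n else 0)"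
    unfolding Bailey_lemma[OF p nz dn en an]
    by (intro sum.cong) (auto simp: unit)
  moreover have "B = G / (P * D * E)" if "D * E * B = G / P" "D \<noteq> 0" "E \<noteq> 0" for B D E G P :: complex
  proof -
    have "B = D * E * B / (D * E)" using that(2,3) by simp
    also have "\<dots> = G / P / (D * E)" by (simp only: that(1))
    finally show ?thesis by (simp add: mult.assoc)
  qed
  ultimately show ?thesis using dn en by (simp add: mult.assoc)
qed

text \<open>A terminating \<open>8W7\<close> series up to a factor that depends on \<open>a\<close> and \<open>n\<close> only: the terminating
  parameter \<open>p\<^sup>-\<^sup>n\<close> is contained in \<open>bailey_sum\<close>, and what it contributes to the argument of the series
  is cancelled there (see \<open>W87_terminating\<close>).\<close>

definition W_fin where
  "W_fin a b c d e p n = bailey_sum a p (\<lambda>r. wp a p b r * wp a p c r * wp a p d r * wp a p e r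
     * (a\<^sup>2 * p\<^sup>2 / (b * c * d * e)) ^ r * vwp a p r) n"

text \<open>A terminating \<open>4\<phi>3\<close> series up to a factor, balanced if \<open>g = B C / (d e f)\<close>. The parameter \<open>g\<close> stands for the third
  denominator parameter, reversed as in \<open>saal_term\<close>. In this form no denominator depends on \<open>g\<close>, and
  the symmetry in \<open>d\<close>, \<open>e\<close>, \<open>f\<close> is visible.\<close>

definition phi43 where
  "phi43 d e f B C g p n = (\<Sum>j\<le>n. qpoch d p j * qpoch e p j * qpoch f p j * qpoch g p (n - j) * g ^ j
     / (qpoch p p j * qpoch p p (n - j) * qpoch B p j * qpoch C p j))"

text \<open>The Bailey lemma with parameters \<open>d\<close> and \<open>e\<close>, applied to the pair given by the \<open>6\<phi>5\<close> summation
  with parameters \<open>b\<close> and \<open>c\<close>.\<close>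

lemma Watson_transformation:
  assumes p: "\<And>n. qpoch p p n \<noteq> 0" and a: "a \<noteq> 1" and an: "qpoch (a * p) p (2 * n) \<noteq> 0"
    and nz: "b \<noteq> 0" "c \<noteq> 0" "d \<noteq> 0" "e \<noteq> 0"
    and bn: "qpoch (a * p / b) p n \<noteq> 0" and cn: "qpoch (a * p / c) p n \<noteq> 0"
    and dn: "qpoch (a * p / d) p n \<noteq> 0" and en: "qpoch (a * p / e) p n \<noteq> 0"
  shows "qpoch (a * p / d) p n * qpoch (a * p / e) p n * W_fin a b c d e p n
    = phi43 d e (a * p / (b * c)) (a * p / b) (a * p / c) (a * p / (d * e)) p n"
proof -
  have bc: "bailey_sum a p (\<lambda>r. wp a p b r * wp a p c r * (a * p / (b * c)) ^ r * vwp a p r) j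
     = qpoch (a * p / (b * c)) p j / (qpoch p p j * qpoch (a * p / b) p j * qpoch (a * p / c) p j)"
    if "j \<le> n" for j
    by (rule sum_6phi5[OF p a])
       (use qpoch_nonzero_le[OF an] qpoch_nonzero_le[OF bn] qpoch_nonzero_le[OF cn] nz that in auto)
  have "W_fin a b c d e p n = bailey_sum a p (\<lambda>r. wp a p d r * wp a p e r * (a * p / (d * e)) ^ r *
       (wp a p b r * wp a p c r * (a * p / (b * c)) ^ r * vwp a p r)) n"
    unfolding W_fin_def
    by (rule arg_cong[where f = "\<lambda>A. bailey_sum a p A n"])
       (auto simp: fun_eq_iff power_mult_distrib [symmetric] power2_eq_square mult_ac power_divide)
  then show ?thesis
    unfolding phi43_def
    by (simp only: Bailey_lemma[OF p nz(3,4) dn en an]) (intro sum.cong refl, simp add: bc, simp add: mult_ac)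
qed

text \<open>Both \<open>8W7\<close> series have the same \<open>4\<phi>3\<close> series as their Watson transform: passing from \<open>a\<close> to \<open>l\<close>
  merely exchanges the roles of the numerator parameters \<open>d\<close> and \<open>a p / (b c)\<close>.\<close>

lemma Bailey_transformation:
  assumes p: "\<And>n. qpoch p p n \<noteq> 0" and p0: "p \<noteq> 0" and a: "a \<noteq> 1" "l \<noteq> 1"
    and an: "qpoch (a * p) p (2 * n) \<noteq> 0" and ln: "qpoch (l * p) p (2 * n) \<noteq> 0"
    and nz: "a \<noteq> 0" "b \<noteq> 0" "c \<noteq> 0" "d \<noteq> 0" "e \<noteq> 0"
    and bn: "qpoch (a * p / b) p n \<noteq> 0" and cn: "qpoch (a * p / c) p n \<noteq> 0"
    and dn: "qpoch (a * p / d) p n \<noteq> 0" and en: "qpoch (a * p / e) p n \<noteq> 0"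
    and len: "qpoch (l * p / e) p n \<noteq> 0"
    and l: "l = p * a\<^sup>2 / (b * c * d)"
    and b': "b' = l * b / a" and c': "c' = l * c / a" and d': "d' = l * d / a"
  shows "qpoch (a * p / e) p n * W_fin a b c d e p n
    = qpoch (l * p / e) p n * W_fin l b' c' d' e p n"
proof -
  have l0: "l \<noteq> 0" using nz p0 by (simp add: l)
  have eqs: "l * p / b' = a * p / b" "l * p / c' = a * p / c" "l * p / d' = a * p / d"
    "l * p / (b' * c') = d" "l * p / (d' * e) = a * p / (d * e)" "a * p / (b * c) = d'"
    using nz p0 l0 by (simp_all add: b' c' d' field_simps power2_eq_square) (simp_all add: l power2_eq_square)
  have "qpoch (a * p / d) p n * (qpoch (a * p / e) p n * W_fin a b c d e p n)
     = phi43 d e d' (a * p / b) (a * p / c) (a * p / (d * e)) p n"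
    using Watson_transformation[OF p a(1) an nz(2-5) bn cn dn en] by (simp add: eqs mult.assoc)
  also have "\<dots> = phi43 d' e d (a * p / b) (a * p / c) (a * p / (d * e)) p n"
    by (simp add: phi43_def mult_ac)
  also have "\<dots> = qpoch (a * p / d) p n * (qpoch (l * p / e) p n * W_fin l b' c' d' e p n)"
    using Watson_transformation[OF p a(2) ln, of b' c' d' e] nz l0 bn cn dn len
    by (simp add: eqs mult.assoc) (simp add: b' c' d' mult.assoc)
  finally show ?thesis using dn by simp
qed

section \<open>The terminating change of base\<close>

text \<open>The parameter \<open>- q\<^sup>-\<^sup>n\<close> combines with the terminating parameter \<open>q\<^sup>-\<^sup>n\<close> hidden in \<open>bailey_sum a q\<close> to
  the terminating parameter of base \<open>q\<^sup>2\<close>.\<close>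

lemma wp_minus_root:
  assumes q2: "\<And>n. qpoch (q\<^sup>2) (q\<^sup>2) n \<noteq> 0" and q0: "q \<noteq> 0" and r: "r \<le> n"
    and an: "qpoch (- (a * q)) q (2 * n) \<noteq> 0"
  shows "wp a q (- (1 / q ^ n)) r * (q ^ n) ^ r / (qpoch q q (n - r) * qpoch (a * q) q (n + r))
     = qpoch (- q) q n * qpoch (- (a * q)) q n * tri_power q r
        / (qpoch (q\<^sup>2) (q\<^sup>2) (n - r) * qpoch (a\<^sup>2 * q\<^sup>2) (q\<^sup>2) (n + r))"
proof -
  have q: "qpoch q q k \<noteq> 0 \<and> qpoch (- q) q k \<noteq> 0" for k
    using q2[of k] by (simp add: qpoch_square)
  have e: "q / (- q * q ^ n) = - (1 / q ^ n)" using q0 by (simp add: field_simps)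
  have "qpoch (- (1 / q ^ n)) q r * (- q * q ^ n) ^ r * qpoch (- q) q (n - r)
      = (- 1) ^ r * (tri_power q r * q ^ r) * qpoch (- q) q n"
    using qpoch_reverse[OF r _ q0, of "- q"] q0 unfolding e by simp
  moreover have "(- q * q ^ n) ^ r = (- 1) ^ r * q ^ r * (q ^ n) ^ r"
    by (metis mult_minus1 power_mult_distrib)
  ultimately have rev: "qpoch (- (1 / q ^ n)) q r * (q ^ n) ^ r = tri_power q r * qpoch (- q) q n / qpoch (- q) q (n - r)"
    using q0 q[of "n - r"] by (simp add: field_simps)
  have d: "a * q / (- (1 / q ^ n)) = - (a * q) * q ^ n" by simp
  have s: "qpoch (- (a * q)) q (n + r) = qpoch (- (a * q)) q n * qpoch (- (a * q) * q ^ n) q r"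
    by (rule qpoch_add)
  have "qpoch (- (a * q)) q (n + r) \<noteq> 0"
    using qpoch_nonzero_le[OF an] r by simp
  with s have nz: "qpoch (- (a * q)) q n \<noteq> 0" "qpoch (- (a * q) * q ^ n) q r \<noteq> 0" by auto
  have sq: "qpoch (a\<^sup>2 * q\<^sup>2) (q\<^sup>2) (n + r) = qpoch (a * q) q (n + r) * (qpoch (- (a * q)) q n * qpoch (- (a * q) * q ^ n) q r)"
    unfolding s[symmetric] qpoch_square[symmetric] by (simp add: power_mult_distrib)
  have "wp a q (- (1 / q ^ n)) r * (q ^ n) ^ r / (qpoch q q (n - r) * qpoch (a * q) q (n + r))
     = (qpoch (- (1 / q ^ n)) q r * (q ^ n) ^ r) / (qpoch (- (a * q) * q ^ n) q r * (qpoch q q (n - r) * qpoch (a * q) q (n + r)))"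
    unfolding wp_def d by simp
  also have "\<dots> = qpoch (- q) q n * qpoch (- (a * q)) q n * tri_power q r
        / (qpoch (q\<^sup>2) (q\<^sup>2) (n - r) * qpoch (a\<^sup>2 * q\<^sup>2) (q\<^sup>2) (n + r))"
    unfolding rev sq qpoch_square using nz by (simp add: mult_ac)
  finally show ?thesis .
qed

text \<open>The \<open>6\<phi>5\<close> summation in base \<open>q\<close> with parameters \<open>b\<close> and \<open>- q\<^sup>-\<^sup>n\<close>, read as a statement in base \<open>q\<^sup>2\<close>
  by means of \<open>wp_minus_root\<close>. This is where the base changes.\<close>

lemma quadratic_Bailey_pair:
  assumes q2: "\<And>n. qpoch (q\<^sup>2) (q\<^sup>2) n \<noteq> 0" and q0: "q \<noteq> 0" and a: "a \<noteq> 1" and b: "b \<noteq> 0"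
    and an: "qpoch (a * q) q (2 * n) \<noteq> 0" and an': "qpoch (- (a * q)) q (2 * n) \<noteq> 0"
    and bn: "qpoch (a * q / b) q n \<noteq> 0" and bn': "qpoch (- (a * q / b)) q n \<noteq> 0"
  shows "bailey_sum (a\<^sup>2) (q\<^sup>2) (\<lambda>r. wp a q b r * (- (a * q / b)) ^ r * tri_power q r * vwp a q r) n
     = qpoch (- (a * q / b)) q (2 * n) / (qpoch (q\<^sup>2) (q\<^sup>2) n * qpoch ((a * q / b)\<^sup>2) (q\<^sup>2) n
         * qpoch (- (a * q)) q (2 * n))"
proof -
  define e where "e = - (1 / q ^ n)"
  have e0: "e \<noteq> 0" using q0 by (simp add: e_def)
  have q: "qpoch q q k \<noteq> 0" "qpoch (- q) q k \<noteq> 0" for k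
    using q2[of k] by (simp_all add: qpoch_square)
  have ae: "a * q / e = - (a * q) * q ^ n" "a * q / (b * e) = - (a * q / b) * q ^ n"
    using q0 by (simp_all add: e_def)
  have split: "qpoch x q (2 * n) = qpoch x q n * qpoch (x * q ^ n) q n" for x
    by (simp add: mult_2 qpoch_add)
  have en: "qpoch (a * q / e) q n \<noteq> 0" "qpoch (- (a * q)) q n \<noteq> 0"
    using an' by (auto simp: ae split)
  define B where "B = bailey_sum (a\<^sup>2) (q\<^sup>2) (\<lambda>r. wp a q b r * (- (a * q / b)) ^ r * tri_power q r * vwp a q r) n"
  have "bailey_sum a q (\<lambda>r. wp a q b r * wp a q e r * (a * q / (b * e)) ^ r * vwp a q r) n
     = qpoch (- q) q n * qpoch (- (a * q)) q n * B"
    unfolding bailey_sum_def B_def sum_distrib_left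
  proof (intro sum.cong refl)
    fix r assume "r \<in> {..n}"
    then have r: "r \<le> n" by simp
    show "wp a q b r * wp a q e r * (a * q / (b * e)) ^ r * vwp a q r / (qpoch q q (n - r) * qpoch (a * q) q (n + r))
       = qpoch (- q) q n * qpoch (- (a * q)) q n *
         (wp a q b r * (- (a * q / b)) ^ r * tri_power q r * vwp a q r
           / (qpoch (q\<^sup>2) (q\<^sup>2) (n - r) * qpoch (a\<^sup>2 * q\<^sup>2) (q\<^sup>2) (n + r)))"
      using arg_cong[OF wp_minus_root[OF q2 q0 r an'], of "\<lambda>x. wp a q b r * (- (a * q / b)) ^ r * vwp a q r * x"]
      unfolding ae power_mult_distrib unfolding e_def by (simp add: mult_ac)
  qed
  also have "bailey_sum a q (\<lambda>r. wp a q b r * wp a q e r * (a * q / (b * e)) ^ r * vwp a q r) n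
     = qpoch (a * q / (b * e)) q n / (qpoch q q n * qpoch (a * q / b) q n * qpoch (a * q / e) q n)"
    by (rule sum_6phi5[OF q(1) a an b e0 bn en(1)])
  finally have main: "qpoch (- q) q n * qpoch (- (a * q)) q n * B = \<dots>" ..
  have "B = qpoch (a * q / (b * e)) q n / (qpoch q q n * qpoch (a * q / b) q n * qpoch (a * q / e) q n)
      / (qpoch (- q) q n * qpoch (- (a * q)) q n)"
    unfolding main[symmetric] using q en by simp
  also have "\<dots> = qpoch (- (a * q / b)) q (2 * n) / (qpoch (q\<^sup>2) (q\<^sup>2) n * qpoch ((a * q / b)\<^sup>2) (q\<^sup>2) n
         * qpoch (- (a * q)) q (2 * n))"
    unfolding qpoch_square split ae using bn' by (simp add: mult_ac)
  finally show ?thesis unfolding B_def .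
qed

text \<open>The parameters \<open>d\<close>, \<open>- d\<close> and \<open>- q\<^sup>-\<^sup>n\<close> make the series an output of the Bailey lemma in base \<open>q\<^sup>2\<close>
  with parameters \<open>d\<^sup>2\<close> and \<open>- a q\<close>. The second one is a square root of \<open>a\<^sup>2 q\<^sup>2\<close>, so its well-poised ratio
  is \<open>1\<close> and its only effect is on the argument.\<close>

lemma W_fin_quadratic:
  assumes q2: "\<And>n. qpoch (q\<^sup>2) (q\<^sup>2) n \<noteq> 0" and q0: "q \<noteq> 0" and a: "a \<noteq> 0" "a \<noteq> 1" and b: "b \<noteq> 0"
    and d: "d \<noteq> 0"
    and an: "qpoch (a * q) q (2 * n) \<noteq> 0" and an': "qpoch (- (a * q)) q (2 * n) \<noteq> 0"
    and bn: "qpoch (a * q / b) q n \<noteq> 0" and bn': "qpoch (- (a * q / b)) q n \<noteq> 0"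
    and dn: "qpoch (a\<^sup>2 * q\<^sup>2 / d\<^sup>2) (q\<^sup>2) n \<noteq> 0"
  shows "qpoch (a\<^sup>2 * q\<^sup>2 / d\<^sup>2) (q\<^sup>2) n * qpoch (- (a * q)) (q\<^sup>2) n * W_fin a b d (- d) (- (1 / q ^ n)) q n
     = qpoch (- q) q n * qpoch (- (a * q)) q n *
       phi43 (d\<^sup>2) (- (a * q / b)) (- (a * q / b) * q) ((a * q / b)\<^sup>2) (- (a * q\<^sup>2)) (- (a * q / d\<^sup>2)) (q\<^sup>2) n"
proof -
  define A where "A r = wp a q b r * (- (a * q / b)) ^ r * tri_power q r * vwp a q r" for r
  define e where "e = - (a * q)"
  have e0: "e \<noteq> 0" using a q0 by (simp add: e_def)
  have ee: "a\<^sup>2 * q\<^sup>2 / e = e" "a\<^sup>2 * q\<^sup>2 / (d\<^sup>2 * e) = - (a * q / d\<^sup>2)"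
    using a q0 d by (simp_all add: e_def power2_eq_square)
  have en: "qpoch e (q\<^sup>2) n \<noteq> 0"
    using an' by (simp add: qpoch_double e_def)
  have aa: "qpoch (a\<^sup>2 * q\<^sup>2) (q\<^sup>2) (2 * n) \<noteq> 0"
    using an an' qpoch_square[of "a * q" q "2 * n"] by (simp add: power_mult_distrib)
  have "W_fin a b d (- d) (- (1 / q ^ n)) q n
     = qpoch (- q) q n * qpoch (- (a * q)) q n *
       bailey_sum (a\<^sup>2) (q\<^sup>2) (\<lambda>r. wp (a\<^sup>2) (q\<^sup>2) (d\<^sup>2) r * wp (a\<^sup>2) (q\<^sup>2) e r * (a\<^sup>2 * q\<^sup>2 / (d\<^sup>2 * e)) ^ r * A r) n"
    unfolding bailey_sum_def W_fin_def sum_distrib_left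
  proof (intro sum.cong refl)
    fix r assume "r \<in> {..n}"
    then have r: "r \<le> n" by simp
    have w1: "wp (a\<^sup>2) (q\<^sup>2) e r = 1"
      using qpoch_nonzero_le[OF en r] by (simp add: wp_def ee)
    have w2: "wp a q d r * wp a q (- d) r = wp (a\<^sup>2) (q\<^sup>2) (d\<^sup>2) r"
      unfolding wp_def qpoch_square using qpoch_square[of "a * q / d" q r]
      by (simp add: power_divide power_mult_distrib)
    have u: "a\<^sup>2 * q\<^sup>2 / (b * d * - d * - (1 / q ^ n)) = - (a * q / b) * - (a * q / d\<^sup>2) * q ^ n"
      using q0 by (simp add: power2_eq_square mult_ac)
    show "wp a q b r * wp a q d r * wp a q (- d) r * wp a q (- (1 / q ^ n)) r *
          (a\<^sup>2 * q\<^sup>2 / (b * d * - d * - (1 / q ^ n))) ^ r * vwp a q r /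
          (qpoch q q (n - r) * qpoch (a * q) q (n + r)) =
          qpoch (- q) q n * qpoch (- (a * q)) q n *
          (wp (a\<^sup>2) (q\<^sup>2) (d\<^sup>2) r * wp (a\<^sup>2) (q\<^sup>2) e r * (a\<^sup>2 * q\<^sup>2 / (d\<^sup>2 * e)) ^ r * A r /
           (qpoch (q\<^sup>2) (q\<^sup>2) (n - r) * qpoch (a\<^sup>2 * q\<^sup>2) (q\<^sup>2) (n + r)))"
      using arg_cong[OF wp_minus_root[OF q2 q0 r an'], of
        "\<lambda>x. wp a q b r * (wp a q d r * wp a q (- d) r) * (- (a * q / b)) ^ r * (- (a * q / d\<^sup>2)) ^ r * vwp a q r * x"]
      unfolding u w1 ee power_mult_distrib A_def w2[symmetric] by (simp add: mult_ac)
  qed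
  moreover have pair: "bailey_sum (a\<^sup>2) (q\<^sup>2) A j
     = qpoch (- (a * q / b)) q (2 * j) / (qpoch (q\<^sup>2) (q\<^sup>2) j * qpoch ((a * q / b)\<^sup>2) (q\<^sup>2) j
         * qpoch (- (a * q)) q (2 * j))" if "j \<le> n" for j
    unfolding A_def
    by (rule quadratic_Bailey_pair[OF q2 q0 a(2) b])
       (use that qpoch_nonzero_le[OF an] qpoch_nonzero_le[OF an'] qpoch_nonzero_le[OF bn]
          qpoch_nonzero_le[OF bn'] in auto)
  have d20: "d\<^sup>2 \<noteq> 0" using d by simp
  note BL = Bailey_lemma[OF q2 d20 e0 dn _ aa, of A, unfolded ee, OF en]
  have "qpoch (a\<^sup>2 * q\<^sup>2 / d\<^sup>2) (q\<^sup>2) n * qpoch e (q\<^sup>2) n *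
     bailey_sum (a\<^sup>2) (q\<^sup>2) (\<lambda>r. wp (a\<^sup>2) (q\<^sup>2) (d\<^sup>2) r * wp (a\<^sup>2) (q\<^sup>2) e r * (- (a * q / d\<^sup>2)) ^ r * A r) n
    = phi43 (d\<^sup>2) (- (a * q / b)) (- (a * q / b) * q) ((a * q / b)\<^sup>2) (- (a * q\<^sup>2)) (- (a * q / d\<^sup>2)) (q\<^sup>2) n"
    unfolding BL phi43_def
  proof (intro sum.cong refl)
    fix j assume "j \<in> {..n}"
    then have j: "j \<le> n" by simp
    have ej: "qpoch e (q\<^sup>2) j \<noteq> 0" by (rule qpoch_nonzero_le[OF en j])
    have eq: "- (a * q\<^sup>2) = e * q" by (simp add: e_def power2_eq_square)
    show "qpoch (d\<^sup>2) (q\<^sup>2) j * qpoch e (q\<^sup>2) j * qpoch (- (a * q / d\<^sup>2)) (q\<^sup>2) (n - j) * (- (a * q / d\<^sup>2)) ^ j /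
         qpoch (q\<^sup>2) (q\<^sup>2) (n - j) * bailey_sum (a\<^sup>2) (q\<^sup>2) A j =
         qpoch (d\<^sup>2) (q\<^sup>2) j * qpoch (- (a * q / b)) (q\<^sup>2) j * qpoch (- (a * q / b) * q) (q\<^sup>2) j *
         qpoch (- (a * q / d\<^sup>2)) (q\<^sup>2) (n - j) * (- (a * q / d\<^sup>2)) ^ j /
         (qpoch (q\<^sup>2) (q\<^sup>2) j * qpoch (q\<^sup>2) (q\<^sup>2) (n - j) * qpoch ((a * q / b)\<^sup>2) (q\<^sup>2) j *
          qpoch (- (a * q\<^sup>2)) (q\<^sup>2) j)"
      unfolding pair[OF j] e_def[symmetric] qpoch_double eq using ej by (simp add: mult_ac)
  qed
  ultimately show ?thesis unfolding ee unfolding e_def by (simp add: mult_ac)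
qed

text \<open>Only finitely many values of \<open>s\<close> make a given denominator of the terminating identity vanish.\<close>

lemma eventually_qpoch_nonzero:
  assumes "c \<noteq> 0"
  shows "eventually (\<lambda>s. qpoch (c * s) p n \<noteq> 0) (at s0)"
proof -
  have "eventually (\<lambda>s. \<forall>i\<in>{..<n}. s \<noteq> 1 / (c * p ^ i)) (at s0)"
    by (intro eventually_ball_finite) (auto intro: eventually_neq_at_within)
  then show ?thesis
  proof eventually_elim
    case (elim s)
    have "1 - c * s * p ^ i \<noteq> 0" if "i < n" for i
    proof
      assume "1 - c * s * p ^ i = 0"
      then have "c * p ^ i * s = 1" by (simp add: mult_ac)
      then have "s = 1 / (c * p ^ i)" by (metis mult_zero_left nonzero_eq_divide_eq zero_neq_one mult.commute)
      with elim that show False by auto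
    qed
    then show ?case by (simp add: qpoch_def)
  qed
qed

text \<open>The chain of transformations from the left series to the right one, for \<open>Q = q ^ Suc n\<close> and
  \<open>s = \<beta> x\<close>. The four series \<open>X0\<close>, \<open>X1\<close>, \<open>X4\<close>, \<open>X5\<close> that occur have the leading parameters
  \<open>a0\<close>, \<open>a1\<close>, \<open>a4\<close>, \<open>a5\<close>, the first two in base \<open>q\<close> and the others in base \<open>q\<^sup>2\<close>.\<close>

lemma terminating_quadratic_generic:
  fixes q z al s0 :: complex and n :: nat
  defines "Q \<equiv> q ^ Suc n"
  assumes q2: "\<And>n. qpoch (q\<^sup>2) (q\<^sup>2) n \<noteq> 0" and q0: "q \<noteq> 0" and z: "z \<noteq> 0" and al: "al \<noteq> 0"
    and zn: "qpoch (q * z\<^sup>2) q n \<noteq> 0" and zn': "qpoch (- (q * z\<^sup>2)) q n \<noteq> 0"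
  shows "eventually (\<lambda>s.
     qpoch (q * s * z) q n * qpoch (- (q\<^sup>2 * al * s * z\<^sup>2)) (q\<^sup>2) n *
       W_fin (- (Q * s * z ^ 3)) (q * z / al) (- (Q * z\<^sup>2)) (- (Q * s * z)) (- (al * z)) q n
     = qpoch (- q) q n * qpoch (- (q * al * s * z\<^sup>2)) q n * qpoch (q\<^sup>2 * s * z\<^sup>2 / al) q n *
       W_fin (- (q * s * z ^ 4 / al)) (- (q * z\<^sup>2)) (- (z\<^sup>2)) (- (q * s / al)) (q\<^sup>2 * z\<^sup>2 / al\<^sup>2) (q\<^sup>2) n)
     (at s0)"
proof -
  have Q0: "Q \<noteq> 0" using q0 by (simp add: Q_def)
  note ev = eventually_qpoch_nonzero
  have q1: "qpoch q q k \<noteq> 0" "qpoch (- q) q k \<noteq> 0" for k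
    using q2[of k] by (simp_all add: qpoch_square)
  have zz: "qpoch (q\<^sup>2 * z ^ 4) (q\<^sup>2) n \<noteq> 0"
    using zn zn' qpoch_square[of "q * z\<^sup>2" q n] by (simp add: power_mult_distrib)
  have nonzero: "eventually (\<lambda>s. s \<noteq> 0) (at s0)"
    by (rule eventually_neq_at_within)
  have generic:
    "eventually (\<lambda>s. qpoch (- (Q * z ^ 3) * s) q 1 \<noteq> 0) (at s0)"
    "eventually (\<lambda>s. qpoch (al * z\<^sup>2 * s) q 1 \<noteq> 0) (at s0)"
    "eventually (\<lambda>s. qpoch (- (Q * z ^ 3 * q) * s) q (2 * n) \<noteq> 0) (at s0)"
    "eventually (\<lambda>s. qpoch (al * z\<^sup>2 * q * s) q (2 * n) \<noteq> 0) (at s0)"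
    "eventually (\<lambda>s. qpoch (- (al * z\<^sup>2 * q) * s) q (2 * n) \<noteq> 0) (at s0)"
    "eventually (\<lambda>s. qpoch (- (Q * al * z\<^sup>2) * s) q n \<noteq> 0) (at s0)"
    "eventually (\<lambda>s. qpoch (q * z * s) q n \<noteq> 0) (at s0)"
    "eventually (\<lambda>s. qpoch (q * Q * z\<^sup>2 / al * s) q n \<noteq> 0) (at s0)"
    "eventually (\<lambda>s. qpoch (- (q * z) * s) q n \<noteq> 0) (at s0)"
    "eventually (\<lambda>s. qpoch (- (q\<^sup>2 * z ^ 4 / al) * s) q 1 \<noteq> 0) (at s0)"
    "eventually (\<lambda>s. qpoch (- (q\<^sup>2 * z ^ 4 / al * q\<^sup>2) * s) (q\<^sup>2) (2 * n) \<noteq> 0) (at s0)"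
    "eventually (\<lambda>s. qpoch (- (q * z ^ 4 / al) * s) q 1 \<noteq> 0) (at s0)"
    "eventually (\<lambda>s. qpoch (- (q * z ^ 4 / al * q\<^sup>2) * s) (q\<^sup>2) (2 * n) \<noteq> 0) (at s0)"
    "eventually (\<lambda>s. qpoch (- (q\<^sup>2 * al * z\<^sup>2) * s) (q\<^sup>2) n \<noteq> 0) (at s0)"
    "eventually (\<lambda>s. qpoch (q ^ 3 * z\<^sup>2 / al * s) (q\<^sup>2) n \<noteq> 0) (at s0)"
    "eventually (\<lambda>s. qpoch (q\<^sup>2 * z\<^sup>2 / al * s) (q\<^sup>2) n \<noteq> 0) (at s0)"
    "eventually (\<lambda>s. qpoch (- (q * al * z\<^sup>2) * s) (q\<^sup>2) n \<noteq> 0) (at s0)"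
    by (rule ev; use q0 Q0 z al in simp)+
  from nonzero generic show ?thesis
  proof eventually_elim
    case (elim s)
    note s = elim(1)
    have one: "qpoch x q 1 = 1 - x" for x by (simp add: qpoch_def)
    define a0 where "a0 = - (Q * s * z ^ 3)"
    define a1 where "a1 = al * s * z\<^sup>2"
    define a4 where "a4 = - (q\<^sup>2 * s * z ^ 4 / al)"
    define a5 where "a5 = - (q * s * z ^ 4 / al)"
    define h where "h = - (1 / q ^ n)"
    have nz: "a0 \<noteq> 0" "a1 \<noteq> 0" "a4 \<noteq> 0" "a5 \<noteq> 0"
      using s z al q0 Q0 by (auto simp: a0_def a1_def a4_def a5_def)
    have n1: "a0 \<noteq> 1" "a1 \<noteq> 1" "a4 \<noteq> 1" "a5 \<noteq> 1"
    proof -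
      have ax: "a0 = - (Q * z ^ 3) * s" "a1 = al * z\<^sup>2 * s" "a4 = - (q\<^sup>2 * z ^ 4 / al) * s" "a5 = - (q * z ^ 4 / al) * s"
        by (simp_all add: a0_def a1_def a4_def a5_def)
      show "a0 \<noteq> 1" "a1 \<noteq> 1" "a4 \<noteq> 1" "a5 \<noteq> 1"
        using elim(2,3,11,13) unfolding ax one right_minus_eq by metis+
    qed
    have i0: "a0 * q / (q * z / al) = - (Q * al * z\<^sup>2) * s" "a0 * q / (- (Q * z\<^sup>2)) = q * z * s"
      "a0 * q / (- (Q * s * z)) = q * z\<^sup>2" "a0 * q / (- (al * z)) = q * Q * z\<^sup>2 / al * s"
      "a1 * q / (- (al * z)) = - (q * z) * s" "a0 * q = - (Q * z ^ 3 * q) * s" "a1 * q = al * z\<^sup>2 * q * s"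
      "q * a0\<^sup>2 / ((q * z / al) * (- (Q * z\<^sup>2)) * (- (Q * s * z))) = a1"
      "a1 * (q * z / al) / a0 = h" "a1 * (- (Q * z\<^sup>2)) / a0 = al * z" "a1 * (- (Q * s * z)) / a0 = al * s"
      using s z al q0
      by (simp_all add: a0_def a1_def h_def Q_def divide_simps power2_eq_square power3_eq_cube power4_eq_xxxx)
    have step1: "qpoch (q * Q * z\<^sup>2 / al * s) q n * W_fin a0 (q * z / al) (- (Q * z\<^sup>2)) (- (Q * s * z)) (- (al * z)) q n
        = qpoch (- (q * z) * s) q n * W_fin a1 (al * s) (al * z) (- (al * z)) h q n"
    proof -
      have perm: "W_fin a1 (al * s) (al * z) (- (al * z)) h q n = W_fin a1 h (al * z) (al * s) (- (al * z)) q n"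
        by (simp add: W_fin_def mult_ac)
      show ?thesis
        unfolding perm
        by (rule Bailey_transformation[OF q1(1) q0 n1(1,2), of n "q * z / al" "- (Q * z\<^sup>2)" "- (Q * s * z)" "- (al * z)"
            h "al * z" "al * s", unfolded i0(1-5,8-11), unfolded i0(6,7)])
           (use elim s z al q0 Q0 nz zn in simp_all)
    qed
    have i1: "a1 * q / (al * s) = q * z\<^sup>2" "a1\<^sup>2 * q\<^sup>2 / (al * z)\<^sup>2 = (q * z * s)\<^sup>2"
      "- (a1 * q) = - (al * z\<^sup>2 * q) * s" "- (a1 * q / (al * z)\<^sup>2) = - (q * s / al)" "(q * z\<^sup>2)\<^sup>2 = q\<^sup>2 * z ^ 4"
      "- (a1 * q\<^sup>2) = - (q\<^sup>2 * al * z\<^sup>2) * s"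
      using s z al q0 by (simp_all add: a1_def field_simps power2_eq_square power4_eq_xxxx)
    have zs: "qpoch ((q * z * s)\<^sup>2) (q\<^sup>2) n = qpoch (q * z * s) q n * qpoch (- (q * z) * s) q n"
      unfolding qpoch_square by simp
    have step2: "qpoch ((q * z * s)\<^sup>2) (q\<^sup>2) n * qpoch (- (al * z\<^sup>2 * q) * s) (q\<^sup>2) n *
        W_fin a1 (al * s) (al * z) (- (al * z)) h q n
      = qpoch (- q) q n * qpoch (- (al * z\<^sup>2 * q) * s) q n *
        phi43 ((al * z)\<^sup>2) (- (q * z\<^sup>2)) (- (q * z\<^sup>2) * q) (q\<^sup>2 * z ^ 4) (- (q\<^sup>2 * al * z\<^sup>2) * s) (- (q * s / al)) (q\<^sup>2) n"
      unfolding h_def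
      by (rule W_fin_quadratic[OF q2 q0, of a1 "al * s" "al * z" n, unfolded i1])
         (use elim s z al n1 nz zn zn' zs in \<open>auto simp: i0(7)\<close>)
    have i2: "a4 * q\<^sup>2 / (q\<^sup>2 * z\<^sup>2 / al\<^sup>2) = - (q\<^sup>2 * al * z\<^sup>2) * s" "a4 * q\<^sup>2 / (- (q\<^sup>2 * s / al)) = q\<^sup>2 * z ^ 4"
      "a4 * q\<^sup>2 / (- (q * z\<^sup>2)) = q ^ 3 * z\<^sup>2 / al * s" "a4 * q\<^sup>2 / (- (q\<^sup>2 * z\<^sup>2)) = q\<^sup>2 * z\<^sup>2 / al * s"
      "a4 * q\<^sup>2 / ((q\<^sup>2 * z\<^sup>2 / al\<^sup>2) * (- (q\<^sup>2 * s / al))) = (al * z)\<^sup>2"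
      "a4 * q\<^sup>2 / ((- (q * z\<^sup>2)) * (- (q\<^sup>2 * z\<^sup>2))) = - (q * s / al)"
      "a5 * q\<^sup>2 / (q\<^sup>2 * z\<^sup>2 / al\<^sup>2) = - (q * al * z\<^sup>2) * s"
      "a4 * q\<^sup>2 = - (q\<^sup>2 * z ^ 4 / al * q\<^sup>2) * s" "a5 * q\<^sup>2 = - (q * z ^ 4 / al * q\<^sup>2) * s"
      "q\<^sup>2 * a4\<^sup>2 / ((- (q\<^sup>2 * z\<^sup>2)) * (- (q * z\<^sup>2)) * (- (q\<^sup>2 * s / al))) = a5"
      "a5 * (- (q\<^sup>2 * z\<^sup>2)) / a4 = - (q * z\<^sup>2)" "a5 * (- (q * z\<^sup>2)) / a4 = - (z\<^sup>2)"
      "a5 * (- (q\<^sup>2 * s / al)) / a4 = - (q * s / al)"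
      using s z al q0
      by (simp_all add: a4_def a5_def divide_simps power2_eq_square power3_eq_cube power4_eq_xxxx)
    have qq: "- (q * z\<^sup>2) * q = - (q\<^sup>2 * z\<^sup>2)" by (simp add: power2_eq_square)
    have step3: "qpoch (q ^ 3 * z\<^sup>2 / al * s) (q\<^sup>2) n * qpoch (q\<^sup>2 * z\<^sup>2 / al * s) (q\<^sup>2) n *
        W_fin a4 (q\<^sup>2 * z\<^sup>2 / al\<^sup>2) (- (q\<^sup>2 * s / al)) (- (q * z\<^sup>2)) (- (q\<^sup>2 * z\<^sup>2)) (q\<^sup>2) n
      = phi43 ((al * z)\<^sup>2) (- (q * z\<^sup>2)) (- (q * z\<^sup>2) * q) (q\<^sup>2 * z ^ 4) (- (q\<^sup>2 * al * z\<^sup>2) * s) (- (q * s / al)) (q\<^sup>2) n"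
    proof -
      have perm: "phi43 ((al * z)\<^sup>2) (- (q * z\<^sup>2)) (- (q * z\<^sup>2) * q) (q\<^sup>2 * z ^ 4) (- (q\<^sup>2 * al * z\<^sup>2) * s) (- (q * s / al)) (q\<^sup>2) n
        = phi43 (- (q * z\<^sup>2)) (- (q\<^sup>2 * z\<^sup>2)) ((al * z)\<^sup>2) (- (q\<^sup>2 * al * z\<^sup>2) * s) (q\<^sup>2 * z ^ 4) (- (q * s / al)) (q\<^sup>2) n"
        unfolding qq by (simp add: phi43_def mult_ac)
      show ?thesis
        unfolding perm
        by (rule Watson_transformation[OF q2 n1(3), of n "q\<^sup>2 * z\<^sup>2 / al\<^sup>2" "- (q\<^sup>2 * s / al)" "- (q * z\<^sup>2)" "- (q\<^sup>2 * z\<^sup>2)",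
             unfolded i2(1-7), unfolded i2(8)])
           (use elim s z al q0 zz in simp_all)
    qed
    have step4: "qpoch (- (q\<^sup>2 * al * z\<^sup>2) * s) (q\<^sup>2) n *
        W_fin a4 (q\<^sup>2 * z\<^sup>2 / al\<^sup>2) (- (q\<^sup>2 * s / al)) (- (q * z\<^sup>2)) (- (q\<^sup>2 * z\<^sup>2)) (q\<^sup>2) n
      = qpoch (- (q * al * z\<^sup>2) * s) (q\<^sup>2) n *
        W_fin a5 (- (q * z\<^sup>2)) (- (z\<^sup>2)) (- (q * s / al)) (q\<^sup>2 * z\<^sup>2 / al\<^sup>2) (q\<^sup>2) n"
    proof -
      have perm: "W_fin a4 (q\<^sup>2 * z\<^sup>2 / al\<^sup>2) (- (q\<^sup>2 * s / al)) (- (q * z\<^sup>2)) (- (q\<^sup>2 * z\<^sup>2)) (q\<^sup>2) n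
        = W_fin a4 (- (q\<^sup>2 * z\<^sup>2)) (- (q * z\<^sup>2)) (- (q\<^sup>2 * s / al)) (q\<^sup>2 * z\<^sup>2 / al\<^sup>2) (q\<^sup>2) n"
        by (simp add: W_fin_def mult_ac)
      have q20: "q\<^sup>2 \<noteq> 0" using q0 by simp
      show ?thesis
        unfolding perm
        by (rule Bailey_transformation[OF q2 q20 n1(3,4), of n "- (q\<^sup>2 * z\<^sup>2)" "- (q * z\<^sup>2)" "- (q\<^sup>2 * s / al)"
             "q\<^sup>2 * z\<^sup>2 / al\<^sup>2" "- (q * z\<^sup>2)" "- (z\<^sup>2)" "- (q * s / al)",
             unfolded i2(1-4,7,10-13), unfolded i2(8,9)])
           (use elim s z al q0 nz zz in simp_all)
    qed
    \<comment> \<open>The equations \<open>t1\<close>, \<open>t2\<close>, \<open>t4\<close> below are the links of the chain, and \<open>P1\<close>, \<open>P4\<close> are cancelled in the end.\<close>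
    define X0 where "X0 = W_fin a0 (q * z / al) (- (Q * z\<^sup>2)) (- (Q * s * z)) (- (al * z)) q n"
    define X1 where "X1 = W_fin a1 (al * s) (al * z) (- (al * z)) h q n"
    define X4 where "X4 = W_fin a4 (q\<^sup>2 * z\<^sup>2 / al\<^sup>2) (- (q\<^sup>2 * s / al)) (- (q * z\<^sup>2)) (- (q\<^sup>2 * z\<^sup>2)) (q\<^sup>2) n"
    define X5 where "X5 = W_fin a5 (- (q * z\<^sup>2)) (- (z\<^sup>2)) (- (q * s / al)) (q\<^sup>2 * z\<^sup>2 / al\<^sup>2) (q\<^sup>2) n"
    define P1 where "P1 = qpoch (q * Q * z\<^sup>2 / al * s) q n"
    define P2 where "P2 = qpoch (- (q * z) * s) q n"
    define P3 where "P3 = qpoch (q * z * s) q n"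
    define P4 where "P4 = qpoch (- (q * al * z\<^sup>2) * s) (q\<^sup>2) n"
    define P5 where "P5 = qpoch (- (q * al * z\<^sup>2) * s) q n"
    define P6 where "P6 = qpoch (- (q\<^sup>2 * al * z\<^sup>2) * s) (q\<^sup>2) n"
    define P7 where "P7 = qpoch (q\<^sup>2 * z\<^sup>2 / al * s) q n"
    have dbl: "qpoch (q ^ 3 * z\<^sup>2 / al * s) (q\<^sup>2) n * qpoch (q\<^sup>2 * z\<^sup>2 / al * s) (q\<^sup>2) n = P7 * P1"
    proof -
      have "qpoch (q\<^sup>2 * z\<^sup>2 / al * s) q (2 * n) = P7 * P1"
        unfolding mult_2 qpoch_add P7_def P1_def Q_def by (simp add: mult_ac power2_eq_square)
      moreover have "qpoch (q\<^sup>2 * z\<^sup>2 / al * s) q (2 * n) = qpoch (q ^ 3 * z\<^sup>2 / al * s) (q\<^sup>2) n * qpoch (q\<^sup>2 * z\<^sup>2 / al * s) (q\<^sup>2) n"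
        unfolding qpoch_double by (simp add: mult_ac power2_eq_square power3_eq_cube)
      ultimately show ?thesis by simp
    qed
    have al_comm: "- (al * z\<^sup>2 * q) * s = - (q * al * z\<^sup>2) * s" by (simp add: mult_ac)
    have t1: "P1 * X0 = P2 * X1" using step1 by (simp only: P1_def P2_def X0_def X1_def)
    have t2: "P3 * P2 * P4 * X1 = qpoch (- q) q n * P5 * (P7 * P1 * X4)"
      using step2 unfolding zs step3[symmetric] dbl al_comm
      by (simp only: P2_def P3_def P4_def P5_def X1_def X4_def)
    have t4: "P6 * X4 = P4 * X5" using step4 by (simp only: P4_def P6_def X4_def X5_def)
    have P14: "P1 \<noteq> 0" "P4 \<noteq> 0" using elim by (auto simp: P1_def P4_def)
    have "P1 * P4 * (P3 * P6 * X0) = P3 * P4 * P6 * (P1 * X0)" by (simp add: mult_ac)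
    also have "\<dots> = P6 * (P3 * P2 * P4 * X1)" unfolding t1 by (simp add: mult_ac)
    also have "\<dots> = qpoch (- q) q n * P5 * P7 * P1 * (P6 * X4)" unfolding t2 by (simp add: mult_ac)
    also have "\<dots> = P1 * P4 * (qpoch (- q) q n * P5 * P7 * X5)" unfolding t4 by (simp add: mult_ac)
    finally have "P3 * P6 * X0 = qpoch (- q) q n * P5 * P7 * X5" using P14 by simp
    moreover have "P3 = qpoch (q * s * z) q n" "P6 = qpoch (- (q\<^sup>2 * al * s * z\<^sup>2)) (q\<^sup>2) n"
      "P5 = qpoch (- (q * al * s * z\<^sup>2)) q n" "P7 = qpoch (q\<^sup>2 * s * z\<^sup>2 / al) q n"
      by (simp_all add: P3_def P5_def P6_def P7_def mult_ac)
    ultimately show ?case by (simp only: X0_def X5_def a0_def a5_def)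
  qed
qed

section \<open>Infinite products and regularised very-well-poised series\<close>

definition qinf :: "complex \<Rightarrow> complex \<Rightarrow> complex" where
  "qinf a p = (\<Prod>i. 1 - a * p ^ i)"

lemma qpoch_inf_Nil [simp]: "qpoch_inf [] p = 1"
  and qpoch_inf_Cons [simp]: "qpoch_inf (a # as) p = qinf a p * qpoch_inf as p"
  by (simp_all add: qpoch_inf_def qinf_def)

lemma convergent_prod_qinf:
  fixes a p :: complex
  assumes "norm p < 1"
  shows "convergent_prod (\<lambda>i. 1 - a * p ^ i)"
proof (rule abs_convergent_prod_imp_convergent_prod)
  have "summable (\<lambda>i. norm a * norm p ^ i)"
    using assms by (intro summable_mult summable_geometric) auto
  then show "abs_convergent_prod (\<lambda>i. 1 - a * p ^ i)"
    by (intro summable_imp_abs_convergent_prod) (simp add: norm_mult norm_power)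
qed

lemma qpoch_tendsto_qinf:
  assumes "norm p < 1"
  shows "(\<lambda>n. qpoch a p n) \<longlonglongrightarrow> qinf a p"
proof -
  have "(\<lambda>n. \<Prod>i\<le>n. 1 - a * p ^ i) \<longlonglongrightarrow> qinf a p"
    unfolding qinf_def by (rule convergent_prod_LIMSEQ[OF convergent_prod_qinf[OF assms]])
  then show ?thesis
    unfolding qpoch_def by (simp add: LIMSEQ_lessThan_iff_atMost)
qed

lemma qinf_split:
  assumes "norm p < 1"
  shows "qinf a p = qpoch a p n * qinf (a * p ^ n) p"
proof -
  have "(\<lambda>m. qpoch a p (m + n)) \<longlonglongrightarrow> qinf a p"
    by (rule LIMSEQ_ignore_initial_segment[OF qpoch_tendsto_qinf[OF assms]])
  moreover have "(\<lambda>m. qpoch a p (m + n)) \<longlonglongrightarrow> qpoch a p n * qinf (a * p ^ n) p"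
    unfolding add.commute[of _ n] qpoch_add
    by (intro tendsto_intros qpoch_tendsto_qinf assms)
  ultimately show ?thesis by (rule LIMSEQ_unique)
qed

lemma qinf_double:
  assumes "norm p < 1"
  shows "qinf a p = qinf a (p\<^sup>2) * qinf (a * p) (p\<^sup>2)"
proof -
  have p2: "norm (p\<^sup>2) < 1"
    using assms by (simp add: norm_power power_less_one_iff)
  have "strict_mono (\<lambda>n::nat. 2 * n)" by (simp add: strict_mono_def)
  then have "(\<lambda>n. qpoch a p (2 * n)) \<longlonglongrightarrow> qinf a p"
    using LIMSEQ_subseq_LIMSEQ[OF qpoch_tendsto_qinf[OF assms]] by (simp add: o_def)
  moreover have "(\<lambda>n. qpoch a p (2 * n)) \<longlonglongrightarrow> qinf a (p\<^sup>2) * qinf (a * p) (p\<^sup>2)"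
    unfolding qpoch_double by (intro tendsto_intros qpoch_tendsto_qinf p2)
  ultimately show ?thesis by (rule LIMSEQ_unique)
qed

lemma qinf_eq_0_iff:
  assumes "norm p < 1"
  shows "qinf a p = 0 \<longleftrightarrow> (\<exists>i. a * p ^ i = 1)"
proof
  assume z: "qinf a p = 0"
  show "\<exists>i. a * p ^ i = 1"
  proof (rule ccontr)
    assume "\<not> ?thesis"
    then have "1 - a * p ^ i \<noteq> 0" for i by auto
    with prodinf_nonzero[OF convergent_prod_qinf[OF assms]] z show False
      by (auto simp: qinf_def)
  qed
next
  assume "\<exists>i. a * p ^ i = 1"
  then obtain i where "a * p ^ i = 1" ..
  then have "qpoch a p (Suc i) = 0" by (simp add: qpoch_Suc)
  then show "qinf a p = 0" using qinf_split[OF assms, of a "Suc i"] by simp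
qed

lemma qpoch_nonzero_if_qinf: "norm p < 1 \<Longrightarrow> qinf a p \<noteq> 0 \<Longrightarrow> qpoch a p n \<noteq> 0"
  using qinf_split[of p a n] by auto

lemma qinf_nonzero_if_qpoch:
  assumes "norm p < 1" "\<And>n. qpoch a p n \<noteq> 0"
  shows "qinf a p \<noteq> 0"
proof
  assume "qinf a p = 0"
  then obtain i where "a * p ^ i = 1" using qinf_eq_0_iff assms(1) by blast
  then have "qpoch a p (Suc i) = 0" by (simp add: qpoch_Suc)
  with assms(2) show False by blast
qed

lemma qpoch_nonzero_small:
  assumes "norm p < 1" "norm a < 1"
  shows "qpoch a p n \<noteq> 0"
proof -
  have "1 - a * p ^ i \<noteq> 0" for i
  proof
    assume "1 - a * p ^ i = 0"
    then have "norm (a * p ^ i) = 1" by simp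
    moreover have "norm (a * p ^ i) \<le> norm a * 1"
      unfolding norm_mult norm_power using assms by (intro mult_left_mono power_le_one) auto
    ultimately show False using assms by simp
  qed
  then show ?thesis by (simp add: qpoch_def)
qed

lemma qpoch_self_nonzero: "norm p < 1 \<Longrightarrow> qpoch p p n \<noteq> 0"
  by (rule qpoch_nonzero_small)

text \<open>A homogeneous form of the q-shifted factorial. With \<open>d = V D\<close> it equals \<open>V\<^sup>r (D; p)\<^sub>r\<close>, but it remains
  meaningful in the limit where \<open>V\<close> tends to \<open>0\<close> while \<open>V D\<close> is fixed.\<close>

definition pprod :: "complex \<Rightarrow> complex \<Rightarrow> complex \<Rightarrow> nat \<Rightarrow> complex" where
  "pprod V d p r = (\<Prod>i<r. V - d * p ^ i)"

lemma qpoch_eq_pprod: "qpoch a p r = pprod 1 a p r"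
  by (simp add: qpoch_def pprod_def)

lemma pprod_eq: "pprod u (u * a) p r = u ^ r * qpoch a p r"
  by (induction r) (simp_all add: pprod_def qpoch_Suc algebra_simps)

text \<open>The bound is geometric with any ratio \<open>R\<close> that dominates \<open>V\<close>, uniformly for bounded \<open>d\<close>. In
  particular it stays useful for \<open>V\<close> near \<open>0\<close>, and for \<open>V = R = 1\<close> it bounds \<open>(d; p)\<^sub>r\<close>.\<close>

lemma norm_pprod_le:
  assumes p: "norm p < 1" and R: "0 < R" "norm V \<le> R" and D: "norm d \<le> D"
  shows "norm (pprod V d p r) \<le> exp (D / R / (1 - norm p)) * R ^ r"
proof -
  have D0: "0 \<le> D" using norm_ge_zero D by (rule order_trans)
  have "norm (pprod V d p r) = (\<Prod>i<r. norm (V - d * p ^ i))"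
    by (simp add: pprod_def prod_norm)
  also have "\<dots> \<le> (\<Prod>i<r. R * (1 + D / R * norm p ^ i))"
  proof (intro prod_mono conjI)
    fix i
    have "norm (V - d * p ^ i) \<le> norm V + norm (d * p ^ i)" by (rule norm_triangle_ineq4)
    also have "\<dots> \<le> R + D * norm p ^ i"
      unfolding norm_mult norm_power using R D by (intro add_mono mult_right_mono) auto
    also have "\<dots> = R * (1 + D / R * norm p ^ i)" using R by (simp add: field_simps)
    finally show "norm (V - d * p ^ i) \<le> \<dots>" .
  qed simp
  also have "\<dots> = R ^ r * (\<Prod>i<r. 1 + D / R * norm p ^ i)"
    by (simp add: prod.distrib)
  also have "\<dots> \<le> R ^ r * exp (\<Sum>i<r. D / R * norm p ^ i)"
    using R D0 by (intro mult_left_mono prod_le_exp_sum) auto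
  also have "(\<Sum>i<r. D / R * norm p ^ i) = D / R * (\<Sum>i<r. norm p ^ i)"
    by (simp add: sum_distrib_left)
  also have "\<dots> \<le> D / R * (1 / (1 - norm p))"
  proof (intro mult_left_mono)
    have "(\<Sum>i<r. norm p ^ i) \<le> (\<Sum>i. norm p ^ i)"
      using p by (intro sum_le_suminf summable_geometric) auto
    also have "\<dots> = 1 / (1 - norm p)" using p by (intro suminf_geometric) auto
    finally show "(\<Sum>i<r. norm p ^ i) \<le> 1 / (1 - norm p)" .
  qed (use R D0 in auto)
  finally show ?thesis using R by (simp add: mult.commute)
qed

lemma norm_qinf_le:
  assumes p: "norm p < 1" and D: "norm a \<le> D"
  shows "norm (qinf a p) \<le> exp (D / (1 - norm p))"
proof (rule LIMSEQ_le_const2[OF tendsto_norm[OF qpoch_tendsto_qinf[OF p]]])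
  have "norm (qpoch a p n) \<le> exp (D / (1 - norm p))" for n
    using norm_pprod_le[OF p zero_less_one _ D, of 1 n] by (simp add: qpoch_eq_pprod)
  then show "\<exists>N. \<forall>n\<ge>N. norm (qpoch a p n) \<le> exp (D / (1 - norm p))" by blast
qed

lemma qinf_holomorphic:
  assumes p: "norm p < 1"
  shows "(\<lambda>a. qinf a p) holomorphic_on A"
proof -
  have "(\<lambda>a. qinf a p) holomorphic_on UNIV"
  proof (rule holomorphic_uniform_sequence[where f = "\<lambda>n a. qpoch a p n"])
    show "(\<lambda>a. qpoch a p n) holomorphic_on UNIV" for n
      unfolding qpoch_def by (intro holomorphic_intros)
    fix x :: complex
    define K where "K = cball x 1"
    have "bounded K" by (simp add: K_def)
    then obtain D where D: "\<And>a. a \<in> K \<Longrightarrow> norm a \<le> D" by (auto simp: bounded_iff)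
    have "uniformly_convergent_on K (\<lambda>N a. \<Prod>n<N. 1 - a * p ^ n)"
    proof (rule uniformly_convergent_on_prod')
      show "uniformly_convergent_on K (\<lambda>N a. \<Sum>n<N. norm (1 - a * p ^ n - 1))"
      proof (rule Weierstrass_m_test')
        show "norm (norm (1 - a * p ^ n - 1)) \<le> D * norm p ^ n" if "a \<in> K" for n a
          using D[OF that] by (auto simp: norm_mult norm_power intro!: mult_right_mono)
        show "summable (\<lambda>n. D * norm p ^ n)"
          using p by (intro summable_mult summable_geometric) auto
      qed
    qed (auto simp: K_def intro!: continuous_intros)
    then have "uniform_limit K (\<lambda>n a. qpoch a p n) (\<lambda>a. lim (\<lambda>n. qpoch a p n)) sequentially"
      by (simp add: qpoch_def uniformly_convergent_uniform_limit_iff)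
    moreover have "lim (\<lambda>n. qpoch a p n) = qinf a p" for a
      by (rule limI[OF qpoch_tendsto_qinf[OF p]])
    ultimately show "\<exists>d>0. cball x d \<subseteq> UNIV \<and> uniform_limit (cball x d) (\<lambda>n a. qpoch a p n) (\<lambda>a. qinf a p) sequentially"
      by (intro exI[of _ 1]) (simp add: K_def)
  qed auto
  then show ?thesis by (rule holomorphic_on_subset) auto
qed

lemma holomorphic_on_qinf [holomorphic_intros]:
  assumes "norm p < 1" "f holomorphic_on A"
  shows "(\<lambda>z. qinf (f z) p) holomorphic_on A"
  using holomorphic_on_compose[OF assms(2) qinf_holomorphic[OF assms(1)]] by (simp add: o_def)

lemma continuous_on_qinf:
  assumes "norm p < 1" "continuous_on A f"
  shows "continuous_on A (\<lambda>z. qinf (f z) p)"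
  by (rule continuous_on_compose2[OF holomorphic_on_imp_continuous_on[OF qinf_holomorphic[OF assms(1)]] assms(2) subset_UNIV])

text \<open>The \<open>r\<close>-th term of a very-well-poised series after multiplication by the infinite products of its
  denominator parameters \<open>bs\<close>, so that \<open>1 / (y; p)\<^sub>r\<close> becomes \<open>(y p\<^sup>r; p)\<^sub>\<infinity>\<close>. One numerator parameter is
  merged with the argument \<open>V\<close> into \<open>pprod\<close>; the others form the list \<open>as\<close>.\<close>

definition reg_term :: "complex \<Rightarrow> complex \<Rightarrow> complex \<Rightarrow> complex \<Rightarrow> complex list \<Rightarrow> complex list \<Rightarrow> nat \<Rightarrow> complex" where
  "reg_term p a V d as bs r = (1 - a * p ^ (2 * r)) * pprod V d p r * (\<Prod>x\<leftarrow>as. qpoch x p r) * (\<Prod>y\<leftarrow>bs. qinf (y * p ^ r) p)"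

text \<open>On a compact set the factors other than \<open>pprod\<close> are bounded uniformly in \<open>r\<close>, and \<open>pprod\<close> decays
  geometrically since \<open>\<bar>V\<bar>\<close> has a maximum below \<open>1\<close>.\<close>

lemma reg_term_bound:
  fixes a V d :: "'a :: topological_space \<Rightarrow> complex" and as bs :: "('a \<Rightarrow> complex) list"
  assumes p: "norm p < 1" and K: "compact K"
    and cont: "continuous_on K a" "continuous_on K V" "continuous_on K d"
      "\<And>f. f \<in> set as \<union> set bs \<Longrightarrow> continuous_on K f"
    and V: "\<And>w. w \<in> K \<Longrightarrow> norm (V w) < 1"
  shows "\<exists>C R. 0 < R \<and> R < 1 \<and> (\<forall>w\<in>K. \<forall>r. norm (reg_term p (a w) (V w) (d w) (map (\<lambda>f. f w) as) (map (\<lambda>f. f w) bs) r) \<le> C * R ^ r)"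
proof -
  have bnd: "\<exists>D\<ge>0. \<forall>w\<in>K. norm (f w) \<le> D" if "continuous_on K f" for f :: "'a \<Rightarrow> complex"
  proof -
    have "bounded (f ` K)" by (intro compact_imp_bounded compact_continuous_image that K)
    then obtain D where "\<forall>w\<in>K. norm (f w) \<le> D" by (auto simp: bounded_iff)
    then show ?thesis by (intro exI[of _ "max D 0"]) (auto intro: order_trans)
  qed
  \<comment> \<open>The lower bound \<open>1 / 2\<close> keeps the ratio positive even where \<open>V\<close> vanishes identically.\<close>
  obtain R where R: "0 < R" "R < 1" "\<And>w. w \<in> K \<Longrightarrow> norm (V w) \<le> R"
  proof (cases "K = {}")
    case True
    then show ?thesis using that[of "1/2"] by auto
  next
    case False
    then obtain w0 where w0: "w0 \<in> K" "\<And>w. w \<in> K \<Longrightarrow> norm (V w) \<le> norm (V w0)"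
      using continuous_attains_sup[OF K False continuous_on_norm[OF cont(2)]] by auto
    show ?thesis
      by (rule that[of "max (1/2) (norm (V w0))"]) (use w0 V[of w0] in \<open>auto simp: le_max_iff_disj\<close>)
  qed
  obtain A where A: "A \<ge> 0" "\<And>w. w \<in> K \<Longrightarrow> norm (a w) \<le> A" using bnd[OF cont(1)] by auto
  obtain D where D: "D \<ge> 0" "\<And>w. w \<in> K \<Longrightarrow> norm (d w) \<le> D" using bnd[OF cont(3)] by auto
  have as_bd: "\<exists>C\<ge>0. \<forall>w\<in>K. \<forall>r. norm (\<Prod>x\<leftarrow>map (\<lambda>f. f w) as. qpoch x p r) \<le> C"
    using cont(4)
  proof (induction as)
    case (Cons f as)
    then obtain C where C: "C \<ge> 0" "\<And>w r. w \<in> K \<Longrightarrow> norm (\<Prod>x\<leftarrow>map (\<lambda>f. f w) as. qpoch x p r) \<le> C"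
      by auto
    obtain E where E: "\<And>w. w \<in> K \<Longrightarrow> norm (f w) \<le> E" using bnd[of f] Cons.prems by auto
    have "norm (\<Prod>x\<leftarrow>map (\<lambda>f. f w) (f # as). qpoch x p r) \<le> exp (E / (1 - norm p)) * C" if "w \<in> K" for w r
      using norm_pprod_le[OF p zero_less_one _ E[OF that], of 1 r] C(2)[OF that, of r]
      by (simp add: norm_mult qpoch_eq_pprod mult_mono)
    then show ?case using C(1) by (intro exI[of _ "exp (E / (1 - norm p)) * C"]) auto
  qed (auto intro: exI[of _ 1])
  have bs_bd: "\<exists>C\<ge>0. \<forall>w\<in>K. \<forall>r. norm (\<Prod>y\<leftarrow>map (\<lambda>f. f w) bs. qinf (y * p ^ r) p) \<le> C"
    using cont(4)
  proof (induction bs)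
    case (Cons f bs)
    then obtain C where C: "C \<ge> 0" "\<And>w r. w \<in> K \<Longrightarrow> norm (\<Prod>y\<leftarrow>map (\<lambda>f. f w) bs. qinf (y * p ^ r) p) \<le> C"
      by auto
    obtain E where E: "\<And>w. w \<in> K \<Longrightarrow> norm (f w) \<le> E" using bnd[of f] Cons.prems by auto
    have "norm (\<Prod>y\<leftarrow>map (\<lambda>f. f w) (f # bs). qinf (y * p ^ r) p) \<le> exp (E / (1 - norm p)) * C" if w: "w \<in> K" for w r
    proof -
      have "norm (f w * p ^ r) \<le> norm (f w) * 1"
        unfolding norm_mult norm_power using p by (intro mult_left_mono power_le_one) auto
      then have "norm (f w * p ^ r) \<le> E" using E[OF w] by simp
      from norm_qinf_le[OF p this] C(2)[OF w, of r] show ?thesis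
        by (simp add: norm_mult mult_mono)
    qed
    then show ?case using C(1) by (intro exI[of _ "exp (E / (1 - norm p)) * C"]) auto
  qed (auto intro: exI[of _ 1])
  obtain C1 where C1: "C1 \<ge> 0" "\<And>w r. w \<in> K \<Longrightarrow> norm (\<Prod>x\<leftarrow>map (\<lambda>f. f w) as. qpoch x p r) \<le> C1"
    using as_bd by auto
  obtain C2 where C2: "C2 \<ge> 0" "\<And>w r. w \<in> K \<Longrightarrow> norm (\<Prod>y\<leftarrow>map (\<lambda>f. f w) bs. qinf (y * p ^ r) p) \<le> C2"
    using bs_bd by auto
  define E where "E = exp (D / R / (1 - norm p))"
  have "norm (reg_term p (a w) (V w) (d w) (map (\<lambda>f. f w) as) (map (\<lambda>f. f w) bs) r) \<le> ((1 + A) * E * C1 * C2) * R ^ r"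
    if w: "w \<in> K" for w r
  proof -
    have "norm (1 - a w * p ^ (2 * r)) \<le> 1 + norm (a w * p ^ (2 * r))"
      using norm_triangle_ineq4[of 1 "a w * p ^ (2 * r)"] by simp
    also have "\<dots> \<le> 1 + A * 1"
      unfolding norm_mult norm_power using p A w by (intro add_mono mult_mono power_le_one) auto
    finally have "norm (1 - a w * p ^ (2 * r)) \<le> 1 + A" by simp
    moreover have "norm (pprod (V w) (d w) p r) \<le> E * R ^ r"
      unfolding E_def by (rule norm_pprod_le[OF p R(1) R(3)[OF w] D(2)[OF w]])
    ultimately have "norm (reg_term p (a w) (V w) (d w) (map (\<lambda>f. f w) as) (map (\<lambda>f. f w) bs) r)
        \<le> (1 + A) * (E * R ^ r) * C1 * C2"
      unfolding reg_term_def norm_mult using A(1) C1 C2 w R(1) by (intro mult_mono) (auto simp: E_def)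
    then show ?thesis by (simp add: mult_ac)
  qed
  with R show ?thesis by blast
qed

lemma reg_term_uniform_limit:
  fixes a V d :: "'a :: topological_space \<Rightarrow> complex" and as bs :: "('a \<Rightarrow> complex) list"
  assumes p: "norm p < 1" and K: "compact K"
    and cont: "continuous_on K a" "continuous_on K V" "continuous_on K d"
      "\<And>f. f \<in> set as \<union> set bs \<Longrightarrow> continuous_on K f"
    and V: "\<And>w. w \<in> K \<Longrightarrow> norm (V w) < 1"
  shows "uniform_limit K (\<lambda>n w. \<Sum>r<n. reg_term p (a w) (V w) (d w) (map (\<lambda>f. f w) as) (map (\<lambda>f. f w) bs) r)
     (\<lambda>w. \<Sum>r. reg_term p (a w) (V w) (d w) (map (\<lambda>f. f w) as) (map (\<lambda>f. f w) bs) r) sequentially"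
proof -
  obtain C R where R: "0 < R" "R < 1" and C: "\<And>w r. w \<in> K \<Longrightarrow>
      norm (reg_term p (a w) (V w) (d w) (map (\<lambda>f. f w) as) (map (\<lambda>f. f w) bs) r) \<le> C * R ^ r"
    using reg_term_bound[OF assms] by blast
  show ?thesis
    using R by (intro Weierstrass_m_test[where M = "\<lambda>r. C * R ^ r"] C summable_mult summable_geometric) auto
qed

lemma reg_term_continuous_term:
  fixes a V d :: "'a :: topological_space \<Rightarrow> complex" and as bs :: "('a \<Rightarrow> complex) list"
  assumes p: "norm p < 1"
    and cont: "continuous_on K a" "continuous_on K V" "continuous_on K d"
      "\<And>f. f \<in> set as \<union> set bs \<Longrightarrow> continuous_on K f"
  shows "continuous_on K (\<lambda>w. reg_term p (a w) (V w) (d w) (map (\<lambda>f. f w) as) (map (\<lambda>f. f w) bs) r)"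
proof -
  have c1: "continuous_on K (\<lambda>w. \<Prod>x\<leftarrow>map (\<lambda>f. f w) as. qpoch x p r)"
    using cont(4) by (induction as) (auto simp: qpoch_def intro!: continuous_intros)
  have c2: "continuous_on K (\<lambda>w. \<Prod>y\<leftarrow>map (\<lambda>f. f w) bs. qinf (y * p ^ r) p)"
    using cont(4) by (induction bs) (auto intro!: continuous_intros continuous_on_qinf p)
  show ?thesis
    unfolding reg_term_def pprod_def by (intro continuous_intros cont(1-3) c1 c2)
qed

lemma reg_term_continuous:
  fixes a V d :: "'a :: heine_borel \<Rightarrow> complex" and as bs :: "('a \<Rightarrow> complex) list"
  assumes p: "norm p < 1" and S: "open S"
    and cont: "continuous_on S a" "continuous_on S V" "continuous_on S d"
      "\<And>f. f \<in> set as \<union> set bs \<Longrightarrow> continuous_on S f"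
    and V: "\<And>w. w \<in> S \<Longrightarrow> norm (V w) < 1"
  shows "continuous_on S (\<lambda>w. \<Sum>r. reg_term p (a w) (V w) (d w) (map (\<lambda>f. f w) as) (map (\<lambda>f. f w) bs) r)"
proof (rule continuous_at_imp_continuous_on, rule ballI)
  fix w assume "w \<in> S"
  then obtain e where e: "e > 0" "cball w e \<subseteq> S" using S open_contains_cball by blast
  note sub = continuous_on_subset[OF _ e(2)]
  have "uniform_limit (cball w e) (\<lambda>n w. \<Sum>r<n. reg_term p (a w) (V w) (d w) (map (\<lambda>f. f w) as) (map (\<lambda>f. f w) bs) r)
     (\<lambda>w. \<Sum>r. reg_term p (a w) (V w) (d w) (map (\<lambda>f. f w) as) (map (\<lambda>f. f w) bs) r) sequentially"
    by (rule reg_term_uniform_limit[OF p]) (use e V sub cont in auto)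
  then have "continuous_on (cball w e) (\<lambda>w. \<Sum>r. reg_term p (a w) (V w) (d w) (map (\<lambda>f. f w) as) (map (\<lambda>f. f w) bs) r)"
    by (rule uniform_limit_theorem[rotated])
       (use sub cont p in \<open>auto intro!: always_eventually continuous_on_sum reg_term_continuous_term\<close>)
  then show "isCont (\<lambda>w. \<Sum>r. reg_term p (a w) (V w) (d w) (map (\<lambda>f. f w) as) (map (\<lambda>f. f w) bs) r) w"
    by (rule continuous_on_interior) (use e(1) in \<open>auto intro!: interiorI[of "ball w e"]\<close>)
qed

lemma reg_term_holomorphic:
  fixes a V d :: "complex \<Rightarrow> complex" and as bs :: "(complex \<Rightarrow> complex) list"
  assumes p: "norm p < 1" and S: "open S"
    and hol: "a holomorphic_on S" "V holomorphic_on S" "d holomorphic_on S"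
      "\<And>f. f \<in> set as \<union> set bs \<Longrightarrow> f holomorphic_on S"
    and V: "\<And>w. w \<in> S \<Longrightarrow> norm (V w) < 1"
  shows "(\<lambda>w. \<Sum>r. reg_term p (a w) (V w) (d w) (map (\<lambda>f. f w) as) (map (\<lambda>f. f w) bs) r) holomorphic_on S"
proof (rule holomorphic_uniform_sequence[OF S])
  have c1: "(\<lambda>w. \<Prod>x\<leftarrow>map (\<lambda>f. f w) as. qpoch x p r) holomorphic_on S" for r
    using hol(4) by (induction as) (auto simp: qpoch_def intro!: holomorphic_intros)
  have c2: "(\<lambda>w. \<Prod>y\<leftarrow>map (\<lambda>f. f w) bs. qinf (y * p ^ r) p) holomorphic_on S" for r
    using hol(4) by (induction bs) (auto intro!: holomorphic_intros p)
  show "(\<lambda>w. \<Sum>r<n. reg_term p (a w) (V w) (d w) (map (\<lambda>f. f w) as) (map (\<lambda>f. f w) bs) r) holomorphic_on S" for n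
    unfolding reg_term_def pprod_def by (intro holomorphic_intros hol(1-3) c1 c2)
  fix w assume "w \<in> S"
  then obtain e where e: "e > 0" "cball w e \<subseteq> S" using S open_contains_cball by blast
  note sub = continuous_on_subset[OF holomorphic_on_imp_continuous_on e(2)]
  have "uniform_limit (cball w e) (\<lambda>n w. \<Sum>r<n. reg_term p (a w) (V w) (d w) (map (\<lambda>f. f w) as) (map (\<lambda>f. f w) bs) r)
     (\<lambda>w. \<Sum>r. reg_term p (a w) (V w) (d w) (map (\<lambda>f. f w) as) (map (\<lambda>f. f w) bs) r) sequentially"
    by (rule reg_term_uniform_limit[OF p]) (use e V sub hol in auto)
  with e show "\<exists>d'>0. cball w d' \<subseteq> S \<and> uniform_limit (cball w d') (\<lambda>n w. \<Sum>r<n. reg_term p (a w) (V w) (d w) (map (\<lambda>f. f w) as) (map (\<lambda>f. f w) bs) r)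
     (\<lambda>w. \<Sum>r. reg_term p (a w) (V w) (d w) (map (\<lambda>f. f w) as) (map (\<lambda>f. f w) bs) r) sequentially"
    by blast
qed

text \<open>This is where convergence of the \<open>8W7\<close> series comes from: its terms are those of a regularised
  series divided by one nonzero constant.\<close>

lemma W87_regularized:
  assumes p: "norm p < 1" and def: "W87_defined a [x1, x2, x3, D, x5] p" and u: "norm u < 1"
  shows "W87 a [x1, x2, x3, D, x5] p u * ((1 - a) * qinf p p *
      (qinf (p * a / x1) p * qinf (p * a / x2) p * qinf (p * a / x3) p * qinf (p * a / D) p * qinf (p * a / x5) p))
    = (\<Sum>r. reg_term p a u (u * D) [a, x1, x2, x3, x5]
        [p, p * a / x1, p * a / x2, p * a / x3, p * a / D, p * a / x5] r)" (is "_ * ?N = (\<Sum>r. ?w r)")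
proof -
  have nz: "a \<noteq> 1" "a \<noteq> 0" "x1 \<noteq> 0" "x2 \<noteq> 0" "x3 \<noteq> 0" "D \<noteq> 0" "x5 \<noteq> 0"
    "\<And>r. qpoch (p * a / x1) p r \<noteq> 0" "\<And>r. qpoch (p * a / x2) p r \<noteq> 0" "\<And>r. qpoch (p * a / x3) p r \<noteq> 0"
    "\<And>r. qpoch (p * a / D) p r \<noteq> 0" "\<And>r. qpoch (p * a / x5) p r \<noteq> 0"
    using def by (auto simp: W87_defined_def)
  define t where "t r = (1 - a * p ^ (2 * r)) / (1 - a) * u ^ r *
        (\<Prod>x\<leftarrow>a # [x1, x2, x3, D, x5]. qpoch x p r / qpoch (p * a / x) p r)" for r
  have w: "?w r = ?N * t r" for r
    unfolding reg_term_def pprod_eq t_def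
    using nz qpoch_self_nonzero[OF p, of r]
    by (simp add: qinf_split[OF p, of "p * a / _" r] qinf_split[OF p, of p r])
  have "?N \<noteq> 0"
    using nz p by (simp add: qinf_nonzero_if_qpoch qpoch_self_nonzero)
  moreover have "summable ?w"
  proof -
    note reg_term_uniform_limit[OF p, of "{0::complex}" "\<lambda>_. a" "\<lambda>_. u" "\<lambda>_. u * D" "map (\<lambda>c _. c) [a, x1, x2, x3, x5]"
      "map (\<lambda>c _. c) [p, p * a / x1, p * a / x2, p * a / x3, p * a / D, p * a / x5]"]
    then have "uniform_limit {0::complex} (\<lambda>n _. \<Sum>r<n. ?w r) (\<lambda>_. \<Sum>r. ?w r) sequentially"
      using u by (auto simp: o_def)
    then have "(\<lambda>n. \<Sum>r<n. ?w r) \<longlonglongrightarrow> (\<Sum>r. ?w r)"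
      by (auto dest: tendsto_uniform_limitI)
    then show ?thesis by (auto simp: summable_def sums_def)
  qed
  ultimately have "summable t"
    unfolding w by (simp add: summable_cmult_iff)
  then have "(\<Sum>r. ?w r) = ?N * (\<Sum>r. t r)"
    unfolding w by (rule suminf_mult)
  then show ?thesis
    by (simp only: W87_def t_def mult.commute)
qed

section \<open>The terminating identity for every value of the parameter\<close>

lemma isCont_qpoch:
  assumes "isCont f x"
  shows "isCont (\<lambda>s. qpoch (f s) p n) x"
  unfolding qpoch_def by (intro continuous_intros assms)

lemma isCont_qinf:
  assumes "norm p < 1" "isCont f x"
  shows "isCont (\<lambda>s. qinf (f s) p) x"
proof -
  have "isCont (\<lambda>a. qinf a p) (f x)"
    using holomorphic_on_imp_continuous_on[OF qinf_holomorphic[OF assms(1), of UNIV]]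
    by (simp add: continuous_on_eq_continuous_at)
  then show ?thesis by (rule isCont_o2[OF assms(2)])
qed

lemma isCont_W_fin:
  assumes p: "\<And>n. qpoch p p n \<noteq> 0"
    and cont: "isCont a x" "isCont b x" "isCont c x" "isCont d x" "isCont e x"
    and a: "a x \<noteq> 1" and an: "qpoch (a x * p) p (2 * n) \<noteq> 0"
    and nz: "b x \<noteq> 0" "c x \<noteq> 0" "d x \<noteq> 0" "e x \<noteq> 0"
    and dn: "qpoch (a x * p / b x) p n \<noteq> 0" "qpoch (a x * p / c x) p n \<noteq> 0"
      "qpoch (a x * p / d x) p n \<noteq> 0" "qpoch (a x * p / e x) p n \<noteq> 0"
  shows "isCont (\<lambda>s. W_fin (a s) (b s) (c s) (d s) (e s) p n) x"
proof -
  have wp: "isCont (\<lambda>s. wp (a s) p (f s) r) x"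
    if "isCont f x" "f x \<noteq> 0" "qpoch (a x * p / f x) p n \<noteq> 0" "r \<le> n" for f r
    unfolding wp_def using that qpoch_nonzero_le[OF that(3,4)]
    by (intro isCont_divide isCont_qpoch continuous_intros cont) auto
  have v: "isCont (\<lambda>s. vwp (a s) p r) x" for r
    unfolding vwp_def using a p by (intro isCont_divide isCont_mult isCont_qpoch continuous_intros cont) auto
  have dd: "isCont (\<lambda>s. 1 / (qpoch p p (n - r) * qpoch (a s * p) p (n + r))) x" if "r \<le> n" for r
  proof -
    have "qpoch (a x * p) p (n + r) \<noteq> 0" using qpoch_nonzero_le[OF an] that by simp
    then show ?thesis using p by (intro isCont_divide isCont_mult isCont_qpoch continuous_intros cont) auto
  qed
  have u: "isCont (\<lambda>s. (a s)\<^sup>2 * p\<^sup>2 / (b s * c s * d s * e s)) x"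
    using nz by (intro isCont_divide continuous_intros cont) auto
  have "isCont (\<lambda>s. \<Sum>r\<le>n. wp (a s) p (b s) r * wp (a s) p (c s) r * wp (a s) p (d s) r * wp (a s) p (e s) r
     * ((a s)\<^sup>2 * p\<^sup>2 / (b s * c s * d s * e s)) ^ r * vwp (a s) p r
     * (1 / (qpoch p p (n - r) * qpoch (a s * p) p (n + r)))) x"
    by (intro continuous_sum isCont_mult isCont_power wp v u dd cont nz dn) auto
  then show ?thesis by (simp add: W_fin_def bailey_sum_def)
qed

lemma wp_inverse_power:
  assumes p0: "p \<noteq> 0" and pn: "\<And>n. qpoch p p n \<noteq> 0" and r: "r \<le> n" and an: "qpoch (a * p) p (2 * n) \<noteq> 0"
  shows "wp a p (1 / p ^ n) r * (p ^ n) ^ r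
    = qpoch p p n * qpoch (a * p) p n * ((- 1) ^ r * tri_power p r)
       / (qpoch p p (n - r) * qpoch (a * p) p (n + r))"
proof -
  have e: "p / (p * p ^ n) = 1 / p ^ n" using p0 by simp
  have "qpoch (1 / p ^ n) p r * (p * p ^ n) ^ r * qpoch p p (n - r)
      = (- 1) ^ r * (tri_power p r * p ^ r) * qpoch p p n"
    using qpoch_reverse[OF r p0 p0] unfolding e .
  then have rev: "qpoch (1 / p ^ n) p r * (p ^ n) ^ r = (- 1) ^ r * tri_power p r * qpoch p p n / qpoch p p (n - r)"
    using p0 pn[of "n - r"] by (simp add: power_mult_distrib field_simps)
  have d: "a * p / (1 / p ^ n) = a * p * p ^ n" by simp
  have s: "qpoch (a * p) p (n + r) = qpoch (a * p) p n * qpoch (a * p * p ^ n) p r"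
    by (rule qpoch_add)
  have "qpoch (a * p) p (n + r) \<noteq> 0" using qpoch_nonzero_le[OF an] r by simp
  with s have nz: "qpoch (a * p) p n \<noteq> 0" "qpoch (a * p * p ^ n) p r \<noteq> 0" by auto
  have "wp a p (1 / p ^ n) r * (p ^ n) ^ r = (qpoch (1 / p ^ n) p r * (p ^ n) ^ r) / qpoch (a * p * p ^ n) p r"
    by (simp add: wp_def d)
  also have "\<dots> = qpoch p p n * qpoch (a * p) p n * ((- 1) ^ r * tri_power p r)
       / (qpoch p p (n - r) * qpoch (a * p) p (n + r))"
    unfolding rev s using nz by (simp add: mult_ac)
  finally show ?thesis .
qed

lemma W87_terminating:
  assumes p0: "p \<noteq> 0" and pn: "\<And>n. qpoch p p n \<noteq> 0" and a0: "a \<noteq> 0"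
    and an: "qpoch (a * p) p (2 * n) \<noteq> 0"
    and u: "u = a\<^sup>2 * p\<^sup>2 / (x1 * x2 * x3 * x5) * p ^ n"
  shows "W87 a [x1, x2, x3, 1 / p ^ n, x5] p u = qpoch p p n * qpoch (a * p) p n * W_fin a x1 x2 x3 x5 p n"
proof -
  define t where "t r = (1 - a * p ^ (2 * r)) / (1 - a) * u ^ r *
        (\<Prod>x\<leftarrow>a # [x1, x2, x3, 1 / p ^ n, x5]. qpoch x p r / qpoch (p * a / x) p r)" for r
  have zero: "t r = 0" if "r \<notin> {..n}" for r
  proof -
    have "qpoch (1 / p ^ n) p (Suc n) = 0" using p0 by (simp add: qpoch_Suc)
    then have "qpoch (1 / p ^ n) p r = 0"
      using qpoch_nonzero_le[of "1 / p ^ n" p r "Suc n"] that by auto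
    then show ?thesis by (simp add: t_def)
  qed
  have "t r = qpoch p p n * qpoch (a * p) p n * (wp a p x1 r * wp a p x2 r * wp a p x3 r * wp a p x5 r
     * (a\<^sup>2 * p\<^sup>2 / (x1 * x2 * x3 * x5)) ^ r * vwp a p r / (qpoch p p (n - r) * qpoch (a * p) p (n + r)))"
    if "r \<le> n" for r
  proof -
    define U where "U = a\<^sup>2 * p\<^sup>2 / (x1 * x2 * x3 * x5)"
    define K where "K = (1 - a * p ^ (2 * r)) / (1 - a) * qpoch a p r / qpoch p p r"
    have "t r = K * U ^ r * (wp a p x1 r * wp a p x2 r * wp a p x3 r * wp a p x5 r) * (wp a p (1 / p ^ n) r * (p ^ n) ^ r)"
      unfolding t_def u U_def[symmetric] power_mult_distrib using a0
      by (simp add: K_def wp_def mult_ac)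
    then show ?thesis
      unfolding wp_inverse_power[OF p0 pn that an] U_def[symmetric] vwp_def
      by (simp add: K_def mult_ac)
  qed
  then have "(\<Sum>r\<le>n. t r) = qpoch p p n * qpoch (a * p) p n * W_fin a x1 x2 x3 x5 p n"
    unfolding W_fin_def bailey_sum_def sum_distrib_left by (intro sum.cong) auto
  moreover have "W87 a [x1, x2, x3, 1 / p ^ n, x5] p u = (\<Sum>r\<le>n. t r)"
    unfolding W87_def t_def[symmetric] by (rule suminf_finite) (use zero in auto)
  ultimately show ?thesis by simp
qed

lemma isCont_eq_limit:
  fixes f g :: "complex \<Rightarrow> complex"
  assumes "isCont f x" "isCont g x" "eventually (\<lambda>s. f s = g s) (at x)"
  shows "f x = g x"
proof -
  have "((\<lambda>s. f s - g s) \<longlongrightarrow> f x - g x) (at x)"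
    using assms(1,2) by (intro tendsto_diff) (auto simp: isCont_def)
  moreover have "((\<lambda>s. f s - g s) \<longlongrightarrow> 0) (at x)"
    by (rule tendsto_eventually) (use assms(3) in \<open>auto elim: eventually_mono\<close>)
  ultimately have "f x - g x = 0" by (rule tendsto_unique[rotated]) simp
  then show ?thesis by simp
qed

text \<open>The generic identity with infinite products restored. In this form both sides are continuous at
  every \<open>s\<close> at which the two series are defined, so the exceptional values of \<open>s\<close> can be filled in.
  The factor \<open>P6\<close> of the generic identity can vanish at such an \<open>s\<close>, hence it is cancelled first.\<close>

lemma terminating_quadratic:
  fixes q z al s :: complex and n :: nat
  defines "Q \<equiv> q ^ Suc n"
  defines "a0 \<equiv> - (Q * s * z ^ 3)" and "a5 \<equiv> - (q * s * z ^ 4 / al)"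
  assumes q: "norm q < 1" "q \<noteq> 0" and z: "z \<noteq> 0" and al: "al \<noteq> 0" and s: "s \<noteq> 0"
    and L: "a0 \<noteq> 1" "qpoch (a0 * q) q (2 * n) \<noteq> 0"
      "\<And>x. x \<in> {q * z / al, - (Q * z\<^sup>2), - (Q * s * z), - (al * z)} \<Longrightarrow> qpoch (a0 * q / x) q n \<noteq> 0"
    and R: "a5 \<noteq> 1" "qpoch (a5 * q\<^sup>2) (q\<^sup>2) (2 * n) \<noteq> 0"
      "\<And>x. x \<in> {- (q * z\<^sup>2), - (z\<^sup>2), - (q * s / al), q\<^sup>2 * z\<^sup>2 / al\<^sup>2} \<Longrightarrow> qpoch (a5 * q\<^sup>2 / x) (q\<^sup>2) n \<noteq> 0"
  shows "qpoch (q * s * z) q n * qpoch q q n * qinf (- (Q * al * s * z\<^sup>2)) q *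
       W_fin a0 (q * z / al) (- (Q * z\<^sup>2)) (- (Q * s * z)) (- (al * z)) q n
     = qpoch (q\<^sup>2 * s * z\<^sup>2 / al) q n * qinf (- (q * al * s * z\<^sup>2)) (q\<^sup>2) * qinf (- (Q\<^sup>2 * al * s * z\<^sup>2)) (q\<^sup>2) *
       qpoch (q\<^sup>2) (q\<^sup>2) n *
       W_fin a5 (- (q * z\<^sup>2)) (- (z\<^sup>2)) (- (q * s / al)) (q\<^sup>2 * z\<^sup>2 / al\<^sup>2) (q\<^sup>2) n"
proof -
  have p2: "norm (q\<^sup>2) < 1" using q by (simp add: norm_power power_less_one_iff)
  have q2: "qpoch (q\<^sup>2) (q\<^sup>2) k \<noteq> 0" and q1: "qpoch q q k \<noteq> 0" for k
    using qpoch_self_nonzero[OF p2] qpoch_self_nonzero[OF q(1)] by auto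
  have Q0: "Q \<noteq> 0" using q by (simp add: Q_def)
  have "a0 * q / (- (Q * s * z)) = q * z\<^sup>2"
    using Q0 s z by (simp add: a0_def divide_simps power2_eq_square power3_eq_cube)
  then have zn: "qpoch (q * z\<^sup>2) q n \<noteq> 0" using L(3)[of "- (Q * s * z)"] by simp
  have "a5 * q\<^sup>2 / (- (q * s / al)) = (q * z\<^sup>2)\<^sup>2"
    using s z al q by (simp add: a5_def divide_simps power2_eq_square power4_eq_xxxx)
  then have "qpoch ((q * z\<^sup>2)\<^sup>2) (q\<^sup>2) n \<noteq> 0" using R(3)[of "- (q * s / al)"] by simp
  then have zn': "qpoch (- (q * z\<^sup>2)) q n \<noteq> 0" by (simp add: qpoch_square)
  have "eventually (\<lambda>s. qpoch (- (q\<^sup>2 * al * z\<^sup>2) * s) (q\<^sup>2) n \<noteq> 0) (at s)"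
    by (rule eventually_qpoch_nonzero) (use q al z in simp)
  with terminating_quadratic_generic[OF q2 q(2) z al zn zn', of s, folded Q_def]
  have ev: "eventually (\<lambda>s. qpoch (q * s * z) q n * qpoch q q n * qinf (- (Q * al * s * z\<^sup>2)) q *
       W_fin (- (Q * s * z ^ 3)) (q * z / al) (- (Q * z\<^sup>2)) (- (Q * s * z)) (- (al * z)) q n
     = qpoch (q\<^sup>2 * s * z\<^sup>2 / al) q n * qinf (- (q * al * s * z\<^sup>2)) (q\<^sup>2) * qinf (- (Q\<^sup>2 * al * s * z\<^sup>2)) (q\<^sup>2) *
       qpoch (q\<^sup>2) (q\<^sup>2) n *
       W_fin (- (q * s * z ^ 4 / al)) (- (q * z\<^sup>2)) (- (z\<^sup>2)) (- (q * s / al)) (q\<^sup>2 * z\<^sup>2 / al\<^sup>2) (q\<^sup>2) n) (at s)"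
  proof eventually_elim
    case (elim s)
    define X0 where "X0 = W_fin (- (Q * s * z ^ 3)) (q * z / al) (- (Q * z\<^sup>2)) (- (Q * s * z)) (- (al * z)) q n"
    define X5 where "X5 = W_fin (- (q * s * z ^ 4 / al)) (- (q * z\<^sup>2)) (- (z\<^sup>2)) (- (q * s / al)) (q\<^sup>2 * z\<^sup>2 / al\<^sup>2) (q\<^sup>2) n"
    define P6 where "P6 = qpoch (- (q\<^sup>2 * al * s * z\<^sup>2)) (q\<^sup>2) n"
    define J where "J = qinf (- (Q * al * s * z\<^sup>2)) q"
    define M where "M = qinf (- (q * al * s * z\<^sup>2)) (q\<^sup>2)"
    define N where "N = qinf (- (Q\<^sup>2 * al * s * z\<^sup>2)) (q\<^sup>2)"
    define P5 where "P5 = qpoch (- (q * al * s * z\<^sup>2)) q n"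
    have "- (q\<^sup>2 * al * z\<^sup>2) * s = - (q\<^sup>2 * al * s * z\<^sup>2)" by (simp add: mult_ac)
    with elim(2) have P60: "P6 \<noteq> 0" by (simp only: P6_def not_False_eq_True)
    have "P5 * J = qinf (- (q * al * s * z\<^sup>2)) q"
      unfolding P5_def J_def qinf_split[OF q(1), of "- (q * al * s * z\<^sup>2)" n] by (simp add: Q_def mult_ac)
    also have "\<dots> = M * qinf (- (q\<^sup>2 * al * s * z\<^sup>2)) (q\<^sup>2)"
      unfolding M_def qinf_double[OF q(1), of "- (q * al * s * z\<^sup>2)"] by (simp add: power2_eq_square mult_ac)
    also have "qinf (- (q\<^sup>2 * al * s * z\<^sup>2)) (q\<^sup>2) = P6 * N"
    proof -
      have "Q\<^sup>2 = q\<^sup>2 * (q\<^sup>2) ^ n" by (simp add: Q_def power_mult_distrib power_mult[symmetric] mult.commute)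
      then show ?thesis
        unfolding P6_def N_def qinf_split[OF p2, of "- (q\<^sup>2 * al * s * z\<^sup>2)" n] by (simp add: mult_ac)
    qed
    finally have PJ: "P5 * J = M * (P6 * N)" .
    have "P6 * (qpoch (q * s * z) q n * qpoch q q n * J * X0) = qpoch q q n * J * (qpoch (q * s * z) q n * P6 * X0)"
      by (simp add: mult_ac)
    also have "\<dots> = qpoch q q n * J * (qpoch (- q) q n * P5 * qpoch (q\<^sup>2 * s * z\<^sup>2 / al) q n * X5)"
      using elim(1) by (simp only: P6_def X0_def P5_def X5_def)
    also have "\<dots> = qpoch (q\<^sup>2) (q\<^sup>2) n * (P5 * J) * qpoch (q\<^sup>2 * s * z\<^sup>2 / al) q n * X5"
      by (simp add: qpoch_square mult_ac)
    also have "\<dots> = P6 * (qpoch (q\<^sup>2 * s * z\<^sup>2 / al) q n * M * N * qpoch (q\<^sup>2) (q\<^sup>2) n * X5)"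
      unfolding PJ by (simp add: mult_ac)
    finally show ?case using P60 by (simp add: X0_def X5_def J_def M_def N_def)
  qed
  have c0: "isCont (\<lambda>s. W_fin (- (Q * s * z ^ 3)) (q * z / al) (- (Q * z\<^sup>2)) (- (Q * s * z)) (- (al * z)) q n) s"
  proof (rule isCont_W_fin[OF q1])
    show "isCont (\<lambda>s. - (Q * s * z ^ 3)) s" "isCont (\<lambda>s. q * z / al) s" "isCont (\<lambda>s. - (Q * z\<^sup>2)) s" "isCont (\<lambda>s. - (Q * s * z)) s" "isCont (\<lambda>s. - (al * z)) s"
      using al by (intro continuous_intros; simp)+
    show "- (Q * s * z ^ 3) \<noteq> 1" "qpoch (- (Q * s * z ^ 3) * q) q (2 * n) \<noteq> 0"
      using L(1,2) by (simp_all only: a0_def not_False_eq_True)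
    show "q * z / al \<noteq> 0" "- (Q * z\<^sup>2) \<noteq> 0" "- (Q * s * z) \<noteq> 0" "- (al * z) \<noteq> 0"
      using q Q0 z al s by simp_all
    show "qpoch (- (Q * s * z ^ 3) * q / (q * z / al)) q n \<noteq> 0" "qpoch (- (Q * s * z ^ 3) * q / (- (Q * z\<^sup>2))) q n \<noteq> 0" "qpoch (- (Q * s * z ^ 3) * q / (- (Q * s * z))) q n \<noteq> 0" "qpoch (- (Q * s * z ^ 3) * q / (- (al * z))) q n \<noteq> 0"
      by (rule L(3)[unfolded a0_def]; blast)+
  qed
  have c5: "isCont (\<lambda>s. W_fin (- (q * s * z ^ 4 / al)) (- (q * z\<^sup>2)) (- (z\<^sup>2)) (- (q * s / al)) (q\<^sup>2 * z\<^sup>2 / al\<^sup>2) (q\<^sup>2) n) s"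
  proof (rule isCont_W_fin[OF q2])
    show "isCont (\<lambda>s. - (q * s * z ^ 4 / al)) s" "isCont (\<lambda>s. - (q * z\<^sup>2)) s" "isCont (\<lambda>s. - (z\<^sup>2)) s" "isCont (\<lambda>s. - (q * s / al)) s" "isCont (\<lambda>s. q\<^sup>2 * z\<^sup>2 / al\<^sup>2) s"
      using al by (intro continuous_intros; simp)+
    show "- (q * s * z ^ 4 / al) \<noteq> 1" "qpoch (- (q * s * z ^ 4 / al) * q\<^sup>2) (q\<^sup>2) (2 * n) \<noteq> 0"
      using R(1,2) by (simp_all only: a5_def not_False_eq_True)
    show "- (q * z\<^sup>2) \<noteq> 0" "- (z\<^sup>2) \<noteq> 0" "- (q * s / al) \<noteq> 0" "q\<^sup>2 * z\<^sup>2 / al\<^sup>2 \<noteq> 0"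
      using q z al s by simp_all
    show "qpoch (- (q * s * z ^ 4 / al) * q\<^sup>2 / (- (q * z\<^sup>2))) (q\<^sup>2) n \<noteq> 0" "qpoch (- (q * s * z ^ 4 / al) * q\<^sup>2 / (- (z\<^sup>2))) (q\<^sup>2) n \<noteq> 0" "qpoch (- (q * s * z ^ 4 / al) * q\<^sup>2 / (- (q * s / al))) (q\<^sup>2) n \<noteq> 0" "qpoch (- (q * s * z ^ 4 / al) * q\<^sup>2 / (q\<^sup>2 * z\<^sup>2 / al\<^sup>2)) (q\<^sup>2) n \<noteq> 0"
      by (rule R(3)[unfolded a5_def]; blast)+
  qed
  show ?thesis
    unfolding a0_def a5_def
    by (rule isCont_eq_limit[OF _ _ ev])
       (use al in \<open>intro isCont_mult c0 c5 isCont_qpoch isCont_qinf p2 q(1) continuous_intros; simp\<close>)+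
qed

section \<open>Holomorphic functions of several variables\<close>

lemma holomorphic_several_const: "open S \<Longrightarrow> holomorphic_several (\<lambda>w. c) S"
  by (simp add: holomorphic_several_def)

lemma holomorphic_several_coord:
  fixes S :: "(complex ^ 'n) set"
  shows "open S \<Longrightarrow> holomorphic_several (\<lambda>w. w $ k) S"
  unfolding holomorphic_several_def
proof (intro conjI ballI allI)
  fix w and i :: 'n
  show "(\<lambda>t. (\<chi> j. if j = i then t else w $ j) $ k) field_differentiable at (w $ i)"
    by (cases "k = i") simp_all
qed (auto intro!: continuous_intros)

lemma holomorphic_several_uminus: "holomorphic_several f S \<Longrightarrow> holomorphic_several (\<lambda>w. - f w) S"
  unfolding holomorphic_several_def by (auto intro!: continuous_intros field_differentiable_minus)

lemma update_same: "(\<chi> j. if j = i then w $ i else w $ j) = w"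
  by (simp add: vec_eq_iff)

lemma holomorphic_several_mult:
  "holomorphic_several f S \<Longrightarrow> holomorphic_several g S \<Longrightarrow> holomorphic_several (\<lambda>w. f w * g w) S"
  unfolding holomorphic_several_def by (auto intro!: continuous_intros field_differentiable_mult)

lemma holomorphic_several_divide:
  "holomorphic_several f S \<Longrightarrow> holomorphic_several g S \<Longrightarrow> (\<And>w. w \<in> S \<Longrightarrow> g w \<noteq> 0)
    \<Longrightarrow> holomorphic_several (\<lambda>w. f w / g w) S"
  unfolding holomorphic_several_def
  by (auto intro!: continuous_intros field_differentiable_divide simp: update_same)

lemma holomorphic_several_power:
  assumes "holomorphic_several f S"
  shows "holomorphic_several (\<lambda>w. f w ^ n) S"
proof (induction n)
  case 0
  then show ?case using assms by (simp add: holomorphic_several_const holomorphic_several_def)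
next
  case (Suc n)
  then show ?case using holomorphic_several_mult[OF assms] by simp
qed

lemma holomorphic_several_qinf:
  assumes "norm p < 1" "holomorphic_several f S"
  shows "holomorphic_several (\<lambda>w. qinf (f w) p) S"
  unfolding holomorphic_several_def
proof (intro conjI ballI allI)
  show "open S" "continuous_on S (\<lambda>w. qinf (f w) p)"
    using assms by (auto simp: holomorphic_several_def intro!: continuous_on_qinf)
  fix w i assume "w \<in> S"
  then have f: "(\<lambda>t. f (\<chi> j. if j = i then t else w $ j)) field_differentiable at (w $ i)"
    using assms(2) by (auto simp: holomorphic_several_def)
  have "(\<lambda>a. qinf a p) field_differentiable at x" for x
    using qinf_holomorphic[OF assms(1), of UNIV] holomorphic_on_imp_differentiable_at by blast
  from field_differentiable_compose[OF f this]
  show "(\<lambda>t. qinf (f (\<chi> j. if j = i then t else w $ j)) p) field_differentiable at (w $ i)"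
    by (simp add: o_def)
qed

text \<open>Holomorphy along a coordinate line through \<open>w\<close>, at all of its points in \<open>S\<close> rather than only
  at \<open>w\<close>, as the theorems on functions of one variable require.\<close>

lemma holomorphic_several_slice:
  fixes f :: "complex ^ 'n \<Rightarrow> complex"
  assumes "holomorphic_several f S"
  shows "(\<lambda>t. f (\<chi> j. if j = i then t else w $ j)) holomorphic_on {t. (\<chi> j. if j = i then t else w $ j) \<in> S}"
  unfolding holomorphic_on_def
proof (rule ballI, rule field_differentiable_at_within)
  fix t assume t: "t \<in> {t. (\<chi> j. if j = i then t else w $ j) \<in> S}"
  define u where "u = (\<chi> j. if j = i then t else w $ j)"
  have "(\<lambda>t. f (\<chi> j. if j = i then t else u $ j)) field_differentiable at (u $ i)"
    using assms t unfolding holomorphic_several_def u_def[symmetric] mem_Collect_eq by blast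
  moreover have "(\<chi> j. if j = i then t' else u $ j) = (\<chi> j. if j = i then t' else w $ j)" for t'
    by (simp add: u_def vec_eq_iff)
  ultimately show "(\<lambda>t. f (\<chi> j. if j = i then t else w $ j)) field_differentiable at t"
    by (simp add: u_def)
qed

lemma continuous_on_update:
  "continuous_on UNIV (\<lambda>t. (\<chi> j. if j = i then t else (w :: complex ^ 'n) $ j))"
proof (rule continuous_on_vec_lambda)
  show "continuous_on UNIV (\<lambda>t. if j = i then t else w $ j)" for j
    by (cases "j = i") (auto intro: continuous_intros)
qed

lemma holomorphic_several_reg_series:
  fixes a V d :: "complex ^ 'n \<Rightarrow> complex"
  assumes p: "norm p < 1" and S: "open S"
    and hol: "holomorphic_several a S" "holomorphic_several V S" "holomorphic_several d S"
      "\<And>f. f \<in> set as \<union> set bs \<Longrightarrow> holomorphic_several f S"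
    and V: "\<And>w. w \<in> S \<Longrightarrow> norm (V w) < 1"
  shows "holomorphic_several (\<lambda>w. \<Sum>r. reg_term p (a w) (V w) (d w) (map (\<lambda>f. f w) as) (map (\<lambda>f. f w) bs) r) S"
    (is "holomorphic_several ?F S")
  unfolding holomorphic_several_def
proof (intro conjI ballI allI)
  show "open S" by fact
  show "continuous_on S ?F"
    by (rule reg_term_continuous[OF p S]) (use hol V in \<open>auto simp: holomorphic_several_def\<close>)
  fix w and i :: 'n assume w: "w \<in> S"
  define \<phi> where "\<phi> t = (\<chi> j. if j = i then t else w $ j)" for t
  define T where "T = {t. \<phi> t \<in> S}"
  have T: "open T"
    using open_vimage[OF S, of \<phi>] continuous_on_update[of i w] by (simp add: T_def \<phi>_def vimage_def)
  have sl: "(\<lambda>t. f (\<phi> t)) holomorphic_on T" if "holomorphic_several f S" for f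
    unfolding T_def \<phi>_def by (rule holomorphic_several_slice[OF that])
  have "(\<lambda>t. \<Sum>r. reg_term p (a (\<phi> t)) (V (\<phi> t)) (d (\<phi> t)) (map (\<lambda>f. f t) (map (\<lambda>f t. f (\<phi> t)) as))
      (map (\<lambda>f. f t) (map (\<lambda>f t. f (\<phi> t)) bs)) r) holomorphic_on T"
    by (rule reg_term_holomorphic[OF p T]) (use hol V sl in \<open>auto simp: T_def\<close>)
  then have "(\<lambda>t. ?F (\<phi> t)) holomorphic_on T" by (simp add: o_def)
  moreover have "w $ i \<in> T" using w by (simp add: T_def \<phi>_def update_same)
  ultimately show "(\<lambda>t. ?F (\<chi> j. if j = i then t else w $ j)) field_differentiable at (w $ i)"
    using holomorphic_on_imp_differentiable_at[OF _ T] unfolding \<phi>_def by blast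
qed

text \<open>The absolute value of \<open>t\<close> is determined by the index of the factor that vanishes.\<close>

lemma countable_zeros_qinf:
  assumes p: "norm p < 1" and c: "c \<noteq> 0" and k: "k > 0"
  shows "countable {t::real. 0 < t \<and> qinf (c * of_real t ^ k) p = 0}"
proof (rule countable_subset)
  show "{t::real. 0 < t \<and> qinf (c * of_real t ^ k) p = 0} \<subseteq> range (\<lambda>i. root k (1 / norm (c * p ^ i)))"
  proof (safe)
    fix t :: real assume t: "0 < t" "qinf (c * of_real t ^ k) p = 0"
    then obtain i where i: "c * of_real t ^ k * p ^ i = 1" using qinf_eq_0_iff[OF p] by blast
    then have "norm (c * of_real t ^ k * p ^ i) = 1" by simp
    then have "t ^ k * norm (c * p ^ i) = 1"
      using t by (simp add: norm_mult norm_power mult_ac)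
    then have "t ^ k = 1 / norm (c * p ^ i)"
      by (metis mult_zero_right nonzero_eq_divide_eq zero_neq_one)
    then have "t = root k (1 / norm (c * p ^ i))"
      using real_root_power_cancel[OF k] t by (metis less_imp_le)
    then show "t \<in> range (\<lambda>i. root k (1 / norm (c * p ^ i)))" by blast
  qed
qed simp

lemma countable_prod_zeros:
  fixes f g :: "real \<Rightarrow> complex"
  assumes "countable {t. 0 < t \<and> f t = 0}" "countable {t. 0 < t \<and> g t = 0}"
  shows "countable {t. 0 < t \<and> f t * g t = 0}"
proof -
  have "{t. 0 < t \<and> f t * g t = 0} = {t. 0 < t \<and> f t = 0} \<union> {t. 0 < t \<and> g t = 0}" by auto
  then show ?thesis using assms by simp
qed

lemma countable_zeros_monomial:
  assumes "norm p < 1" "f 1 \<noteq> 0" "k > 0" "\<And>t. f t = f 1 * of_real t ^ k"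
  shows "countable {t::real. 0 < t \<and> qinf (f t) p = 0}"
  using countable_zeros_qinf[OF assms(1-3)] unfolding assms(4)[symmetric] .

text \<open>Scaling both \<open>x\<close> and \<open>z\<close> changes every product whose zeros matter, since each of them contains
  a positive power of \<open>x\<close> or \<open>z\<close>.\<close>

definition scale_xz :: "complex ^ 4 \<Rightarrow> real \<Rightarrow> complex ^ 4" where
  "scale_xz w t = (\<chi> i. if i = 1 \<or> i = 2 then w $ i else of_real t * w $ i)"

lemma scale_xz_nth [simp]:
  "scale_xz w t $ 1 = w $ 1" "scale_xz w t $ 2 = w $ 2"
  "scale_xz w t $ 3 = of_real t * w $ 3" "scale_xz w t $ 4 = of_real t * w $ 4"
  by (simp_all add: scale_xz_def)

text \<open>A ball inside the zero set would contain \<open>scale_xz w t\<close> for an uncountable set of \<open>t\<close> around \<open>1\<close>.\<close>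

lemma interior_zeros_empty:
  assumes "\<And>w. w \<in> U \<Longrightarrow> countable {t. 0 < t \<and> f (scale_xz w t) = 0}"
  shows "interior {w \<in> U. f w = 0} = {}"
proof (rule ccontr)
  define Z where "Z = interior {w \<in> U. f w = 0}"
  assume "interior {w \<in> U. f w = 0} \<noteq> {}"
  then obtain w where w: "w \<in> Z" by (auto simp: Z_def)
  have ZU: "Z \<subseteq> {w \<in> U. f w = 0}" unfolding Z_def by (rule interior_subset)
  have "continuous_on UNIV (scale_xz w)"
    unfolding scale_xz_def[abs_def]
  proof (rule continuous_on_vec_lambda)
    show "continuous_on UNIV (\<lambda>t. if i = 1 \<or> i = 2 then w $ i else complex_of_real t * w $ i)" for i :: 4
      by (cases "i = 1 \<or> i = 2") (auto intro!: continuous_intros)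
  qed
  moreover have "open Z" by (simp add: Z_def)
  ultimately have "open (scale_xz w -` Z \<inter> {0<..})"
    by (intro open_Int open_vimage) auto
  moreover have "scale_xz w 1 = w" by (simp add: scale_xz_def vec_eq_iff)
  then have "1 \<in> scale_xz w -` Z \<inter> {0<..}" using w by simp
  ultimately obtain e where e: "e > 0" "ball 1 e \<subseteq> scale_xz w -` Z \<inter> {0<..}"
    by (meson open_contains_ball)
  have "ball 1 e \<subseteq> {t. 0 < t \<and> f (scale_xz w t) = 0}"
    using e(2) ZU by auto
  moreover have "countable {t. 0 < t \<and> f (scale_xz w t) = 0}"
    using assms w ZU by blast
  ultimately have "countable (ball (1::real) e)" by (rule countable_subset)
  moreover have "uncountable (ball (1::real) e)" using e(1) by (rule uncountable_ball)
  ultimately show False by blast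
qed

section \<open>Both sides as quotients of holomorphic functions\<close>

text \<open>The regularised left series as a function of \<open>al = \<alpha>\<close>, \<open>v = 1 / \<beta>\<close>, \<open>s = \<beta> x\<close> and \<open>z\<close>. The parameter
  merged with the argument is \<open>h z / v\<close>, and the merged product \<open>- Q s z\<close> is free of \<open>v\<close>.\<close>

definition reg_left :: "complex \<Rightarrow> complex \<Rightarrow> complex \<Rightarrow> complex \<Rightarrow> complex \<Rightarrow> complex \<Rightarrow> complex" where
  "reg_left Q h al v s z = (\<Sum>r. reg_term Q (- (h * s * v * z\<^sup>2)) (- (h * s * v)) (- (Q * s * z))
     [- (h * s * v * z\<^sup>2), Q * z / al, - (h * z * v), - (al * z), - (h * s * v)]
     [Q, - (h * al * s * v * z), Q * s * z, h * Q * s * v * z / al, - (Q * s * v\<^sup>2 * z), Q * z\<^sup>2] r)"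

text \<open>The regularised right series in the same coordinates; here \<open>Q z\<^sup>2 / v\<^sup>2\<close> is merged with the
  argument.\<close>

definition reg_right :: "complex \<Rightarrow> complex \<Rightarrow> complex \<Rightarrow> complex \<Rightarrow> complex \<Rightarrow> complex" where
  "reg_right Q al v s z = (\<Sum>r. reg_term (Q\<^sup>2) (- (Q * s * z ^ 4 / al)) (- (Q * al * s * v\<^sup>2)) (- (Q\<^sup>2 * al * s * z\<^sup>2))
     [- (Q * s * z ^ 4 / al), Q\<^sup>2 * z\<^sup>2 / al\<^sup>2, - (Q * z\<^sup>2), - (z\<^sup>2), - (Q * s / al)]
     [Q\<^sup>2, - (Q * al * s * z\<^sup>2), Q\<^sup>2 * s * z\<^sup>2 / al, Q ^ 3 * s * z\<^sup>2 / al, - (Q\<^sup>2 * s * v\<^sup>2 * z\<^sup>2 / al), Q\<^sup>2 * z ^ 4] r)"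

text \<open>The factor by which the left side has to be multiplied to give \<open>reg_left\<close>. The four products in
  the numerator of the left side are already those of four of the denominator parameters of the series.\<close>

definition den_left :: "complex \<Rightarrow> complex \<Rightarrow> complex \<Rightarrow> complex \<Rightarrow> complex \<Rightarrow> complex \<Rightarrow> complex" where
  "den_left Q h al v s z = qinf (h * s * v) Q * qinf (- (h * s * v * z\<^sup>2)) Q * qinf (Q\<^sup>2 * s * z\<^sup>2 / al) Q
     * qinf Q Q * qinf (Q * z\<^sup>2) Q"

text \<open>The factor that clears the denominators of the right side; it does not depend on \<open>v\<close>. Besides
  \<open>reg_right\<close>, the product \<open>(- Q \<alpha> s v\<^sup>2; Q\<^sup>2)\<^sub>\<infinity>\<close> from the numerator remains.\<close>

definition den_right :: "complex \<Rightarrow> complex \<Rightarrow> complex \<Rightarrow> complex \<Rightarrow> complex" where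
  "den_right Q al s z = qinf (- (Q * s * z ^ 4 / al)) (Q\<^sup>2) * qinf (Q\<^sup>2) (Q\<^sup>2) *
     qinf (Q\<^sup>2 * s * z\<^sup>2 / al) (Q\<^sup>2) * qinf (Q ^ 3 * s * z\<^sup>2 / al) (Q\<^sup>2) * qinf (Q\<^sup>2 * z ^ 4) (Q\<^sup>2)"

lemma qinf_head: "norm p < 1 \<Longrightarrow> qinf a p = (1 - a) * qinf (p * a) p"
  using qinf_split[of p a 1] by (simp add: qpoch_def mult.commute)

lemma eventually_norm_less_1:
  fixes f :: "complex \<Rightarrow> complex"
  assumes "isCont f 0" "f 0 = 0"
  shows "eventually (\<lambda>v. norm (f v) < 1) (at 0)"
proof -
  have "((\<lambda>v. norm (f v)) \<longlongrightarrow> norm (f 0)) (at 0)"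
    using assms(1) by (intro tendsto_norm) (simp add: isCont_def)
  then show ?thesis by (rule order_tendstoD) (simp add: assms(2))
qed

lemma reg_left_holomorphic:
  assumes p: "norm Q < 1" and S: "open S" and conv: "\<And>v. v \<in> S \<Longrightarrow> norm (h * s * v) < 1" and al: "al \<noteq> 0"
  shows "(\<lambda>v. reg_left Q h al v s z) holomorphic_on S"
proof -
  have "(\<lambda>v. \<Sum>r. reg_term Q (- (h * s * v * z\<^sup>2)) (- (h * s * v)) (- (Q * s * z))
     (map (\<lambda>f. f v) [\<lambda>v. - (h * s * v * z\<^sup>2), \<lambda>v. Q * z / al, \<lambda>v. - (h * z * v), \<lambda>v. - (al * z), \<lambda>v. - (h * s * v)])
     (map (\<lambda>f. f v) [\<lambda>v. Q, \<lambda>v. - (h * al * s * v * z), \<lambda>v. Q * s * z, \<lambda>v. h * Q * s * v * z / al,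
        \<lambda>v. - (Q * s * v\<^sup>2 * z), \<lambda>v. Q * z\<^sup>2]) r) holomorphic_on S"
    by (rule reg_term_holomorphic[OF p S]) (use conv al in \<open>auto intro!: holomorphic_intros\<close>)
  then show ?thesis unfolding reg_left_def by simp
qed

lemma reg_right_holomorphic:
  assumes p: "norm Q < 1" and S: "open S" and conv: "\<And>v. v \<in> S \<Longrightarrow> norm (Q * al * s * v\<^sup>2) < 1" and al: "al \<noteq> 0"
  shows "(\<lambda>v. reg_right Q al v s z) holomorphic_on S"
proof -
  have p2: "norm (Q\<^sup>2) < 1" using p by (simp add: norm_power power_less_one_iff)
  have "(\<lambda>v. \<Sum>r. reg_term (Q\<^sup>2) (- (Q * s * z ^ 4 / al)) (- (Q * al * s * v\<^sup>2)) (- (Q\<^sup>2 * al * s * z\<^sup>2))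
     (map (\<lambda>f. f v) [\<lambda>v. - (Q * s * z ^ 4 / al), \<lambda>v. Q\<^sup>2 * z\<^sup>2 / al\<^sup>2, \<lambda>v. - (Q * z\<^sup>2), \<lambda>v. - (z\<^sup>2), \<lambda>v. - (Q * s / al)])
     (map (\<lambda>f. f v) [\<lambda>v. Q\<^sup>2, \<lambda>v. - (Q * al * s * z\<^sup>2), \<lambda>v. Q\<^sup>2 * s * z\<^sup>2 / al, \<lambda>v. Q ^ 3 * s * z\<^sup>2 / al,
        \<lambda>v. - (Q\<^sup>2 * s * v\<^sup>2 * z\<^sup>2 / al), \<lambda>v. Q\<^sup>2 * z ^ 4]) r) holomorphic_on S"
    by (rule reg_term_holomorphic[OF p2 S]) (use conv al in \<open>auto intro!: holomorphic_intros\<close>)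
  then show ?thesis unfolding reg_right_def by simp
qed

definition region :: "real \<Rightarrow> (complex ^ 4) set" where
  "region q = {w. param_domain q (w $ 1) (w $ 2) (w $ 3) (w $ 4)}"

context
  fixes q :: real and Q h :: complex
  assumes q: "0 < q" "q < 1" and Q: "Q = of_real q" and h: "h = of_real (q powr (1/2))"
begin

lemma h_mult_h: "h * h = Q"
  unfolding h Q of_real_mult[symmetric] using q by (simp add: powr_add[symmetric])

lemma Q_nonzero: "Q \<noteq> 0" and h_nonzero: "h \<noteq> 0" and norm_Q_less_1: "norm Q < 1" and norm_Q2_less_1: "norm (Q\<^sup>2) < 1"
  using q by (simp_all add: Q h norm_power power_less_one_iff)

lemma three_halves: "of_real (q powr (3/2)) = h * Q"
proof -
  have "q powr (3/2) = q powr (1/2 + 1)" by simp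
  also have "\<dots> = q powr (1/2) * q" using q by (simp only: powr_add powr_one)
  finally show ?thesis by (simp add: h Q)
qed

context
  fixes al v s z :: complex
  assumes nz: "al \<noteq> 0" "v \<noteq> 0" "s \<noteq> 0" "z \<noteq> 0"
begin

lemma left_a0_eq: "left_a0 q (s * v) z = - (h * s * v * z\<^sup>2)"
  by (simp add: left_a0_def h)

lemma left_params_eq:
  "left_params q al (1 / v) (s * v) z = [Q * z / al, - (h * z * v), - (al * z), h * z / v, - (h * s * v)]"
  by (simp add: left_params_def h Q Let_def)

lemma right_a0_eq: "right_a0 q al (1 / v) (s * v) z = - (Q * s * z ^ 4 / al)"
  using nz by (simp add: right_a0_def Q)

lemma right_params_eq:
  "right_params q al (1 / v) (s * v) z = [Q\<^sup>2 * z\<^sup>2 / al\<^sup>2, - (Q * z\<^sup>2), - (z\<^sup>2), Q * z\<^sup>2 / v\<^sup>2, - (Q * s / al)]"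
  using nz by (simp add: right_params_def Q Let_def power_divide)

lemma left_quotients:
  "Q * (- (h * s * v * z\<^sup>2)) / (Q * z / al) = - (h * al * s * v * z)"
  "Q * (- (h * s * v * z\<^sup>2)) / (- (h * z * v)) = Q * s * z"
  "Q * (- (h * s * v * z\<^sup>2)) / (- (al * z)) = h * Q * s * v * z / al"
  "Q * (- (h * s * v * z\<^sup>2)) / (h * z / v) = - (Q * s * v\<^sup>2 * z)"
  "Q * (- (h * s * v * z\<^sup>2)) / (- (h * s * v)) = Q * z\<^sup>2"
  "- (h * s * v) * (h * z / v) = - (Q * s * z)"
  using nz Q_nonzero h_nonzero by (simp_all add: divide_simps power2_eq_square h_mult_h[symmetric])

lemma right_quotients:
  "Q\<^sup>2 * (- (Q * s * z ^ 4 / al)) / (Q\<^sup>2 * z\<^sup>2 / al\<^sup>2) = - (Q * al * s * z\<^sup>2)"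
  "Q\<^sup>2 * (- (Q * s * z ^ 4 / al)) / (- (Q * z\<^sup>2)) = Q\<^sup>2 * s * z\<^sup>2 / al"
  "Q\<^sup>2 * (- (Q * s * z ^ 4 / al)) / (- (z\<^sup>2)) = Q ^ 3 * s * z\<^sup>2 / al"
  "Q\<^sup>2 * (- (Q * s * z ^ 4 / al)) / (Q * z\<^sup>2 / v\<^sup>2) = - (Q\<^sup>2 * s * v\<^sup>2 * z\<^sup>2 / al)"
  "Q\<^sup>2 * (- (Q * s * z ^ 4 / al)) / (- (Q * s / al)) = Q\<^sup>2 * z ^ 4"
  "- (Q * al * s * v\<^sup>2) * (Q * z\<^sup>2 / v\<^sup>2) = - (Q\<^sup>2 * al * s * z\<^sup>2)"
  using nz Q_nonzero by (simp_all add: divide_simps power2_eq_square power3_eq_cube power4_eq_xxxx)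

lemma left_defined_iff:
  "W87_defined (left_a0 q (s * v) z) (left_params q al (1 / v) (s * v) z) Q \<longleftrightarrow>
     - (h * s * v * z\<^sup>2) \<noteq> 1 \<and> (\<forall>r. qpoch (- (h * al * s * v * z)) Q r \<noteq> 0 \<and> qpoch (Q * s * z) Q r \<noteq> 0
       \<and> qpoch (h * Q * s * v * z / al) Q r \<noteq> 0 \<and> qpoch (- (Q * s * v\<^sup>2 * z)) Q r \<noteq> 0 \<and> qpoch (Q * z\<^sup>2) Q r \<noteq> 0)"
proof -
  have "Q * (- (h * s * v * z\<^sup>2)) / (- (h * s * v * z\<^sup>2)) = Q"
    using nz h_nonzero by simp
  then show ?thesis
    unfolding W87_defined_def left_a0_eq left_params_eq
    using nz Q_nonzero h_nonzero qpoch_self_nonzero[OF norm_Q_less_1]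
    by (simp only: list.simps(15) Set.ball_simps(7) left_quotients list.set(1) Set.ball_simps(5)) auto
qed

lemma right_defined_iff:
  "W87_defined (right_a0 q al (1 / v) (s * v) z) (right_params q al (1 / v) (s * v) z) (Q\<^sup>2) \<longleftrightarrow>
     - (Q * s * z ^ 4 / al) \<noteq> 1 \<and> (\<forall>r. qpoch (- (Q * al * s * z\<^sup>2)) (Q\<^sup>2) r \<noteq> 0 \<and> qpoch (Q\<^sup>2 * s * z\<^sup>2 / al) (Q\<^sup>2) r \<noteq> 0
       \<and> qpoch (Q ^ 3 * s * z\<^sup>2 / al) (Q\<^sup>2) r \<noteq> 0 \<and> qpoch (- (Q\<^sup>2 * s * v\<^sup>2 * z\<^sup>2 / al)) (Q\<^sup>2) r \<noteq> 0
       \<and> qpoch (Q\<^sup>2 * z ^ 4) (Q\<^sup>2) r \<noteq> 0)"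
proof -
  have "Q\<^sup>2 * (- (Q * s * z ^ 4 / al)) / (- (Q * s * z ^ 4 / al)) = Q\<^sup>2"
    using nz Q_nonzero by simp
  then show ?thesis
    unfolding W87_defined_def right_a0_eq right_params_eq
    using nz Q_nonzero h_nonzero qpoch_self_nonzero[OF norm_Q2_less_1]
    by (simp only: list.simps(15) Set.ball_simps(7) right_quotients list.set(1) Set.ball_simps(5)) auto
qed

lemma left_denom_eq:
  "left_denom q al (1 / v) (s * v) z = qinf (h * s * v) Q * qinf (- (h * Q * s * v * z\<^sup>2)) Q * qinf (Q\<^sup>2 * s * z\<^sup>2 / al) Q"
  using nz by (simp add: left_denom_def Let_def three_halves h[symmetric] Q[symmetric] mult_ac)

lemma right_denom_eq: "right_denom q al (1 / v) (s * v) z = qinf (- (Q ^ 3 * s * z ^ 4 / al)) (Q\<^sup>2)"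
  using nz by (simp add: right_denom_def Let_def Q[symmetric] mult_ac)

lemma left_side_eq:
  "left_side q al (1 / v) (s * v) z = qinf (Q * s * z) Q * qinf (- (Q * s * v\<^sup>2 * z)) Q * qinf (h * Q * s * v * z / al) Q
      * qinf (- (h * al * s * v * z)) Q / left_denom q al (1 / v) (s * v) z
      * W87 (- (h * s * v * z\<^sup>2)) [Q * z / al, - (h * z * v), - (al * z), h * z / v, - (h * s * v)] Q (- (h * s * v))"
proof -
  have eqs: "Q * (1 / v) * (s * v) * z = Q * s * z" "- (Q * (s * v) * z / (1 / v)) = - (Q * s * v\<^sup>2 * z)"
    "h * Q * (s * v) * z / al = h * Q * s * v * z / al" "- h * al * (s * v) * z = - (h * al * s * v * z)"
    "- h * (s * v) = - (h * s * v)"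
    using nz by (simp_all add: power2_eq_square)
  then show ?thesis
    unfolding left_side_def Let_def left_a0_eq left_params_eq three_halves h[symmetric] Q[symmetric]
    by (simp only: eqs qpoch_inf_Cons qpoch_inf_Nil mult_1_right mult.assoc [of "qinf _ _"])
qed

lemma right_side_eq:
  "right_side q al (1 / v) (s * v) z = qinf (- (Q\<^sup>2 * s * v\<^sup>2 * z\<^sup>2 / al)) (Q\<^sup>2) * qinf (- (Q * al * s * z\<^sup>2)) (Q\<^sup>2)
      * qinf (- (Q * al * s * v\<^sup>2)) (Q\<^sup>2) / right_denom q al (1 / v) (s * v) z
      * W87 (- (Q * s * z ^ 4 / al)) [Q\<^sup>2 * z\<^sup>2 / al\<^sup>2, - (Q * z\<^sup>2), - (z\<^sup>2), Q * z\<^sup>2 / v\<^sup>2, - (Q * s / al)] (Q\<^sup>2) (- (Q * al * s * v\<^sup>2))"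
proof -
  have eqs: "- (Q\<^sup>2 * (s * v) * z\<^sup>2 / (al * (1 / v))) = - (Q\<^sup>2 * s * v\<^sup>2 * z\<^sup>2 / al)"
    "- Q * al * (1 / v) * (s * v) * z\<^sup>2 = - (Q * al * s * z\<^sup>2)"
    "- (Q * al * (s * v) / (1 / v)) = - (Q * al * s * v\<^sup>2)"
    using nz by (simp_all add: power2_eq_square)
  then show ?thesis
    unfolding right_side_def Let_def right_a0_eq right_params_eq Q[symmetric]
    by (simp only: eqs qpoch_inf_Cons qpoch_inf_Nil mult_1_right mult.assoc [of "qinf _ _"])
qed

lemma left_side_regularized:
  assumes conv: "norm (h * s * v) < 1" and den: "left_denom q al (1 / v) (s * v) z \<noteq> 0"
    and def: "W87_defined (left_a0 q (s * v) z) (left_params q al (1 / v) (s * v) z) Q"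
  shows "left_side q al (1 / v) (s * v) z * den_left Q h al v s z = reg_left Q h al v s z"
proof -
  have W: "W87_defined (- (h * s * v * z\<^sup>2)) [Q * z / al, - (h * z * v), - (al * z), h * z / v, - (h * s * v)] Q"
    using def by (simp only: left_a0_eq left_params_eq)
  have "norm (- (h * s * v)) < 1" using conv by simp
  note reg = W87_regularized[OF norm_Q_less_1 W this, unfolded left_quotients, folded reg_left_def]
  have "qinf (- (h * s * v * z\<^sup>2)) Q = (1 - - (h * s * v * z\<^sup>2)) * qinf (- (h * Q * s * v * z\<^sup>2)) Q"
    using qinf_head[OF norm_Q_less_1, of "- (h * s * v * z\<^sup>2)"] by (simp add: mult_ac)
  then show ?thesis
    unfolding reg[symmetric] left_side_eq den_left_def using den[unfolded left_denom_eq]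
    unfolding left_denom_eq by (simp add: field_simps)
qed

lemma right_side_regularized:
  assumes conv: "norm (Q * al * s * v\<^sup>2) < 1" and den: "right_denom q al (1 / v) (s * v) z \<noteq> 0"
    and def: "W87_defined (right_a0 q al (1 / v) (s * v) z) (right_params q al (1 / v) (s * v) z) (Q\<^sup>2)"
  shows "right_side q al (1 / v) (s * v) z * den_right Q al s z
     = qinf (- (Q * al * s * v\<^sup>2)) (Q\<^sup>2) * reg_right Q al v s z"
proof -
  have W: "W87_defined (- (Q * s * z ^ 4 / al)) [Q\<^sup>2 * z\<^sup>2 / al\<^sup>2, - (Q * z\<^sup>2), - (z\<^sup>2), Q * z\<^sup>2 / v\<^sup>2, - (Q * s / al)] (Q\<^sup>2)"
    using def by (simp only: right_a0_eq right_params_eq)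
  have "norm (- (Q * al * s * v\<^sup>2)) < 1" using conv by simp
  note reg = W87_regularized[OF norm_Q2_less_1 W this, unfolded right_quotients, folded reg_right_def]
  have "qinf (- (Q * s * z ^ 4 / al)) (Q\<^sup>2) = (1 - - (Q * s * z ^ 4 / al)) * qinf (- (Q ^ 3 * s * z ^ 4 / al)) (Q\<^sup>2)"
    using qinf_head[OF norm_Q2_less_1, of "- (Q * s * z ^ 4 / al)"] by (simp add: mult_ac power2_eq_square power3_eq_cube)
  then show ?thesis
    unfolding reg[symmetric] right_side_eq den_right_def using den[unfolded right_denom_eq]
    unfolding right_denom_eq by (simp add: mult_ac)
qed

text \<open>At \<open>v = h z Q\<^sup>n\<close> the parameter \<open>h z / v\<close> is \<open>Q\<^sup>-\<^sup>n\<close> and \<open>Q z\<^sup>2 / v\<^sup>2\<close> is \<open>Q\<^sup>-\<^sup>2\<^sup>n\<close>. Splitting \<open>n\<close> factors off the infinite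
  products reduces the claim to \<open>terminating_quadratic\<close>.\<close>

lemma sides_equal_terminating:
  assumes v: "v = h * z * Q ^ n"
    and dl: "left_denom q al (1 / v) (s * v) z \<noteq> 0" and dr: "right_denom q al (1 / v) (s * v) z \<noteq> 0"
    and L: "W87_defined (left_a0 q (s * v) z) (left_params q al (1 / v) (s * v) z) Q"
    and R: "W87_defined (right_a0 q al (1 / v) (s * v) z) (right_params q al (1 / v) (s * v) z) (Q\<^sup>2)"
  shows "left_side q al (1 / v) (s * v) z = right_side q al (1 / v) (s * v) z"
proof -
  define T where "T = Q ^ Suc n"
  have T0: "T \<noteq> 0" using Q_nonzero by (simp add: T_def)
  have hv: "h * v = T * z" "h * z / v = 1 / Q ^ n" "v\<^sup>2 = T * Q ^ n * z\<^sup>2" "Q * z\<^sup>2 / v\<^sup>2 = 1 / (Q\<^sup>2) ^ n"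
    using nz Q_nonzero h_nonzero by (simp_all add: v T_def h_mult_h[symmetric] power2_eq_square divide_simps power_mult_distrib)
  define a0 where "a0 = - (T * s * z ^ 3)"
  define a5 where "a5 = - (Q * s * z ^ 4 / al)"
  have hz: "h * s * v = T * s * z" "h * z * v = T * z\<^sup>2" "h * s * v * z\<^sup>2 = T * s * z ^ 3"
    "h * al * s * v * z = T * al * s * z\<^sup>2" "h * Q * s * v * z / al = Q\<^sup>2 * s * z\<^sup>2 / al * Q ^ n"
    "h * Q * s * v * z\<^sup>2 = T * s * z ^ 3 * Q" "Q * s * v\<^sup>2 * z = T * s * z ^ 3 * Q * Q ^ n"
    "Q\<^sup>2 * s * v\<^sup>2 * z\<^sup>2 / al = Q ^ 3 * s * z ^ 4 / al * (Q\<^sup>2) ^ n"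
    "Q * al * s * v\<^sup>2 = T\<^sup>2 * al * s * z\<^sup>2"
    using hv nz by (simp_all add: algebra_simps power2_eq_square power3_eq_cube power4_eq_xxxx T_def power_mult_distrib)
  have hzz: "T * s * z * z\<^sup>2 = T * s * z ^ 3" by (simp add: power2_eq_square power3_eq_cube)
  have Lq: "- (T * s * z ^ 3) \<noteq> 1" "qpoch (- (T * al * s * z\<^sup>2)) Q r \<noteq> 0" "qpoch (Q * s * z) Q r \<noteq> 0"
    "qpoch (Q\<^sup>2 * s * z\<^sup>2 / al * Q ^ n) Q r \<noteq> 0" "qpoch (Q * z\<^sup>2) Q r \<noteq> 0" for r
    using L[unfolded left_defined_iff hz hzz] by blast+
  have Rq: "- (Q * s * z ^ 4 / al) \<noteq> 1" "qpoch (- (Q * al * s * z\<^sup>2)) (Q\<^sup>2) r \<noteq> 0"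
    "qpoch (Q\<^sup>2 * s * z\<^sup>2 / al) (Q\<^sup>2) r \<noteq> 0" "qpoch (Q ^ 3 * s * z\<^sup>2 / al) (Q\<^sup>2) r \<noteq> 0"
    "qpoch (Q\<^sup>2 * z ^ 4) (Q\<^sup>2) r \<noteq> 0" for r
    using R[unfolded right_defined_iff] by blast+
  have dl': "qinf (T * s * z) Q \<noteq> 0" "qinf (a0 * Q) Q \<noteq> 0" "qinf (Q\<^sup>2 * s * z\<^sup>2 / al) Q \<noteq> 0"
    using dl[unfolded left_denom_eq hz hzz] by (auto simp: a0_def)
  have dr': "qinf (a5 * Q\<^sup>2) (Q\<^sup>2) \<noteq> 0"
    using dr[unfolded right_denom_eq] by (simp add: a5_def mult_ac power2_eq_square power3_eq_cube)
  have an: "qpoch (a0 * Q) Q (2 * n) \<noteq> 0" and a5n: "qpoch (a5 * Q\<^sup>2) (Q\<^sup>2) (2 * n) \<noteq> 0"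
    using qpoch_nonzero_if_qinf[OF norm_Q_less_1 dl'(2)] qpoch_nonzero_if_qinf[OF norm_Q2_less_1 dr'] by auto
  define X0 where "X0 = W_fin a0 (Q * z / al) (- (T * z\<^sup>2)) (- (T * s * z)) (- (al * z)) Q n"
  define X5 where "X5 = W_fin a5 (- (Q * z\<^sup>2)) (- (z\<^sup>2)) (- (Q * s / al)) (Q\<^sup>2 * z\<^sup>2 / al\<^sup>2) (Q\<^sup>2) n"
  have key: "qpoch (Q * s * z) Q n * qpoch Q Q n * qinf (- (T * al * s * z\<^sup>2)) Q * X0
     = qpoch (Q\<^sup>2 * s * z\<^sup>2 / al) Q n * qinf (- (Q * al * s * z\<^sup>2)) (Q\<^sup>2) * qinf (- (T\<^sup>2 * al * s * z\<^sup>2)) (Q\<^sup>2) *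
       qpoch (Q\<^sup>2) (Q\<^sup>2) n * X5"
    unfolding X0_def X5_def a0_def a5_def T_def
  proof (rule terminating_quadratic[OF norm_Q_less_1 Q_nonzero nz(4,1,3)]; (fold T_def)?)
    show "- (T * s * z ^ 3) \<noteq> 1" "- (Q * s * z ^ 4 / al) \<noteq> 1" by (rule Lq Rq)+
    show "qpoch (- (T * s * z ^ 3) * Q) Q (2 * n) \<noteq> 0" "qpoch (- (Q * s * z ^ 4 / al) * Q\<^sup>2) (Q\<^sup>2) (2 * n) \<noteq> 0"
      using an a5n by (simp_all only: a0_def a5_def not_False_eq_True)
    fix x
    show "qpoch (- (T * s * z ^ 3) * Q / x) Q n \<noteq> 0"
      if "x \<in> {Q * z / al, - (T * z\<^sup>2), - (T * s * z), - (al * z)}"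
      unfolding mult.commute[of "- (T * s * z ^ 3)" Q]
      using that by (elim insertE emptyE; hypsubst; unfold left_quotients[unfolded hz hzz]; intro Lq)
    show "qpoch (- (Q * s * z ^ 4 / al) * Q\<^sup>2 / x) (Q\<^sup>2) n \<noteq> 0"
      if "x \<in> {- (Q * z\<^sup>2), - (z\<^sup>2), - (Q * s / al), Q\<^sup>2 * z\<^sup>2 / al\<^sup>2}"
      unfolding mult.commute[of "- (Q * s * z ^ 4 / al)" "Q\<^sup>2"]
      using that by (elim insertE emptyE; hypsubst; unfold right_quotients; intro Rq)
  qed
  have WL: "W87 a0 [Q * z / al, - (T * z\<^sup>2), - (al * z), 1 / Q ^ n, - (T * s * z)] Q (- (T * s * z))
     = qpoch Q Q n * qpoch (a0 * Q) Q n * X0"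
  proof -
    have perm: "X0 = W_fin a0 (Q * z / al) (- (T * z\<^sup>2)) (- (al * z)) (- (T * s * z)) Q n"
      by (simp add: X0_def W_fin_def mult_ac)
    have u: "- (T * s * z) = a0\<^sup>2 * Q\<^sup>2 / ((Q * z / al) * (- (T * z\<^sup>2)) * (- (al * z)) * (- (T * s * z))) * Q ^ n"
      using nz Q_nonzero by (simp add: a0_def T_def divide_simps power2_eq_square power3_eq_cube)
    have "a0 \<noteq> 0" using nz T0 by (simp add: a0_def)
    from W87_terminating[OF Q_nonzero qpoch_self_nonzero[OF norm_Q_less_1] this an u] show ?thesis unfolding perm .
  qed
  have WR: "W87 a5 [Q\<^sup>2 * z\<^sup>2 / al\<^sup>2, - (Q * z\<^sup>2), - (z\<^sup>2), 1 / (Q\<^sup>2) ^ n, - (Q * s / al)] (Q\<^sup>2) (- (T\<^sup>2 * al * s * z\<^sup>2))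
     = qpoch (Q\<^sup>2) (Q\<^sup>2) n * qpoch (a5 * Q\<^sup>2) (Q\<^sup>2) n * X5"
  proof -
    have perm: "X5 = W_fin a5 (Q\<^sup>2 * z\<^sup>2 / al\<^sup>2) (- (Q * z\<^sup>2)) (- (z\<^sup>2)) (- (Q * s / al)) (Q\<^sup>2) n"
      by (simp add: X5_def W_fin_def mult_ac)
    have u: "- (T\<^sup>2 * al * s * z\<^sup>2) = a5\<^sup>2 * (Q\<^sup>2)\<^sup>2 / ((Q\<^sup>2 * z\<^sup>2 / al\<^sup>2) * (- (Q * z\<^sup>2)) * (- (z\<^sup>2)) * (- (Q * s / al))) * (Q\<^sup>2) ^ n"
      using nz Q_nonzero by (simp add: a5_def T_def divide_simps power2_eq_square power4_eq_xxxx power_mult_distrib)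
    have "Q\<^sup>2 \<noteq> 0" "a5 \<noteq> 0" using nz Q_nonzero by (simp_all add: a5_def)
    from W87_terminating[OF this(1) qpoch_self_nonzero[OF norm_Q2_less_1] this(2) a5n u] show ?thesis unfolding perm .
  qed
  have sp1: "qinf (Q * s * z) Q = qpoch (Q * s * z) Q n * qinf (T * s * z) Q"
    using qinf_split[OF norm_Q_less_1, of "Q * s * z" n] by (simp add: T_def mult_ac)
  have sp2: "qinf (a0 * Q) Q = qpoch (a0 * Q) Q n * qinf (a0 * Q * Q ^ n) Q"
    by (rule qinf_split[OF norm_Q_less_1])
  have sp3: "qinf (Q\<^sup>2 * s * z\<^sup>2 / al) Q = qpoch (Q\<^sup>2 * s * z\<^sup>2 / al) Q n * qinf (Q\<^sup>2 * s * z\<^sup>2 / al * Q ^ n) Q"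
    by (rule qinf_split[OF norm_Q_less_1])
  have sp4: "qinf (a5 * Q\<^sup>2) (Q\<^sup>2) = qpoch (a5 * Q\<^sup>2) (Q\<^sup>2) n * qinf (a5 * Q\<^sup>2 * (Q\<^sup>2) ^ n) (Q\<^sup>2)"
    by (rule qinf_split[OF norm_Q2_less_1])
  have aq: "- (T * s * z ^ 3 * Q) = a0 * Q" "- (T * s * z ^ 3 * Q * Q ^ n) = a0 * Q * Q ^ n"
     "- (Q ^ 3 * s * z ^ 4 / al * (Q\<^sup>2) ^ n) = a5 * Q\<^sup>2 * (Q\<^sup>2) ^ n" "- (Q ^ 3 * s * z ^ 4 / al) = a5 * Q\<^sup>2"
    by (simp_all add: a0_def a5_def power2_eq_square power3_eq_cube)
  have nzs: "qpoch (a0 * Q) Q n \<noteq> 0" "qinf (a0 * Q * Q ^ n) Q \<noteq> 0" "qpoch (Q\<^sup>2 * s * z\<^sup>2 / al) Q n \<noteq> 0"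
    "qinf (Q\<^sup>2 * s * z\<^sup>2 / al * Q ^ n) Q \<noteq> 0" "qpoch (a5 * Q\<^sup>2) (Q\<^sup>2) n \<noteq> 0" "qinf (a5 * Q\<^sup>2 * (Q\<^sup>2) ^ n) (Q\<^sup>2) \<noteq> 0"
    using dl' dr' sp2 sp3 sp4 by auto
  have "left_side q al (1 / v) (s * v) z
      = qpoch (Q * s * z) Q n * qpoch Q Q n * qinf (- (T * al * s * z\<^sup>2)) Q * X0 / qpoch (Q\<^sup>2 * s * z\<^sup>2 / al) Q n"
    unfolding left_side_eq left_denom_eq hz hzz hv(2) aq WL[unfolded a0_def] a0_def[symmetric] WL sp1 sp2 sp3
    using nzs dl'(1) by simp
  also have "\<dots> = qinf (- (Q * al * s * z\<^sup>2)) (Q\<^sup>2) * qinf (- (T\<^sup>2 * al * s * z\<^sup>2)) (Q\<^sup>2) * qpoch (Q\<^sup>2) (Q\<^sup>2) n * X5"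
    unfolding key using nzs by simp
  also have "\<dots> = right_side q al (1 / v) (s * v) z"
    unfolding right_side_eq right_denom_eq hz hv(4) aq a5_def[symmetric] WR sp4
    using nzs by simp
  finally show ?thesis .
qed

end

section \<open>Analytic continuation in the reciprocal of the second parameter\<close>

text \<open>The identity theorem on the star-shaped set \<open>S\<close>, with the points \<open>V n\<close> accumulating at \<open>0\<close>. The
  conditions needed at \<open>V n\<close> split into two kinds: those that do not involve \<open>v\<close> hold because they
  hold at \<open>v0\<close>, and the others hold for large \<open>n\<close> because the quantities involved tend to \<open>0\<close>.\<close>

lemma regularized_identity:
  assumes nz: "al \<noteq> 0" "v0 \<noteq> 0" "s \<noteq> 0" "z \<noteq> 0"
    and conv: "norm (h * s * v0) < 1" "norm (Q * al * s * v0\<^sup>2) < 1"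
    and dl: "left_denom q al (1 / v0) (s * v0) z \<noteq> 0" and dr: "right_denom q al (1 / v0) (s * v0) z \<noteq> 0"
    and L: "W87_defined (left_a0 q (s * v0) z) (left_params q al (1 / v0) (s * v0) z) Q"
    and R: "W87_defined (right_a0 q al (1 / v0) (s * v0) z) (right_params q al (1 / v0) (s * v0) z) (Q\<^sup>2)"
  shows "reg_left Q h al v0 s z * den_right Q al s z
    = qinf (- (Q * al * s * v0\<^sup>2)) (Q\<^sup>2) * reg_right Q al v0 s z * den_left Q h al v0 s z"
proof -
  define S where "S = {v. norm (h * s * v) < 1 \<and> norm (Q * al * s * v\<^sup>2) < 1}"
  define F where "F v = reg_left Q h al v s z * den_right Q al s z
    - qinf (- (Q * al * s * v\<^sup>2)) (Q\<^sup>2) * reg_right Q al v s z * den_left Q h al v s z" for v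
  have S: "open S"
    unfolding S_def by (intro open_Collect_conj open_Collect_less continuous_intros)
  have star: "starlike S"
    unfolding starlike_def
  proof (intro bexI[of _ 0] ballI subsetI)
    fix v w assume v: "v \<in> S" and "w \<in> closed_segment 0 v"
    then obtain u where u: "0 \<le> u" "u \<le> 1" "w = of_real u * v"
      by (auto simp: closed_segment_def scaleR_conv_of_real)
    have "norm (h * s * w) \<le> norm (h * s * v) * 1"
      using u by (simp add: norm_mult mult_left_le_one_le mult_left_mono)
    moreover have "norm (Q * al * s * w\<^sup>2) \<le> norm (Q * al * s * v\<^sup>2) * 1"
      using u by (simp add: norm_mult norm_power power_mult_distrib mult_left_le_one_le mult_left_mono power_le_one)
    ultimately show "w \<in> S" using v by (auto simp: S_def)
  qed (simp add: S_def)
  have F: "F holomorphic_on S"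
    unfolding F_def den_left_def
    by (intro holomorphic_intros reg_left_holomorphic reg_right_holomorphic norm_Q_less_1 norm_Q2_less_1 S nz(1))
       (auto simp: S_def nz)
  \<comment> \<open>At a good \<open>v\<close> every \<open>v\<close>-dependent parameter of a product in a denominator lies in the unit disc, so that product does not vanish.\<close>
  define good where "good v \<longleftrightarrow> norm (- (h * s * v * z\<^sup>2)) < 1 \<and> norm (h * s * v) < 1 \<and> norm (Q * al * s * v\<^sup>2) < 1
     \<and> norm (- (h * al * s * v * z)) < 1 \<and> norm (h * Q * s * v * z / al) < 1 \<and> norm (- (Q * s * v\<^sup>2 * z)) < 1
     \<and> norm (- (Q\<^sup>2 * s * v\<^sup>2 * z\<^sup>2 / al)) < 1 \<and> norm (- (h * Q * s * v * z\<^sup>2)) < 1" for v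
  have ev: "eventually good (at 0)"
    unfolding good_def by (intro eventually_conj eventually_norm_less_1) (use nz in \<open>auto intro!: continuous_intros\<close>)
  have Fz: "F v = 0" if good: "good v" and v: "v = h * z * Q ^ n" for v n
  proof -
    have v0: "v \<noteq> 0" using nz Q_nonzero h_nonzero by (simp add: v)
    note nzv = nz(1) v0 nz(3,4)
    note Lq = L[unfolded left_defined_iff[OF nz]] and Rq = R[unfolded right_defined_iff[OF nz]]
    have small: "qpoch x Q r \<noteq> 0" "qpoch x (Q\<^sup>2) r \<noteq> 0" "qinf x Q \<noteq> 0" "x \<noteq> 1" if "norm x < 1" for x r
      using that qpoch_nonzero_small[OF norm_Q_less_1 that] qpoch_nonzero_small[OF norm_Q2_less_1 that] qinf_nonzero_if_qpoch[OF norm_Q_less_1] by auto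
    have L': "W87_defined (left_a0 q (s * v) z) (left_params q al (1 / v) (s * v) z) Q"
      unfolding left_defined_iff[OF nzv] using Lq good by (auto simp only: good_def small)
    have R': "W87_defined (right_a0 q al (1 / v) (s * v) z) (right_params q al (1 / v) (s * v) z) (Q\<^sup>2)"
      unfolding right_defined_iff[OF nzv] using Rq good by (auto simp only: good_def small)
    have dl': "left_denom q al (1 / v) (s * v) z \<noteq> 0"
      using dl good unfolding left_denom_eq[OF nzv] left_denom_eq[OF nz] good_def
      by (simp only: mult_eq_0_iff small de_Morgan_disj not_False_eq_True simp_thms)
    have dr': "right_denom q al (1 / v) (s * v) z \<noteq> 0"
      using dr unfolding right_denom_eq[OF nzv] right_denom_eq[OF nz] .
    have eq: "left_side q al (1 / v) (s * v) z = right_side q al (1 / v) (s * v) z"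
      by (rule sides_equal_terminating[OF nzv v dl' dr' L' R'])
    have "reg_left Q h al v s z = left_side q al (1 / v) (s * v) z * den_left Q h al v s z"
      by (rule left_side_regularized[OF nzv _ dl' L', symmetric]) (use good in \<open>simp add: good_def\<close>)
    moreover have "qinf (- (Q * al * s * v\<^sup>2)) (Q\<^sup>2) * reg_right Q al v s z
        = right_side q al (1 / v) (s * v) z * den_right Q al s z"
      by (rule right_side_regularized[OF nzv _ dr' R', symmetric]) (use good in \<open>simp add: good_def\<close>)
    ultimately show "F v = 0" unfolding F_def eq by simp
  qed
  define V where "V n = h * z * Q ^ n" for n
  have V0: "V n \<noteq> 0" for n using nz Q_nonzero h_nonzero by (simp add: V_def)
  have lim: "V \<longlonglongrightarrow> 0"
    unfolding V_def using tendsto_mult[OF tendsto_const[of "h * z"] LIMSEQ_power_zero[OF norm_Q_less_1]] by simp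
  have "filterlim V (at 0) sequentially"
    unfolding filterlim_at using lim V0 by auto
  then have "eventually (\<lambda>n. good (V n)) sequentially"
    using ev by (auto simp: filterlim_iff)
  then obtain N where N: "\<And>n. n \<ge> N \<Longrightarrow> good (V n)" by (auto simp: eventually_sequentially)
  define U where "U = (\<lambda>n. V (n + N)) ` UNIV"
  have "F v0 = 0"
  proof (rule analytic_continuation[OF F S starlike_imp_connected[OF star], of U 0])
    show "U \<subseteq> S" using N by (auto simp: U_def S_def good_def)
    show "(0::complex) \<in> S" "v0 \<in> S" using conv by (auto simp: S_def)
    show "0 islimpt U"
      unfolding islimpt_sequential U_def
      by (intro exI[of _ "\<lambda>n. V (n + N)"]) (use V0 LIMSEQ_ignore_initial_segment[OF lim] in auto)
    show "F v = 0" if vU: "v \<in> U" for v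
    proof -
      obtain n where n: "v = V (n + N)" using vU by (auto simp: U_def)
      show ?thesis unfolding n by (rule Fz[OF N V_def]) simp
    qed
  qed
  then show ?thesis by (simp add: F_def)
qed

lemma sides_equal:
  assumes nz: "al \<noteq> 0" "v \<noteq> 0" "s \<noteq> 0" "z \<noteq> 0"
    and conv: "norm (h * s * v) < 1" "norm (Q * al * s * v\<^sup>2) < 1"
    and dl: "left_denom q al (1 / v) (s * v) z \<noteq> 0" and dr: "right_denom q al (1 / v) (s * v) z \<noteq> 0"
    and L: "W87_defined (left_a0 q (s * v) z) (left_params q al (1 / v) (s * v) z) Q"
    and R: "W87_defined (right_a0 q al (1 / v) (s * v) z) (right_params q al (1 / v) (s * v) z) (Q\<^sup>2)"
  shows "left_side q al (1 / v) (s * v) z = right_side q al (1 / v) (s * v) z"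
proof -
  note Lq = L[unfolded left_defined_iff[OF nz]] and Rq = R[unfolded right_defined_iff[OF nz]]
  note inf = qinf_nonzero_if_qpoch[OF norm_Q_less_1] qinf_nonzero_if_qpoch[OF norm_Q2_less_1]
  have "qinf (- (h * s * v * z\<^sup>2)) Q = (1 - - (h * s * v * z\<^sup>2)) * qinf (- (h * Q * s * v * z\<^sup>2)) Q"
    using qinf_head[OF norm_Q_less_1, of "- (h * s * v * z\<^sup>2)"] by (simp add: mult_ac)
  moreover have "1 - - (h * s * v * z\<^sup>2) \<noteq> 0" using Lq by (metis right_minus_eq)
  moreover note dl[unfolded left_denom_eq[OF nz]]
  ultimately have "qinf (- (h * s * v * z\<^sup>2)) Q \<noteq> 0" "qinf (h * s * v) Q \<noteq> 0" "qinf (Q\<^sup>2 * s * z\<^sup>2 / al) Q \<noteq> 0"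
    by (metis mult_eq_0_iff)+
  then have "den_left Q h al v s z \<noteq> 0"
    unfolding den_left_def using Lq inf(1) qpoch_self_nonzero[OF norm_Q_less_1] by simp
  moreover have "den_right Q al s z \<noteq> 0"
  proof -
    have "qinf (- (Q * s * z ^ 4 / al)) (Q\<^sup>2) = (1 - - (Q * s * z ^ 4 / al)) * qinf (- (Q ^ 3 * s * z ^ 4 / al)) (Q\<^sup>2)"
      using qinf_head[OF norm_Q2_less_1, of "- (Q * s * z ^ 4 / al)"] by (simp add: mult_ac power2_eq_square power3_eq_cube)
    moreover have "1 - - (Q * s * z ^ 4 / al) \<noteq> 0" using Rq by (metis right_minus_eq)
    moreover note dr[unfolded right_denom_eq[OF nz]]
    ultimately have "qinf (- (Q * s * z ^ 4 / al)) (Q\<^sup>2) \<noteq> 0" by (metis mult_eq_0_iff)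
    then show ?thesis
      unfolding den_right_def using Rq inf(2) qpoch_self_nonzero[OF norm_Q2_less_1] by simp
  qed
  moreover have "left_side q al (1 / v) (s * v) z * den_left Q h al v s z * den_right Q al s z
     = right_side q al (1 / v) (s * v) z * den_right Q al s z * den_left Q h al v s z"
    unfolding left_side_regularized[OF nz conv(1) dl L] right_side_regularized[OF nz conv(2) dr R]
    by (rule regularized_identity[OF nz conv dl dr L R])
  ultimately show ?thesis by simp
qed

section \<open>Meromorphy of both sides\<close>

lemma region_iff: "w \<in> region q \<longleftrightarrow> w $ 1 \<noteq> 0 \<and> w $ 2 \<noteq> 0 \<and> w $ 3 \<noteq> 0 \<and> w $ 4 \<noteq> 0
    \<and> norm (h * w $ 3) < 1 \<and> norm (Q * w $ 1 * w $ 3 / w $ 2) < 1"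
  by (simp add: region_def param_domain_def Q h)

lemma open_region: "open (region q)"
proof -
  have "region q = {w. w $ 1 \<noteq> 0 \<and> w $ 2 \<noteq> 0 \<and> w $ 3 \<noteq> 0 \<and> w $ 4 \<noteq> 0
    \<and> norm (h * w $ 3) < 1 \<and> norm (Q * w $ 1 * w $ 3) < norm (w $ 2)}"
    unfolding set_eq_iff region_iff by (auto simp: norm_divide divide_less_eq)
  also have "open \<dots>"
    by (intro open_Collect_conj open_Collect_less open_Collect_neq continuous_intros)
  finally show ?thesis .
qed

text \<open>Passing from \<open>(\<alpha>, \<beta>, x, z)\<close> to the coordinates \<open>v = 1 / \<beta>\<close> and \<open>s = \<beta> x\<close>.\<close>

lemma region_coords:
  assumes "w \<in> region q"
  shows "1 / (1 / w $ 2) = w $ 2" "w $ 2 * w $ 3 * (1 / w $ 2) = w $ 3"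
    "w $ 1 \<noteq> 0" "1 / w $ 2 \<noteq> 0" "w $ 2 * w $ 3 \<noteq> 0" "w $ 4 \<noteq> 0"
    "norm (h * (w $ 2 * w $ 3) * (1 / w $ 2)) < 1"
    "norm (Q * w $ 1 * (w $ 2 * w $ 3) * (1 / w $ 2)\<^sup>2) < 1"
  using assms unfolding region_iff by (auto simp: power2_eq_square mult.assoc)

lemmas region_intros = holomorphic_several_const[OF open_region] holomorphic_several_coord[OF open_region]
  holomorphic_several_uminus holomorphic_several_mult holomorphic_several_divide holomorphic_several_power
  holomorphic_several_qinf[OF norm_Q_less_1] holomorphic_several_qinf[OF norm_Q2_less_1]

lemma holomorphic_several_reg_left: "holomorphic_several (\<lambda>w. reg_left Q h (w $ 1) (1 / w $ 2) (w $ 2 * w $ 3) (w $ 4)) (region q)"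
proof -
  have "holomorphic_several (\<lambda>w. \<Sum>r. reg_term Q (- (h * (w $ 2 * w $ 3) * (1 / w $ 2) * (w $ 4)\<^sup>2))
     (- (h * (w $ 2 * w $ 3) * (1 / w $ 2))) (- (Q * (w $ 2 * w $ 3) * w $ 4))
     (map (\<lambda>f. f w) [\<lambda>w. - (h * (w $ 2 * w $ 3) * (1 / w $ 2) * (w $ 4)\<^sup>2), \<lambda>w. Q * w $ 4 / w $ 1, \<lambda>w. - (h * w $ 4 * (1 / w $ 2)),
        \<lambda>w. - (w $ 1 * w $ 4), \<lambda>w. - (h * (w $ 2 * w $ 3) * (1 / w $ 2))])
     (map (\<lambda>f. f w) [\<lambda>w. Q, \<lambda>w. - (h * w $ 1 * (w $ 2 * w $ 3) * (1 / w $ 2) * w $ 4), \<lambda>w. Q * (w $ 2 * w $ 3) * w $ 4,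
        \<lambda>w. h * Q * (w $ 2 * w $ 3) * (1 / w $ 2) * w $ 4 / w $ 1,
        \<lambda>w. - (Q * (w $ 2 * w $ 3) * (1 / w $ 2)\<^sup>2 * w $ 4), \<lambda>w. Q * (w $ 4)\<^sup>2]) r) (region q)"
  proof (rule holomorphic_several_reg_series[OF norm_Q_less_1 open_region])
    show "norm (- (h * (w $ 2 * w $ 3) * (1 / w $ 2))) < 1" if "w \<in> region q" for w
      using region_coords(7)[OF that] by simp
  next
    fix f :: "complex ^ 4 \<Rightarrow> complex" assume "f \<in> set [\<lambda>w. - (h * (w $ 2 * w $ 3) * (1 / w $ 2) * (w $ 4)\<^sup>2), \<lambda>w. Q * w $ 4 / w $ 1, \<lambda>w. - (h * w $ 4 * (1 / w $ 2)),
        \<lambda>w. - (w $ 1 * w $ 4), \<lambda>w. - (h * (w $ 2 * w $ 3) * (1 / w $ 2))] \<union> set [\<lambda>w. Q, \<lambda>w. - (h * w $ 1 * (w $ 2 * w $ 3) * (1 / w $ 2) * w $ 4), \<lambda>w. Q * (w $ 2 * w $ 3) * w $ 4,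
        \<lambda>w. h * Q * (w $ 2 * w $ 3) * (1 / w $ 2) * w $ 4 / w $ 1,
        \<lambda>w. - (Q * (w $ 2 * w $ 3) * (1 / w $ 2)\<^sup>2 * w $ 4), \<lambda>w. Q * (w $ 4)\<^sup>2]"
    then show "holomorphic_several f (region q)"
      unfolding list.set Un_iff insert_iff empty_iff simp_thms
      by (elim disjE; hypsubst; intro region_intros; simp add: region_iff)
  qed (intro region_intros; simp add: region_iff)+
  then show ?thesis unfolding reg_left_def by simp
qed

lemma holomorphic_several_reg_right: "holomorphic_several (\<lambda>w. reg_right Q (w $ 1) (1 / w $ 2) (w $ 2 * w $ 3) (w $ 4)) (region q)"
proof -
  have "holomorphic_several (\<lambda>w. \<Sum>r. reg_term (Q\<^sup>2) (- (Q * (w $ 2 * w $ 3) * w $ 4 ^ 4 / w $ 1))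
     (- (Q * w $ 1 * (w $ 2 * w $ 3) * (1 / w $ 2)\<^sup>2)) (- (Q\<^sup>2 * w $ 1 * (w $ 2 * w $ 3) * (w $ 4)\<^sup>2))
     (map (\<lambda>f. f w) [\<lambda>w. - (Q * (w $ 2 * w $ 3) * w $ 4 ^ 4 / w $ 1), \<lambda>w. Q\<^sup>2 * (w $ 4)\<^sup>2 / (w $ 1)\<^sup>2, \<lambda>w. - (Q * (w $ 4)\<^sup>2),
        \<lambda>w. - ((w $ 4)\<^sup>2), \<lambda>w. - (Q * (w $ 2 * w $ 3) / w $ 1)])
     (map (\<lambda>f. f w) [\<lambda>w. Q\<^sup>2, \<lambda>w. - (Q * w $ 1 * (w $ 2 * w $ 3) * (w $ 4)\<^sup>2), \<lambda>w. Q\<^sup>2 * (w $ 2 * w $ 3) * (w $ 4)\<^sup>2 / w $ 1,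
        \<lambda>w. Q ^ 3 * (w $ 2 * w $ 3) * (w $ 4)\<^sup>2 / w $ 1,
        \<lambda>w. - (Q\<^sup>2 * (w $ 2 * w $ 3) * (1 / w $ 2)\<^sup>2 * (w $ 4)\<^sup>2 / w $ 1), \<lambda>w. Q\<^sup>2 * w $ 4 ^ 4]) r) (region q)"
  proof (rule holomorphic_several_reg_series[OF norm_Q2_less_1 open_region])
    show "norm (- (Q * w $ 1 * (w $ 2 * w $ 3) * (1 / w $ 2)\<^sup>2)) < 1" if "w \<in> region q" for w
      using region_coords(8)[OF that] by simp
  next
    fix f :: "complex ^ 4 \<Rightarrow> complex" assume "f \<in> set [\<lambda>w. - (Q * (w $ 2 * w $ 3) * w $ 4 ^ 4 / w $ 1), \<lambda>w. Q\<^sup>2 * (w $ 4)\<^sup>2 / (w $ 1)\<^sup>2, \<lambda>w. - (Q * (w $ 4)\<^sup>2),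
        \<lambda>w. - ((w $ 4)\<^sup>2), \<lambda>w. - (Q * (w $ 2 * w $ 3) / w $ 1)] \<union> set [\<lambda>w. Q\<^sup>2, \<lambda>w. - (Q * w $ 1 * (w $ 2 * w $ 3) * (w $ 4)\<^sup>2), \<lambda>w. Q\<^sup>2 * (w $ 2 * w $ 3) * (w $ 4)\<^sup>2 / w $ 1,
        \<lambda>w. Q ^ 3 * (w $ 2 * w $ 3) * (w $ 4)\<^sup>2 / w $ 1,
        \<lambda>w. - (Q\<^sup>2 * (w $ 2 * w $ 3) * (1 / w $ 2)\<^sup>2 * (w $ 4)\<^sup>2 / w $ 1), \<lambda>w. Q\<^sup>2 * w $ 4 ^ 4]"
    then show "holomorphic_several f (region q)"
      unfolding list.set Un_iff insert_iff empty_iff simp_thms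
      by (elim disjE; hypsubst; intro region_intros; simp add: region_iff)
  qed (intro region_intros; simp add: region_iff)+
  then show ?thesis unfolding reg_right_def by simp
qed

text \<open>Nonvanishing of these infinite products implies that the series is defined. Hence their product
  vanishes at every point where \<open>left_side\<close> involves a division by zero, and can serve as the
  denominator of a meromorphic function.\<close>

lemma left_side_quotient:
  assumes nz: "al \<noteq> 0" "v \<noteq> 0" "s \<noteq> 0" "z \<noteq> 0" and conv: "norm (h * s * v) < 1"
    and den: "den_left Q h al v s z \<noteq> 0"
    and E: "qinf (- (h * al * s * v * z)) Q \<noteq> 0" "qinf (Q * s * z) Q \<noteq> 0"
      "qinf (h * Q * s * v * z / al) Q \<noteq> 0" "qinf (- (Q * s * v\<^sup>2 * z)) Q \<noteq> 0"
  shows "left_side q al (1 / v) (s * v) z = reg_left Q h al v s z / den_left Q h al v s z"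
proof -
  note p = qpoch_nonzero_if_qinf[OF norm_Q_less_1]
  have hd: "qinf (- (h * s * v * z\<^sup>2)) Q = (1 - - (h * s * v * z\<^sup>2)) * qinf (- (h * Q * s * v * z\<^sup>2)) Q"
    using qinf_head[OF norm_Q_less_1, of "- (h * s * v * z\<^sup>2)"] by (simp add: mult_ac)
  have d: "qinf (h * s * v) Q \<noteq> 0" "qinf (Q\<^sup>2 * s * z\<^sup>2 / al) Q \<noteq> 0" "qinf (Q * z\<^sup>2) Q \<noteq> 0"
    "1 - - (h * s * v * z\<^sup>2) \<noteq> 0" "qinf (- (h * Q * s * v * z\<^sup>2)) Q \<noteq> 0"
    using den unfolding den_left_def hd by (metis mult_eq_0_iff)+
  have "left_denom q al (1 / v) (s * v) z \<noteq> 0"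
    unfolding left_denom_eq[OF nz] using d by simp
  moreover have "- (h * s * v * z\<^sup>2) \<noteq> 1" using d(4) by (metis right_minus_eq)
  then have "W87_defined (left_a0 q (s * v) z) (left_params q al (1 / v) (s * v) z) Q"
    unfolding left_defined_iff[OF nz] using p[OF E(1)] p[OF E(2)] p[OF E(3)] p[OF E(4)] p[OF d(3)] by blast
  ultimately have "left_side q al (1 / v) (s * v) z * den_left Q h al v s z = reg_left Q h al v s z"
    by (rule left_side_regularized[OF nz conv])
  then show ?thesis using den by (simp add: field_simps)
qed

lemma right_side_quotient:
  assumes nz: "al \<noteq> 0" "v \<noteq> 0" "s \<noteq> 0" "z \<noteq> 0" and conv: "norm (Q * al * s * v\<^sup>2) < 1"
    and den: "den_right Q al s z \<noteq> 0"
    and E: "qinf (- (Q * al * s * z\<^sup>2)) (Q\<^sup>2) \<noteq> 0" "qinf (- (Q\<^sup>2 * s * v\<^sup>2 * z\<^sup>2 / al)) (Q\<^sup>2) \<noteq> 0"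
  shows "right_side q al (1 / v) (s * v) z
    = qinf (- (Q * al * s * v\<^sup>2)) (Q\<^sup>2) * reg_right Q al v s z / den_right Q al s z"
proof -
  note p = qpoch_nonzero_if_qinf[OF norm_Q2_less_1]
  have hd: "qinf (- (Q * s * z ^ 4 / al)) (Q\<^sup>2) = (1 - - (Q * s * z ^ 4 / al)) * qinf (- (Q ^ 3 * s * z ^ 4 / al)) (Q\<^sup>2)"
    using qinf_head[OF norm_Q2_less_1, of "- (Q * s * z ^ 4 / al)"] by (simp add: mult_ac power2_eq_square power3_eq_cube)
  have d: "qinf (Q\<^sup>2 * s * z\<^sup>2 / al) (Q\<^sup>2) \<noteq> 0" "qinf (Q ^ 3 * s * z\<^sup>2 / al) (Q\<^sup>2) \<noteq> 0" "qinf (Q\<^sup>2 * z ^ 4) (Q\<^sup>2) \<noteq> 0"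
    "1 - - (Q * s * z ^ 4 / al) \<noteq> 0" "qinf (- (Q ^ 3 * s * z ^ 4 / al)) (Q\<^sup>2) \<noteq> 0"
    using den unfolding den_right_def hd by (metis mult_eq_0_iff)+
  have "right_denom q al (1 / v) (s * v) z \<noteq> 0"
    unfolding right_denom_eq[OF nz] using d by simp
  moreover have "- (Q * s * z ^ 4 / al) \<noteq> 1" using d(4) by (metis right_minus_eq)
  then have "W87_defined (right_a0 q al (1 / v) (s * v) z) (right_params q al (1 / v) (s * v) z) (Q\<^sup>2)"
    unfolding right_defined_iff[OF nz] using p[OF E(1)] p[OF E(2)] p[OF d(1)] p[OF d(2)] p[OF d(3)] by blast
  ultimately have "right_side q al (1 / v) (s * v) z * den_right Q al s z
      = qinf (- (Q * al * s * v\<^sup>2)) (Q\<^sup>2) * reg_right Q al v s z"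
    by (rule right_side_regularized[OF nz conv])
  then show ?thesis using den by (simp add: field_simps)
qed

lemma meromorphic_quotient:
  assumes "holomorphic_several G (region q)" "holomorphic_several H (region q)"
    and "\<And>w. w \<in> region q \<Longrightarrow> countable {t. 0 < t \<and> H (scale_xz w t) = 0}"
    and "\<And>w. w \<in> region q \<Longrightarrow> H w \<noteq> 0 \<Longrightarrow> f w = G w / H w"
  shows "meromorphic_several f (region q)"
  unfolding meromorphic_several_def
proof (intro conjI ballI)
  show "open (region q)" by (rule open_region)
  fix w0 assume w0: "w0 \<in> region q"
  have "interior {w \<in> region q. H w = 0} = {}"
    by (rule interior_zeros_empty) (rule assms(3))
  with w0 assms(1,2,4) show "\<exists>U g h. w0 \<in> U \<and> U \<subseteq> region q \<and> holomorphic_several g U \<and> holomorphic_several h U \<and>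
      interior {v \<in> U. h v = 0} = {} \<and> (\<forall>v\<in>U. h v \<noteq> 0 \<longrightarrow> f v = g v / h v)"
    by (intro exI[of _ "region q"] exI[of _ G] exI[of _ H]) auto
qed

lemma meromorphic_left:
  "meromorphic_several (\<lambda>w. left_side q (w $ 1) (w $ 2) (w $ 3) (w $ 4)) (region q)"
proof -
  define E where "E al v s z = qinf (- (h * al * s * v * z)) Q * qinf (Q * s * z) Q *
    qinf (h * Q * s * v * z / al) Q * qinf (- (Q * s * v\<^sup>2 * z)) Q" for al v s z
  define H where "H w = den_left Q h (w $ 1) (1 / w $ 2) (w $ 2 * w $ 3) (w $ 4) * E (w $ 1) (1 / w $ 2) (w $ 2 * w $ 3) (w $ 4)" for w :: "complex ^ 4"
  define G where "G w = reg_left Q h (w $ 1) (1 / w $ 2) (w $ 2 * w $ 3) (w $ 4) * E (w $ 1) (1 / w $ 2) (w $ 2 * w $ 3) (w $ 4)" for w :: "complex ^ 4"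
  have hE: "holomorphic_several (\<lambda>w. E (w $ 1) (1 / w $ 2) (w $ 2 * w $ 3) (w $ 4)) (region q)"
    unfolding E_def by (intro region_intros; simp add: region_iff)
  show ?thesis
  proof (rule meromorphic_quotient)
    show "holomorphic_several G (region q)"
      unfolding G_def by (intro holomorphic_several_mult hE holomorphic_several_reg_left)
    show "holomorphic_several H (region q)"
      unfolding H_def den_left_def by (intro holomorphic_several_mult hE; intro region_intros; simp add: region_iff)
    fix w assume w: "w \<in> region q"
    then have nz: "w $ 1 \<noteq> 0" "w $ 2 \<noteq> 0" "w $ 3 \<noteq> 0" "w $ 4 \<noteq> 0" by (simp_all add: region_iff)
    note nzQ = Q_nonzero h_nonzero
    show "countable {t. 0 < t \<and> H (scale_xz w t) = 0}"
      unfolding H_def den_left_def E_def scale_xz_nth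
      by (intro countable_prod_zeros,
          (rule countable_zeros_monomial[OF norm_Q_less_1, where k = 1]; use nz nzQ in \<open>simp add: power_mult_distrib eval_nat_numeral\<close>),
          (rule countable_zeros_monomial[OF norm_Q_less_1, where k = 3]; use nz nzQ in \<open>simp add: power_mult_distrib eval_nat_numeral\<close>),
          (rule countable_zeros_monomial[OF norm_Q_less_1, where k = 3]; use nz nzQ in \<open>simp add: power_mult_distrib eval_nat_numeral\<close>),
          simp add: qinf_nonzero_if_qpoch[OF norm_Q_less_1] qpoch_self_nonzero[OF norm_Q_less_1],
          (rule countable_zeros_monomial[OF norm_Q_less_1, where k = 2]; use nz nzQ in \<open>simp add: power_mult_distrib eval_nat_numeral\<close>),
          (rule countable_zeros_monomial[OF norm_Q_less_1, where k = 2]; use nz nzQ in \<open>simp add: power_mult_distrib eval_nat_numeral\<close>),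
          (rule countable_zeros_monomial[OF norm_Q_less_1, where k = 2]; use nz nzQ in \<open>simp add: power_mult_distrib eval_nat_numeral\<close>),
          (rule countable_zeros_monomial[OF norm_Q_less_1, where k = 2]; use nz nzQ in \<open>simp add: power_mult_distrib eval_nat_numeral\<close>),
          (rule countable_zeros_monomial[OF norm_Q_less_1, where k = 2]; use nz nzQ in \<open>simp add: power_mult_distrib eval_nat_numeral\<close>))
    assume "H w \<noteq> 0"
    then have Hz: "den_left Q h (w $ 1) (1 / w $ 2) (w $ 2 * w $ 3) (w $ 4) \<noteq> 0" "E (w $ 1) (1 / w $ 2) (w $ 2 * w $ 3) (w $ 4) \<noteq> 0"
      by (auto simp: H_def)
    have "left_side q (w $ 1) (w $ 2) (w $ 3) (w $ 4)
      = reg_left Q h (w $ 1) (1 / w $ 2) (w $ 2 * w $ 3) (w $ 4) / den_left Q h (w $ 1) (1 / w $ 2) (w $ 2 * w $ 3) (w $ 4)"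
      using left_side_quotient[OF region_coords(3-7)[OF w] Hz(1)] Hz(2) unfolding E_def region_coords(1,2)[OF w] by simp
    then show "left_side q (w $ 1) (w $ 2) (w $ 3) (w $ 4) = G w / H w"
      using Hz(2) by (simp add: G_def H_def)
  qed
qed

lemma meromorphic_right:
  "meromorphic_several (\<lambda>w. right_side q (w $ 1) (w $ 2) (w $ 3) (w $ 4)) (region q)"
proof -
  define E where "E al v s z = qinf (- (Q * al * s * z\<^sup>2)) (Q\<^sup>2) * qinf (- (Q\<^sup>2 * s * v\<^sup>2 * z\<^sup>2 / al)) (Q\<^sup>2)" for al v s z
  define H where "H w = den_right Q (w $ 1) (w $ 2 * w $ 3) (w $ 4) * E (w $ 1) (1 / w $ 2) (w $ 2 * w $ 3) (w $ 4)" for w :: "complex ^ 4"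
  define G where "G w = qinf (- (Q * w $ 1 * (w $ 2 * w $ 3) * (1 / w $ 2)\<^sup>2)) (Q\<^sup>2)
    * reg_right Q (w $ 1) (1 / w $ 2) (w $ 2 * w $ 3) (w $ 4) * E (w $ 1) (1 / w $ 2) (w $ 2 * w $ 3) (w $ 4)" for w :: "complex ^ 4"
  have hE: "holomorphic_several (\<lambda>w. E (w $ 1) (1 / w $ 2) (w $ 2 * w $ 3) (w $ 4)) (region q)"
    unfolding E_def by (intro region_intros; simp add: region_iff)
  have hP: "holomorphic_several (\<lambda>w. qinf (- (Q * w $ 1 * (w $ 2 * w $ 3) * (1 / w $ 2)\<^sup>2)) (Q\<^sup>2)) (region q)"
    by (intro region_intros; simp add: region_iff)
  show ?thesis
  proof (rule meromorphic_quotient)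
    show "holomorphic_several G (region q)"
      unfolding G_def by (intro holomorphic_several_mult hE hP holomorphic_several_reg_right)
    show "holomorphic_several H (region q)"
      unfolding H_def den_right_def by (intro holomorphic_several_mult hE; intro region_intros; simp add: region_iff)
    fix w assume w: "w \<in> region q"
    then have nz: "w $ 1 \<noteq> 0" "w $ 2 \<noteq> 0" "w $ 3 \<noteq> 0" "w $ 4 \<noteq> 0" by (simp_all add: region_iff)
    note nzQ = Q_nonzero h_nonzero
    show "countable {t. 0 < t \<and> H (scale_xz w t) = 0}"
      unfolding H_def den_right_def E_def scale_xz_nth
      by (intro countable_prod_zeros,
          (rule countable_zeros_monomial[OF norm_Q2_less_1, where k = 5]; use nz nzQ in \<open>simp add: power_mult_distrib eval_nat_numeral\<close>),
          simp add: qinf_nonzero_if_qpoch[OF norm_Q2_less_1] qpoch_self_nonzero[OF norm_Q2_less_1],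
          (rule countable_zeros_monomial[OF norm_Q2_less_1, where k = 3]; use nz nzQ in \<open>simp add: power_mult_distrib eval_nat_numeral\<close>),
          (rule countable_zeros_monomial[OF norm_Q2_less_1, where k = 3]; use nz nzQ in \<open>simp add: power_mult_distrib eval_nat_numeral\<close>),
          (rule countable_zeros_monomial[OF norm_Q2_less_1, where k = 4]; use nz nzQ in \<open>simp add: power_mult_distrib eval_nat_numeral\<close>),
          (rule countable_zeros_monomial[OF norm_Q2_less_1, where k = 3]; use nz nzQ in \<open>simp add: power_mult_distrib eval_nat_numeral\<close>),
          (rule countable_zeros_monomial[OF norm_Q2_less_1, where k = 3]; use nz nzQ in \<open>simp add: power_mult_distrib eval_nat_numeral\<close>))
    assume "H w \<noteq> 0"
    then have Hz: "den_right Q (w $ 1) (w $ 2 * w $ 3) (w $ 4) \<noteq> 0" "E (w $ 1) (1 / w $ 2) (w $ 2 * w $ 3) (w $ 4) \<noteq> 0"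
      by (auto simp: H_def)
    have "right_side q (w $ 1) (w $ 2) (w $ 3) (w $ 4)
      = qinf (- (Q * w $ 1 * (w $ 2 * w $ 3) * (1 / w $ 2)\<^sup>2)) (Q\<^sup>2)
         * reg_right Q (w $ 1) (1 / w $ 2) (w $ 2 * w $ 3) (w $ 4) / den_right Q (w $ 1) (w $ 2 * w $ 3) (w $ 4)"
      using right_side_quotient[OF region_coords(3-6,8)[OF w] Hz(1)] Hz(2) unfolding E_def region_coords(1,2)[OF w] by simp
    then show "right_side q (w $ 1) (w $ 2) (w $ 3) (w $ 4) = G w / H w"
      using Hz(2) by (simp add: G_def H_def)
  qed
qed

end

section \<open>The quadratic transformation\<close>

theorem corollary5p2:
  fixes q :: real
  assumes "0 < q" and "q < 1"
  shows "meromorphic_several (\<lambda>w :: complex ^ 4. left_side q (w $ 1) (w $ 2) (w $ 3) (w $ 4))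
           {w. param_domain q (w $ 1) (w $ 2) (w $ 3) (w $ 4)}
         \<and> meromorphic_several (\<lambda>w :: complex ^ 4. right_side q (w $ 1) (w $ 2) (w $ 3) (w $ 4))
           {w. param_domain q (w $ 1) (w $ 2) (w $ 3) (w $ 4)}
         \<and> (\<forall>\<alpha> \<beta> x z. param_domain q \<alpha> \<beta> x z \<longrightarrow>
           left_denom q \<alpha> \<beta> x z \<noteq> 0 \<longrightarrow>
           W87_defined (left_a0 q x z) (left_params q \<alpha> \<beta> x z) (of_real q) \<longrightarrow>
           right_denom q \<alpha> \<beta> x z \<noteq> 0 \<longrightarrow>
           W87_defined (right_a0 q \<alpha> \<beta> x z) (right_params q \<alpha> \<beta> x z) (of_real q ^ 2) \<longrightarrow>
           left_side q \<alpha> \<beta> x z = right_side q \<alpha> \<beta> x z)"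
proof (intro conjI allI impI)
  show "meromorphic_several (\<lambda>w :: complex ^ 4. left_side q (w $ 1) (w $ 2) (w $ 3) (w $ 4))
           {w. param_domain q (w $ 1) (w $ 2) (w $ 3) (w $ 4)}"
    using meromorphic_left[OF assms refl refl] by (simp only: region_def)
  show "meromorphic_several (\<lambda>w :: complex ^ 4. right_side q (w $ 1) (w $ 2) (w $ 3) (w $ 4))
           {w. param_domain q (w $ 1) (w $ 2) (w $ 3) (w $ 4)}"
    using meromorphic_right[OF assms refl refl] by (simp only: region_def)
  fix \<alpha> \<beta> x z
  assume dom: "param_domain q \<alpha> \<beta> x z" and dl: "left_denom q \<alpha> \<beta> x z \<noteq> 0"
    and L: "W87_defined (left_a0 q x z) (left_params q \<alpha> \<beta> x z) (of_real q)"
    and dr: "right_denom q \<alpha> \<beta> x z \<noteq> 0"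
    and R: "W87_defined (right_a0 q \<alpha> \<beta> x z) (right_params q \<alpha> \<beta> x z) (of_real q ^ 2)"
  have nz: "\<alpha> \<noteq> 0" "1 / \<beta> \<noteq> 0" "\<beta> * x \<noteq> 0" "z \<noteq> 0"
    and conv: "norm (of_real (q powr (1/2)) * (\<beta> * x) * (1 / \<beta>)) < 1"
      "norm (of_real q * \<alpha> * (\<beta> * x) * (1 / \<beta>)\<^sup>2) < 1"
    and \<beta>: "\<beta> = 1 / (1 / \<beta>)" and x: "\<beta> * x * (1 / \<beta>) = x"
    using dom by (auto simp: param_domain_def power2_eq_square mult.assoc)
  show "left_side q \<alpha> \<beta> x z = right_side q \<alpha> \<beta> x z"
    by (rule sides_equal[OF assms refl refl nz conv, unfolded x \<beta>[symmetric], OF dl dr L R])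
qed

end
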